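(* Let $a\in\mathbb{R}$, $b\in\mathbb{R}\setminus\{0\}$ and $T>0$. There exists $n_0\in\mathbb{N}$ such that the following holds for every integer $n\ge n_0$ which satisfies $$(-1)^{n+1}\,b\,T^2<\tfrac32\pi^2 ,$$ and, in case $a+(-1)^nb>0$, also $n>\tfrac1\pi T\,(a+(-1)^nb)^{1/2}$. Let $x_n(t)$ denote the unique periodic orbit, with minimal period $p_n=2T/n$ and strictly positive Hamiltonian $H=\tfrac12(x')^2+\tfrac12(a+(-1)^nb)x^2+\tfrac14x^4$, of the non-delayed Duffing oscillator $$x''+(a+(-1)^nb)x+x^3=0 .$$ Then $x_n(t)$, regarded as a periodic solution of the delayed Duffing equation $$x''(t)+a\,x(t)+b\,x(t-T)+x^3(t)=0,$$ is linearly stable if and only if $(-1)^nb<0$, and it is linearly unstable if and only if $(-1)^nb>0$.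
   Context: Uniqueness of $x_n$ is up to time shift; normalize $x_n(0)=A_n>0$, $x_n'(0)=0$. Periodic orbits of the non-delayed Duffing oscillator with $H>0$ satisfy $x(t+p/2)=-x(t)$, where $p$ is the minimal period; hence $x_n(t-T)=(-1)^nx_n(t)$ and $x_n$ also solves the delayed equation. Linear (in)stability. Write the delayed equation as a first order system for $\mathbf{x}=(x,x')$ with phase space $\mathcal{X}=C^0([-T,0],\mathbb{R}^2)$, $\mathbf{x}_t(\vartheta)=\mathbf{x}(t+\vartheta)$ for $-T\le\vartheta\le0$. For a periodic solution $x$ of minimal period $p$, let $\Pi:\mathcal{X}\to\mathcal{X}$, $\mathbf{y}_0\mapsto\mathbf{y}_p$, be the time-$p$ map of the linearized equation $y''(t)+a\,y(t)+b\,y(t-T)+3x(t)^2y(t)=0$, $\mathbf{y}=(y,y')$. Some power of $\Pi$ is compact. The nonzero eigenvalues of $\Pi$ (on the complexification of $\mathcal{X}$) are the Floquet multipliers of $x$. The value $1$ is always a (trivial) Floquet multiplier, with eigenvector given by the time derivative of the periodic solution. The periodic solution is called linearly stable if the trivial Floquet multiplier $1$ is algebraically simple and all other Floquet multipliers $\mu$ satisfy $|\mu|<1$. It is called linearly unstable if there is a Floquet multiplier with $|\mu|>1$. *)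

theory Defs
  imports "HOL-Analysis.Analysis" "HOL-Library.Function_Algebras"
begin

definition minimal_period :: "(real \<Rightarrow> real) \<Rightarrow> real \<Rightarrow> bool" where
  "minimal_period x p \<longleftrightarrow>
     p > 0 \<and> (\<forall>t. x (t + p) = x t) \<and> (\<forall>q. 0 < q \<and> q < p \<longrightarrow> \<not> (\<forall>t. x (t + q) = x t))"

definition duffing_solution :: "real \<Rightarrow> (real \<Rightarrow> real) \<Rightarrow> bool" where
  "duffing_solution \<alpha> x \<longleftrightarrow>
     (\<forall>t. (x has_real_derivative deriv x t) (at t) \<and>
          (deriv x has_real_derivative (- (\<alpha> * x t) - x t ^ 3)) (at t))"

definition delayed_duffing_solution :: "real \<Rightarrow> real \<Rightarrow> real \<Rightarrow> (real \<Rightarrow> real) \<Rightarrow> bool" where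
  "delayed_duffing_solution a b T x \<longleftrightarrow>
     (\<forall>t. (x has_real_derivative deriv x t) (at t) \<and>
          (deriv x has_real_derivative (- (a * x t) - b * x (t - T) - x t ^ 3)) (at t))"

definition hamiltonian :: "real \<Rightarrow> real \<Rightarrow> real \<Rightarrow> real" where
  "hamiltonian \<alpha> u v = 1/2 * v^2 + 1/2 * \<alpha> * u^2 + 1/4 * u^4"

text \<open>The conditions at time 0 normalize the time shift, up to which the orbit is unique.\<close>

definition normalized_duffing_orbit :: "real \<Rightarrow> real \<Rightarrow> (real \<Rightarrow> real) \<Rightarrow> bool" where
  "normalized_duffing_orbit \<alpha> p x \<longleftrightarrow>
     duffing_solution \<alpha> x \<and> minimal_period x p \<and>
     (\<forall>t. hamiltonian \<alpha> (x t) (deriv x t) > 0) \<and>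
     x 0 > 0 \<and> deriv x 0 = 0"

text \<open>
  The space of continuous functions on the interval from \<open>-T\<close> to \<open>0\<close>. Elements are extended by
  zero outside of the interval, so that equality and the vector space operations are those of
  functions on the interval. The phase space is the instance with values in \<open>real \<times> real\<close>; its
  complexification is the instance with values in \<open>complex \<times> complex\<close>.
\<close>

definition phase_space :: "real \<Rightarrow> (real \<Rightarrow> 'a::{topological_space,zero}) set" where
  "phase_space T = {\<phi>. continuous_on {-T..0} \<phi> \<and> (\<forall>\<theta>. \<theta> \<notin> {-T..0} \<longrightarrow> \<phi> \<theta> = 0)}"

definition segment :: "real \<Rightarrow> (real \<Rightarrow> 'a::zero) \<Rightarrow> real \<Rightarrow> (real \<Rightarrow> 'a)" where
  "segment T y t = (\<lambda>\<theta>. if \<theta> \<in> {-T..0} then y (t + \<theta>) else 0)"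

text \<open>
  The linearization at \<open>x\<close>, as a first order system for \<open>(y, y')\<close>. The two components of the
  initial history are unrelated; the equation holds for \<open>t \<ge> 0\<close> only (one-sided at \<open>0\<close>).
\<close>

definition linearized_solution ::
  "real \<Rightarrow> real \<Rightarrow> real \<Rightarrow> (real \<Rightarrow> real) \<Rightarrow> (real \<Rightarrow> real \<times> real) \<Rightarrow> (real \<Rightarrow> real \<times> real) \<Rightarrow> bool" where
  "linearized_solution a b T x \<phi> y \<longleftrightarrow>
     continuous_on {-T..} y \<and> segment T y 0 = \<phi> \<and>
     (\<forall>t\<ge>0. (y has_vector_derivative
               (snd (y t), - (a * fst (y t)) - b * fst (y (t - T)) - 3 * (x t)^2 * fst (y t)))
             (at t within {0..}))"

text \<open>
  For \<open>\<phi>\<close> in the phase space the initial value problem has a solution, unique on \<open>{-T..}\<close>,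
  so the time-\<open>p\<close> map does not depend on the choice made here.
\<close>

definition monodromy ::
  "real \<Rightarrow> real \<Rightarrow> real \<Rightarrow> (real \<Rightarrow> real) \<Rightarrow> real \<Rightarrow> (real \<Rightarrow> real \<times> real) \<Rightarrow> (real \<Rightarrow> real \<times> real)" where
  "monodromy a b T x p \<phi> = segment T (SOME y. linearized_solution a b T x \<phi> y) p"

definition complexify ::
  "((real \<Rightarrow> real \<times> real) \<Rightarrow> (real \<Rightarrow> real \<times> real)) \<Rightarrow>
   (real \<Rightarrow> complex \<times> complex) \<Rightarrow> (real \<Rightarrow> complex \<times> complex)" where
  "complexify L \<phi> =
     (let u = L (\<lambda>\<theta>. (Re (fst (\<phi> \<theta>)), Re (snd (\<phi> \<theta>))));
          v = L (\<lambda>\<theta>. (Im (fst (\<phi> \<theta>)), Im (snd (\<phi> \<theta>))))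
      in (\<lambda>\<theta>. (Complex (fst (u \<theta>)) (fst (v \<theta>)), Complex (snd (u \<theta>)) (snd (v \<theta>)))))"

definition cscale :: "complex \<Rightarrow> (real \<Rightarrow> complex \<times> complex) \<Rightarrow> (real \<Rightarrow> complex \<times> complex)" where
  "cscale c \<phi> = (\<lambda>\<theta>. (c * fst (\<phi> \<theta>), c * snd (\<phi> \<theta>)))"

lemma vector_space_cscale: "vector_space cscale"
  by unfold_locales (auto simp: cscale_def fun_eq_iff algebra_simps)

definition floquet_multipliers ::
  "real \<Rightarrow> real \<Rightarrow> real \<Rightarrow> (real \<Rightarrow> real) \<Rightarrow> real \<Rightarrow> complex set" where
  "floquet_multipliers a b T x p =
     {\<mu>. \<mu> \<noteq> 0 \<and>
         (\<exists>\<phi>\<in>phase_space T. \<phi> \<noteq> 0 \<and> complexify (monodromy a b T x p) \<phi> = cscale \<mu> \<phi>)}"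

definition generalized_eigenspace ::
  "real \<Rightarrow> real \<Rightarrow> real \<Rightarrow> (real \<Rightarrow> real) \<Rightarrow> real \<Rightarrow> complex \<Rightarrow> (real \<Rightarrow> complex \<times> complex) set" where
  "generalized_eigenspace a b T x p \<mu> =
     {\<phi>\<in>phase_space T.
        \<exists>k. ((\<lambda>\<psi>. complexify (monodromy a b T x p) \<psi> - cscale \<mu> \<psi>) ^^ k) \<phi> = 0}"

definition algebraic_multiplicity ::
  "real \<Rightarrow> real \<Rightarrow> real \<Rightarrow> (real \<Rightarrow> real) \<Rightarrow> real \<Rightarrow> complex \<Rightarrow> nat" where
  "algebraic_multiplicity a b T x p \<mu> = vector_space.dim cscale (generalized_eigenspace a b T x p \<mu>)"

definition linearly_stable :: "real \<Rightarrow> real \<Rightarrow> real \<Rightarrow> (real \<Rightarrow> real) \<Rightarrow> real \<Rightarrow> bool" where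
  "linearly_stable a b T x p \<longleftrightarrow>
     algebraic_multiplicity a b T x p 1 = 1 \<and>
     (\<forall>\<mu>\<in>floquet_multipliers a b T x p. \<mu> \<noteq> 1 \<longrightarrow> cmod \<mu> < 1)"

definition linearly_unstable :: "real \<Rightarrow> real \<Rightarrow> real \<Rightarrow> (real \<Rightarrow> real) \<Rightarrow> real \<Rightarrow> bool" where
  "linearly_unstable a b T x p \<longleftrightarrow> (\<exists>\<mu>\<in>floquet_multipliers a b T x p. cmod \<mu> > 1)"

end

theory Submission
  imports Defs
begin

text \<open>
  Let \<open>\<tau> = T / n\<close>. Since \<open>x (t + \<tau>) = - x t\<close>, the linearization has \<open>\<tau>\<close>-periodic coefficients, and every
  Floquet multiplier is \<open>\<rho>\<^sup>2\<close> for some solution with \<open>y (t + \<tau>) = \<rho> y t\<close>. For such a solution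
  \<open>y (t - T) = \<rho> ^ (- n) y t\<close>, so that the delay disappears: with \<open>\<sigma> = - \<rho>\<close>, time rescaled by \<open>\<tau>\<close> and
  \<open>u s = \<tau> x (\<tau> s)\<close>, what remains is the Hill equation \<open>y'' + (\<eta> + \<delta> + 3 u\<^sup>2) y = 0\<close> where
  \<open>\<eta> = \<tau>\<^sup>2 \<alpha>\<close> and \<open>\<delta> = \<beta> / n\<^sup>2 (\<sigma> ^ (- n) - 1)\<close>, \<open>\<beta> = (-1) ^ n b T\<^sup>2\<close>. Both parameters are small for
  \<open>\<bar>\<sigma>\<bar> \<ge> 1\<close> and large \<open>n\<close>, and the trace of the monodromy matrix is \<open>- 2 + \<delta> / 3 + o(\<delta>)\<close>, that is,
  \<open>(\<sigma> - 1)\<^sup>2 / \<sigma> = - \<delta> / 3 + o(\<delta>)\<close>. Writing \<open>\<sigma> = exp (\<zeta> / n)\<close>, the limit \<open>n \<rightarrow> \<infinity>\<close> gives the characteristic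
  equation \<open>\<zeta>\<^sup>2 + k (1 - exp (- \<zeta>)) = 0\<close> with \<open>k = - \<beta> / 3\<close>. For \<open>0 < k < \<pi>\<^sup>2 / 2\<close> its only root with
  nonnegative real part is \<open>0\<close>; this is the bound in the theorem. For \<open>k < 0\<close> the intermediate value
  theorem yields a multiplier \<open>\<sigma>\<^sup>2 > 1\<close>.
\<close>

section \<open>Gronwall estimates and delay equations\<close>

text \<open>The error in the trace has to be small relative to \<delta>, not just small: \<sigma> =
  1 is always a root, \<delta> vanishes there, and all candidates with modulus at least 1 accumulate
  at 1 as n grows. Hence the comparison with explicit solutions at \<delta> = 0. There u' is
  antiperiodic, so that -1 is a double eigenvalue of a matrix of determinant 1; the second solution
  u + s u' comes from the scaling \<open>\<lambda> * u (\<lambda> * s)\<close>, which is a symmetry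
  for \<eta> = 0. Away from \<zeta> = 0 a compactness argument leads to the limit equation; near 0
  the linear term k \<zeta> dominates \<open>\<zeta>\<^sup>2\<close>. The threshold arises from
  \<open>\<bar>\<zeta>\<bar>\<^sup>2 \<le> 2 * k < pi\<^sup>2\<close>, which confines Im \<zeta> to
  the range where sin has the sign of its argument. Locating the multipliers leaves the multiplicity
  of 1 open. For this, the monodromy is factored as the square of the shift S by \<tau>, and
  \<open>S\<^sup>2 - 1 = (S - 1) * (S + 1)\<close> separates the periodic from the antiperiodic
  part. Both equivalences reduce to two implications, because stability and instability exclude each
  other and b is nonzero.\<close>

lemma gronwall_scalar:
  fixes g g' :: "real \<Rightarrow> real"
  assumes der: "\<And>t. t \<in> {0..R} \<Longrightarrow> (g has_real_derivative g' t) (at t within {0..R})"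
    and le: "\<And>t. t \<in> {0..R} \<Longrightarrow> g' t \<le> k * g t"
    and t: "t \<in> {0..R}"
  shows "g t \<le> g 0 * exp (k * t)"
proof -
  define h where "h = (\<lambda>t. g t * exp (- (k * t)))"
  have dh: "(h has_real_derivative (g' s - k * g s) * exp (- (k * s))) (at s within {0..R})"
    if "s \<in> {0..R}" for s
    unfolding h_def
    by (rule derivative_eq_intros der[OF that] refl)+ (simp add: algebra_simps)
  have "h t \<le> h 0"
  proof (rule DERIV_nonpos_imp_decreasing_open[where f = h])
    show "0 \<le> t" using t by simp
    show "\<exists>y. (h has_real_derivative y) (at s) \<and> y \<le> 0" if "0 < s" "s < t" for s
    proof -
      have s: "s \<in> {0..R}" "s \<in> {0<..<R}" using that t by auto
      then have "(h has_real_derivative (g' s - k * g s) * exp (- (k * s))) (at s)"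
        using dh[OF s(1)] by (simp add: at_within_Icc_at)
      moreover have "(g' s - k * g s) * exp (- (k * s)) \<le> 0"
        using le[OF s(1)] by (simp add: mult_le_0_iff)
      ultimately show ?thesis by blast
    qed
    have "continuous_on {0..R} h" using dh by (rule DERIV_continuous_on)
    then show "continuous_on {0..t} h" by (rule continuous_on_subset) (use t in auto)
  qed
  then have "g t * exp (- (k * t)) * exp (k * t) \<le> g 0 * exp (k * t)"
    by (intro mult_right_mono) (auto simp: h_def)
  then show ?thesis by (simp add: mult.assoc flip: exp_add)
qed

lemma has_derivative_norm_square:
  fixes r :: "real \<Rightarrow> 'a::real_inner"
  assumes "(r has_vector_derivative r') (at t within S)"
  shows "((\<lambda>t. (norm (r t))\<^sup>2) has_real_derivative 2 * (r t \<bullet> r')) (at t within S)"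
  unfolding power2_norm_eq_inner has_field_derivative_def
  by (rule derivative_eq_intros assms[unfolded has_vector_derivative_def] refl)+
     (auto simp: inner_commute)

lemma gronwall_second_order:
  fixes r r1 f :: "real \<Rightarrow> 'a::real_inner"
  assumes r: "\<And>t. t \<in> {0..R} \<Longrightarrow> (r has_vector_derivative r1 t) (at t within {0..R})"
    and r1: "\<And>t. t \<in> {0..R} \<Longrightarrow> (r1 has_vector_derivative f t) (at t within {0..R})"
    and f: "\<And>t. t \<in> {0..R} \<Longrightarrow> norm (f t) \<le> q * norm (r t) + F"
    and q: "0 \<le> q" and F: "0 \<le> F" and t: "t \<in> {0..R}"
  shows "(norm (r t))\<^sup>2 + (norm (r1 t))\<^sup>2 \<le> ((norm (r 0))\<^sup>2 + (norm (r1 0))\<^sup>2 + F\<^sup>2) * exp ((q + 2) * t)"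
proof -
  \<comment> \<open>Carrying the constant \<open>F\<^sup>2\<close> inside \<open>g\<close> absorbs
    the forcing term, so that \<open>g\<close> satisfies a homogeneous inequality.\<close>
  define g where "g = (\<lambda>t. (norm (r t))\<^sup>2 + (norm (r1 t))\<^sup>2 + F\<^sup>2)"
  define g' where "g' = (\<lambda>t. 2 * (r t \<bullet> r1 t) + 2 * (r1 t \<bullet> f t))"
  have dg: "(g has_real_derivative g' t) (at t within {0..R})" if "t \<in> {0..R}" for t
    unfolding g_def g'_def
    by (rule derivative_eq_intros has_derivative_norm_square r r1 that refl)+ simp
  have le: "g' t \<le> (q + 2) * g t" if t: "t \<in> {0..R}" for t
  proof -
    let ?x = "norm (r t)" and ?y = "norm (r1 t)"
    have 1: "r t \<bullet> r1 t \<le> ?x * ?y" by (rule norm_cauchy_schwarz)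
    have "r1 t \<bullet> f t \<le> ?y * norm (f t)" by (rule norm_cauchy_schwarz)
    also have "\<dots> \<le> ?y * (q * ?x + F)" by (intro mult_left_mono f t) auto
    finally have 2: "r1 t \<bullet> f t \<le> ?y * (q * ?x + F)" .
    have 3: "2 * (?x * ?y) \<le> ?x\<^sup>2 + ?y\<^sup>2" using sum_squares_bound[of ?x ?y] by simp
    have 4: "2 * (?y * F) \<le> ?y\<^sup>2 + F\<^sup>2" using sum_squares_bound[of ?y F] by simp
    have 5: "q * (2 * (?x * ?y)) \<le> q * (?x\<^sup>2 + ?y\<^sup>2)" using 3 q by (rule mult_left_mono)
    have "g' t \<le> 2 * (?x * ?y) + 2 * (?y * (q * ?x + F))" using 1 2 by (simp add: g'_def)
    also have "\<dots> = 2 * (?x * ?y) + q * (2 * (?x * ?y)) + 2 * (?y * F)"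
      by (simp add: algebra_simps)
    also have "\<dots> \<le> (?x\<^sup>2 + ?y\<^sup>2) + q * (?x\<^sup>2 + ?y\<^sup>2) + (?y\<^sup>2 + F\<^sup>2)"
      using 3 4 5 by linarith
    also have "\<dots> \<le> (q + 2) * g t" using q by (simp add: g_def algebra_simps)
    finally show ?thesis .
  qed
  have "g t \<le> g 0 * exp ((q + 2) * t)"
    by (rule gronwall_scalar[OF dg le t])
  then show ?thesis using zero_le_power2[of F] unfolding g_def by linarith
qed

text \<open>The unknown of the fixed point problem is the derivative, damped by \<open>exp (- L t)\<close>;
  recovering the solution by integration makes it continuous across \<open>0\<close>.\<close>

lemma delay_equation_exists:
  fixes F :: "real \<Rightarrow> 'a \<Rightarrow> 'a \<Rightarrow> 'a::banach" and \<phi> :: "real \<Rightarrow> 'a"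
  assumes T: "0 \<le> T"
    and F: "continuous_on UNIV (\<lambda>(t, y, z). F t y z)"
    and lip: "\<And>t y z y' z'. norm (F t y z - F t y' z') \<le> K * (norm (y - y') + norm (z - z'))"
    and zero: "\<And>t. norm (F t 0 0) \<le> C"
    and \<phi>: "continuous_on {-T..0} \<phi>"
  obtains y where "continuous_on {-T..} y" "\<And>t. t \<in> {-T..0} \<Longrightarrow> y t = \<phi> t"
    "\<And>t. 0 \<le> t \<Longrightarrow> (y has_vector_derivative F t (y t) (y (t - T))) (at t within {0..})"
proof -
  \<comment> \<open>In the zero space the Lipschitz bound says nothing about the sign of
    \<open>K\<close>, so that case is split off.\<close>
  have K: "0 \<le> K" if "\<exists>x::'a. x \<noteq> 0"
  proof -
    obtain x :: 'a where "x \<noteq> 0" using \<open>\<exists>x::'a. x \<noteq> 0\<close> by blast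
    then show ?thesis using order_trans[OF norm_ge_zero lip[of 0 x 0 0 0]]
      by (simp add: zero_le_mult_iff)
  qed
  show ?thesis
  proof (cases "\<exists>x::'a. x \<noteq> 0")
    case False
    then have "x = y" for x y :: 'a by metis
    then show ?thesis
      by (intro that[of "\<lambda>_. 0"]) (auto intro!: continuous_intros derivative_eq_intros)
  next
    case True
    note K = K[OF True]
    \<comment> \<open>Against the weight \<open>exp (L * t)\<close> an integration gains the factor
      \<open>1 / L\<close>. Each of the two state arguments of \<open>F\<close> then contributes at
      most \<open>K / L \<le> 1 / 4\<close>, which gives the contraction constant 1/2.\<close>
    define L where "L = 4 * K + 1"
    have L: "0 < L" using K by (simp add: L_def)
    define cl where "cl t = max (-T) (min t 0)" for t
    have cl: "cl t \<in> {-T..0}" for t using T by (auto simp: cl_def)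
    have \<phi>c: "continuous_on UNIV (\<lambda>t. \<phi> (cl t))"
      by (rule continuous_on_compose2[OF \<phi>]) (use cl in \<open>auto simp: cl_def intro!: continuous_intros\<close>)
    obtain M where M: "\<And>t. t \<in> {-T..0} \<Longrightarrow> norm (\<phi> t) \<le> M"
      using compact_imp_bounded[OF compact_continuous_image[OF \<phi> compact_Icc]]
      unfolding bounded_iff by blast
    have M0: "0 \<le> M" using order_trans[OF norm_ge_zero M[of 0]] T by simp
    define z where "z g s = exp (L * s) *\<^sub>R apply_bcontfun g s" for g :: "real \<Rightarrow>\<^sub>C 'a" and s
    have zc: "continuous_on S (z g)" for g S
      unfolding z_def by (intro continuous_intros continuous_on_apply_bcontfun)
    define Y where "Y g t = \<phi> (cl t) + integral {0..max t 0} (z g)" for g t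
    have dI: "((\<lambda>t. integral {0..t} (z g)) has_vector_derivative z g t) (at t within {0..})"
      if "0 \<le> t" for g t
    proof -
      have "((\<lambda>t. integral {0..t} (z g)) has_vector_derivative z g t) (at t within {0..t+1})"
        by (rule integral_has_vector_derivative) (use that zc in auto)
      then show ?thesis
        by (subst at_within_nhd[where S="{..<t+1}" and U="{0..t+1}"]) (use that in auto)
    qed
    have Yc: "continuous_on UNIV (Y g)" for g
    proof -
      have "continuous_on {0..} (\<lambda>t. integral {0..t} (z g))"
        using dI has_vector_derivative_continuous by (fastforce simp: continuous_on_eq_continuous_within)
      then have "continuous_on UNIV (\<lambda>t. integral {0..max t 0} (z g))"
        by (rule continuous_on_compose2) (auto intro!: continuous_intros)
      then show ?thesis unfolding Y_def by (intro continuous_intros \<phi>c)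
    qed
    have expint: "((\<lambda>s. exp (L * s)) has_integral (exp (L * t) - 1) / L) {0..t}" if "0 \<le> t" for t
    proof -
      have "((\<lambda>s. exp (L * s)) has_integral exp (L * t) / L - exp (L * 0) / L) {0..t}"
        using L that by (intro fundamental_theorem_of_calculus)
          (auto intro!: derivative_eq_intros simp flip: has_real_derivative_iff_has_vector_derivative)
      then show ?thesis by (simp add: diff_divide_distrib)
    qed
    have intbound: "norm (integral {0..t} f) \<le> N * exp (L * t) / L"
      if f: "continuous_on {0..t} f" "\<And>s. s \<in> {0..t} \<Longrightarrow> norm (f s) \<le> exp (L * s) * N"
        and t: "0 \<le> t" and N: "0 \<le> N" for f :: "real \<Rightarrow> 'a" and t N
    proof -
      have "norm (integral {0..t} f) \<le> integral {0..t} (\<lambda>s. exp (L * s) * N)"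
        by (rule integral_norm_bound_integral)
           (use f in \<open>auto intro!: integrable_continuous_interval continuous_intros\<close>)
      also have "\<dots> = (exp (L * t) - 1) / L * N"
        using has_integral_mult_left[OF expint[OF t]] by (rule integral_unique)
      also have "\<dots> \<le> N * exp (L * t) / L" using L N by (simp add: field_simps)
      finally show ?thesis .
    qed
    have Yb: "norm (Y g t) \<le> M + norm g * exp (L * max t 0) / L" for g t
    proof -
      have "norm (integral {0..max t 0} (z g)) \<le> norm g * exp (L * max t 0) / L"
        by (rule intbound[OF zc]) (auto simp: z_def norm_bounded intro!: mult_left_mono)
      then show ?thesis unfolding Y_def
        by (intro norm_triangle_le add_mono M cl)
    qed
    have Yd: "norm (Y g t - Y h t) \<le> dist g h * exp (L * max t 0) / L" for g h t
    proof -
      have "Y g t - Y h t = integral {0..max t 0} (\<lambda>s. z g s - z h s)"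
        unfolding Y_def by (subst integral_diff) (auto intro!: integrable_continuous_interval zc)
      also have "norm \<dots> \<le> dist g h * exp (L * max t 0) / L"
      proof (rule intbound)
        show "norm (z g s - z h s) \<le> exp (L * s) * dist g h" for s
          using norm_bounded[of "g - h" s]
          by (auto simp: z_def dist_norm simp flip: scaleR_diff_right)
      qed (auto intro!: continuous_intros zc)
      finally show ?thesis .
    qed
    \<comment> \<open>Clamping the time by \<open>max t 0\<close> makes \<open>G g\<close> bounded
      and continuous on the whole line, as the type of \<open>g\<close> demands; \<open>Y\<close>
      sees only the values at nonnegative times.\<close>
    define G where "G g t = exp (- (L * max t 0)) *\<^sub>R F (max t 0) (Y g (max t 0)) (Y g (max t 0 - T))" for g t
    have Gc: "continuous_on UNIV (G g)" for g
    proof -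
      have "continuous_on UNIV ((\<lambda>(t, y, z). F t y z) \<circ> (\<lambda>t. (max t 0, Y g (max t 0), Y g (max t 0 - T))))"
        by (intro continuous_on_compose continuous_on_subset[OF F] continuous_intros
              continuous_on_compose2[OF Yc]) auto
      then show ?thesis unfolding G_def o_def by (auto intro!: continuous_intros)
    qed
    have Kexp: "K * (exp (L * (s::real)) / L) * exp (- (L * s')) \<le> 1/4" if "s \<le> s'" for s s'
    proof -
      have "exp (L * s) * exp (- (L * s')) \<le> 1" using that L by (simp flip: exp_add)
      then have "K * (exp (L * s) * exp (- (L * s'))) \<le> K * 1" using K by (rule mult_left_mono)
      also have "\<dots> \<le> L / 4" by (simp add: L_def)
      finally show ?thesis using L by (simp add: field_simps)
    qed
    have Gd: "norm (G g t - G h t) \<le> 1/2 * dist g h" for g h t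
    proof -
      let ?t = "max t 0"
      let ?D = "dist g h"
      have "norm (G g t - G h t) = exp (- (L * ?t)) *
          norm (F ?t (Y g ?t) (Y g (?t - T)) - F ?t (Y h ?t) (Y h (?t - T)))"
        unfolding G_def by (simp flip: scaleR_diff_right)
      also have "\<dots> \<le> exp (- (L * ?t)) * (K * (?D * exp (L * max ?t 0) / L + ?D * exp (L * max (?t - T) 0) / L))"
        by (intro mult_left_mono order_trans[OF lip] add_mono Yd K) auto
      also have "\<dots> = ?D * (K * (exp (L * max ?t 0) / L) * exp (- (L * ?t)))
          + ?D * (K * (exp (L * max (?t - T) 0) / L) * exp (- (L * ?t)))"
        by (simp add: algebra_simps add_divide_distrib)
      also have "\<dots> \<le> ?D * (1/4) + ?D * (1/4)"
        by (intro add_mono mult_left_mono Kexp) (use T in auto)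
      finally show ?thesis by simp
    qed
    have Gbd: "norm (G g t) \<le> C + 2 * K * M + norm g" for g t
    proof -
      let ?t = "max t 0"
      have C: "0 \<le> C" using order_trans[OF norm_ge_zero zero] .
      have e1: "exp (- (L * ?t)) \<le> 1" using L by simp
      have "norm (F ?t (Y g ?t) (Y g (?t - T))) \<le>
         norm (F ?t 0 0) + norm (F ?t (Y g ?t) (Y g (?t - T)) - F ?t 0 0)"
        by (metis add.commute norm_triangle_sub)
      also have "\<dots> \<le> C + K * (norm (Y g ?t) + norm (Y g (?t - T)))"
        using lip[of ?t "Y g ?t" "Y g (?t - T)" 0 0] zero[of ?t] by simp
      also have "\<dots> \<le> C + K * ((M + norm g * exp (L * max ?t 0) / L) + (M + norm g * exp (L * max (?t - T) 0) / L))"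
        by (intro add_left_mono mult_left_mono add_mono Yb K)
      finally have "norm (G g t) \<le> exp (- (L * ?t)) * (C + K * ((M + norm g * exp (L * max ?t 0) / L) + (M + norm g * exp (L * max (?t - T) 0) / L)))"
        unfolding G_def by (simp add: mult_left_mono)
      also have "\<dots> = exp (- (L * ?t)) * (C + 2 * K * M) + norm g * (K * (exp (L * max ?t 0) / L) * exp (- (L * ?t)))
          + norm g * (K * (exp (L * max (?t - T) 0) / L) * exp (- (L * ?t)))"
        by (simp add: algebra_simps add_divide_distrib)
      also have "\<dots> \<le> 1 * (C + 2 * K * M) + norm g * (1/4) + norm g * (1/4)"
        by (intro add_mono mult_left_mono mult_right_mono Kexp e1) (use T C K M0 in auto)
      also have "\<dots> \<le> C + 2 * K * M + norm g" by simp
      finally show ?thesis .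
    qed
    have Gb: "G g \<in> bcontfun" for g
      by (rule bcontfun_normI[OF Gc Gbd])
    have "\<exists>!g. (Bcontfun (G g)) = g"
    proof (rule banach_fix_type[of "1/2"])
      show "\<forall>g h. dist (Bcontfun (G g)) (Bcontfun (G h)) \<le> 1/2 * dist g h"
      proof (intro allI dist_bound)
        show "dist (apply_bcontfun (Bcontfun (G g)) t) (apply_bcontfun (Bcontfun (G h)) t) \<le> 1/2 * dist g h"
          for g h t unfolding Bcontfun_inverse[OF Gb] dist_norm[of "G g t"] by (rule Gd)
      qed
    qed auto
    then obtain g where g: "Bcontfun (G g) = g" by auto
    have gG: "apply_bcontfun g = G g"
      by (subst g[symmetric]) (simp add: Bcontfun_inverse[OF Gb])
    have zg: "z g t = F t (Y g t) (Y g (t - T))" if "0 \<le> t" for t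
      using that unfolding z_def gG G_def by (simp flip: exp_add)
    show ?thesis
    proof (rule that[of "Y g"])
      show "continuous_on {-T..} (Y g)" using Yc continuous_on_subset by blast
      show "Y g t = \<phi> t" if "t \<in> {-T..0}" for t
        using that by (auto simp: Y_def cl_def)
      show "(Y g has_vector_derivative F t (Y g t) (Y g (t - T))) (at t within {0..})" if t: "0 \<le> t" for t
      proof -
        have "((\<lambda>t. \<phi> 0 + integral {0..t} (z g)) has_vector_derivative z g t) (at t within {0..})"
          by (rule derivative_eq_intros dI t refl)+ simp
        then have "(Y g has_vector_derivative z g t) (at t within {0..})"
          by (rule has_vector_derivative_transform[rotated 2]) (use t T in \<open>auto simp: Y_def cl_def\<close>)
        then show ?thesis using zg[OF t] by simp
      qed
    qed
  qed
qed

text \<open>Method of steps: on each interval of length \<open>T\<close> the delayed arguments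
  already agree, so Gronwall with a Lipschitz bound in the undelayed argument suffices.\<close>

lemma delay_equation_unique:
  fixes F :: "real \<Rightarrow> 'a \<Rightarrow> 'a \<Rightarrow> 'a::real_inner"
  assumes T: "0 < T"
    and lip: "\<And>t y z y'. norm (F t y z - F t y' z) \<le> K * norm (y - y')"
    and y: "\<And>t. 0 \<le> t \<Longrightarrow> (y has_vector_derivative F t (y t) (y (t - T))) (at t within {0..})"
    and z: "\<And>t. 0 \<le> t \<Longrightarrow> (z has_vector_derivative F t (z t) (z (t - T))) (at t within {0..})"
    and eq: "\<And>t. t \<in> {-T..0} \<Longrightarrow> y t = z t"
    and t: "-T \<le> t"
  shows "y t = z t"
proof -
  have "\<forall>t\<in>{-T..real k * T}. y t = z t" for k
  proof (induction k)
    case 0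
    then show ?case using eq by auto
  next
    case (Suc k)
    let ?c = "real k * T"
    have c: "0 \<le> ?c" using T by simp
    define d where "d = (\<lambda>s. y (s + ?c) - z (s + ?c))"
    define g where "g = (\<lambda>s. (norm (d s))\<^sup>2)"
    have sh: "((\<lambda>s. f (s + ?c)) has_vector_derivative f') (at s within {0..T})"
      if "(f has_vector_derivative f') (at (s + ?c) within {0..})" "s \<in> {0..T}" for f f' and s
    proof -
      have "((f \<circ> (\<lambda>s. s + ?c)) has_vector_derivative 1 *\<^sub>R f') (at s within {0..T})"
        by (rule vector_diff_chain_within)
           (use that(2) order_trans[OF c] in \<open>auto intro!: derivative_eq_intros has_vector_derivative_within_subset[OF that(1)]\<close>)
      then show ?thesis by (simp add: o_def)
    qed
    have "g s \<le> g 0 * exp (2 * K * s)" if s: "s \<in> {0..T}" for s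
    proof (rule gronwall_scalar[OF _ _ s])
      fix s assume s: "s \<in> {0..T}"
      let ?s = "s + ?c"
      let ?d = "F ?s (y ?s) (y (?s - T)) - F ?s (z ?s) (z (?s - T))"
      have "(d has_vector_derivative ?d) (at s within {0..T})"
        unfolding d_def by (intro has_vector_derivative_diff sh y z) (use s c in auto)
      then show "(g has_real_derivative 2 * (d s \<bullet> ?d)) (at s within {0..T})"
        unfolding g_def by (rule has_derivative_norm_square)
      have "y (?s - T) = z (?s - T)" using Suc s c T by (auto simp: algebra_simps)
      then have "norm ?d \<le> K * norm (d s)" using lip by (simp add: d_def)
      then have "d s \<bullet> ?d \<le> norm (d s) * (K * norm (d s))"
        by (meson norm_cauchy_schwarz mult_left_mono norm_ge_zero order_trans)
      then show "2 * (d s \<bullet> ?d) \<le> 2 * K * g s" by (simp add: g_def power2_eq_square mult.left_commute)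
    qed
    moreover have "?c \<in> {-T..?c}" using order_trans[OF _ c, of "- T"] T by auto
    then have "g 0 = 0" using Suc by (simp add: g_def d_def)
    ultimately have d0: "d s = 0" if "s \<in> {0..T}" for s
      using that by (simp add: g_def)
    show ?case
    proof
      fix t assume "t \<in> {-T..real (Suc k) * T}"
      then consider "t \<in> {-T..?c}" | "t - ?c \<in> {0..T}" by (fastforce simp: algebra_simps)
      then show "y t = z t"
      proof cases
        case 2
        then show ?thesis using d0[of "t - ?c"] by (simp add: d_def)
      qed (use Suc in auto)
    qed
  qed
  moreover obtain k where "t / T < real k" using reals_Archimedean2 by blast
  then have "t \<le> real k * T" using T by (simp add: field_simps)
  ultimately show ?thesis using t by auto
qed

section \<open>Orbits of the Duffing oscillator\<close>

lemma antiderivative_exists: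
  fixes g :: "real \<Rightarrow> real"
  assumes g: "continuous_on UNIV g"
  obtains G where "\<And>x. (G has_real_derivative g x) (at x)" "G 0 = 0"
proof -
  \<comment> \<open>An oriented integral: for \<open>x \<noteq> 0\<close> one of the two intervals
    is empty.\<close>
  define G where "G x = integral {0..x} g - integral {x..0} g" for x
  have "G 0 = 0" by (simp add: G_def)
  moreover have "(G has_real_derivative g x) (at x)" for x
  proof -
    define R where "R = \<bar>x\<bar> + 1"
    have gi: "g integrable_on {a..b}" for a b
      by (intro integrable_continuous_real continuous_on_subset[OF g]) auto
    have GR: "G y = integral {-R..y} g - integral {-R..0} g" if "y \<in> {-R<..<R}" for y
    proof (cases "0 \<le> y")
      case True
      have "- R \<le> 0" by (simp add: R_def)
      from Henstock_Kurzweil_Integration.integral_combine[OF this True gi]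
      have "integral {-R..0} g + integral {0..y} g = integral {-R..y} g" .
      moreover have "integral {y..0} g = 0"
        using True by (cases "y = 0") auto
      ultimately show ?thesis by (simp add: G_def)
    next
      case False
      then show ?thesis using Henstock_Kurzweil_Integration.integral_combine[OF _ _ gi, of "-R" y 0] that by (simp add: G_def)
    qed
    have xR: "x \<in> {-R<..<R}" by (auto simp: R_def)
    have "((\<lambda>y. integral {-R..y} g) has_real_derivative g x) (at x within {-R..R})"
      by (rule integral_has_real_derivative) (use xR continuous_on_subset[OF g] in auto)
    then have "((\<lambda>y. integral {-R..y} g) has_real_derivative g x) (at x)"
      using xR by (simp add: at_within_Icc_at)
    then have "((\<lambda>y. integral {-R..y} g - integral {-R..0} g) has_real_derivative g x) (at x)"
      by (auto intro!: derivative_eq_intros)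
    then show ?thesis
      by (rule has_field_derivative_transform_within_open[where S="{-R<..<R}"]) (use xR GR in auto)
  qed
  ultimately show ?thesis using that by blast
qed

text \<open>Separation of variables: an antiderivative \<open>G\<close> of \<open>1 / f\<close> is
  time as a function of phase, and \<open>\<theta>\<close> is its inverse. Periodicity of
  \<open>f\<close> gives \<open>G (x + P) = G x + G P\<close>, hence the time in which the phase
  advances by \<open>P\<close>.\<close>

lemma phase_equation_exists:
  fixes f :: "real \<Rightarrow> real"
  assumes f: "continuous_on UNIV f" and pos: "\<And>\<theta>. 0 < f \<theta>" and bdd: "\<And>\<theta>. f \<theta> \<le> M"
    and per: "\<And>\<theta>. f (\<theta> + P) = f \<theta>" and P: "0 \<le> P"
  obtains \<theta> where "\<theta> 0 = 0" "\<And>t. (\<theta> has_real_derivative f (\<theta> t)) (at t)"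
    "\<And>t. \<theta> (t + integral {0..P} (\<lambda>s. 1 / f s)) = \<theta> t + P"
proof -
  have "continuous_on UNIV (\<lambda>s. 1 / f s)"
    using pos by (intro continuous_intros f) (metis less_irrefl)
  then obtain G where dG: "\<And>x. (G has_real_derivative 1 / f x) (at x)" and G0: "G 0 = 0"
    using antiderivative_exists by blast
  have M: "0 < M" using less_le_trans[OF pos bdd] .
  have inc: "G x < G y" if "x < y" for x y
    using DERIV_pos_imp_increasing[OF that, of G] dG pos by (metis divide_pos_pos zero_less_one)
  have inj: "inj G" by (metis inc injI linorder_neq_iff)
  have Gc: "isCont G x" for x using dG by (rule DERIV_isCont)
  \<comment> \<open>Speed at most \<open>M\<close> means that \<open>G\<close> grows at least like
    \<open>x / M\<close>. So \<open>G\<close> is onto, and \<open>\<theta>\<close> exists for all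
    times.\<close>
  have lin: "G x - x / M \<le> G y - y / M" if "x \<le> y" for x y
  proof (rule DERIV_nonneg_imp_nondecreasing[OF that])
    fix s
    have "((\<lambda>x. G x - x / M) has_real_derivative 1 / f s - 1 / M) (at s)"
      using M by (auto intro!: derivative_eq_intros dG)
    moreover have "0 \<le> 1 / f s - 1 / M" using pos bdd M by (simp add: frac_le)
    ultimately show "\<exists>y. ((\<lambda>x. G x - x / M) has_real_derivative y) (at s) \<and> 0 \<le> y" by blast
  qed
  have "\<exists>x. G x = t" for t
  proof -
    have "\<exists>x\<ge>- (M * \<bar>t\<bar>). x \<le> M * \<bar>t\<bar> \<and> G x = t"
      using lin[of 0 "M * \<bar>t\<bar>"] lin[of "- (M * \<bar>t\<bar>)" 0] M G0
      by (intro IVT') (auto intro!: continuous_at_imp_continuous_on Gc mult_nonneg_nonneg)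
    then show ?thesis by blast
  qed
  then have surj: "surj G" by (metis surjI)
  define \<theta> where "\<theta> = inv G"
  have G\<theta>: "G (\<theta> t) = t" for t unfolding \<theta>_def by (rule surj_f_inv_f[OF surj])
  have \<theta>G: "\<theta> (G x) = x" for x unfolding \<theta>_def by (rule inv_f_f[OF inj])
  have \<theta>c: "isCont \<theta> t" for t
    using isCont_inverse_function[of 1 "\<theta> t" \<theta> G] \<theta>G Gc G\<theta> by simp
  have d\<theta>: "(\<theta> has_real_derivative f (\<theta> t)) (at t)" for t
    using DERIV_inverse_function[OF dG, of \<theta> t "t - 1" "t + 1"] G\<theta> \<theta>c pos[of "\<theta> t"] by auto
  have "((\<lambda>x. G (x + P) - G x) has_real_derivative 0) (at x)" for x
  proof -
    have "((\<lambda>x. G (x + P)) has_real_derivative 1 / f (x + P)) (at x)"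
      using dG[of "x + P"] by (simp add: DERIV_shift)
    from DERIV_diff[OF this dG] show ?thesis by (simp add: per)
  qed
  then have "G (x + P) - G x = G (0 + P) - G 0" for x
    by (intro DERIV_isconst_all) auto
  then have GP: "G (x + P) = G x + G P" for x using G0 by (metis add.commute add_0 diff_0_right diff_eq_eq)
  have "((\<lambda>s. 1 / f s) has_integral G P - G 0) {0..P}"
    using P by (intro fundamental_theorem_of_calculus)
      (auto intro: has_field_derivative_at_within dG simp flip: has_real_derivative_iff_has_vector_derivative)
  then have "integral {0..P} (\<lambda>s. 1 / f s) = G P" using G0 by (simp add: integral_unique)
  moreover have "\<theta> (t + G P) = \<theta> t + P" for t
    using \<theta>G[of "\<theta> t + P"] GP[of "\<theta> t"] G\<theta>[of t] by simp
  moreover have "\<theta> 0 = 0" using \<theta>G[of 0] G0 by simp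
  ultimately show ?thesis using that d\<theta> by simp
qed

text \<open>Inserting \<open>x = A * cos \<theta>\<close> into the energy of amplitude
  \<open>A\<close> and cancelling \<open>(A * sin \<theta>)\<^sup>2\<close> leaves
  \<open>\<theta>' = phase_speed \<alpha> A \<theta>\<close>. In this angle the turning points of
  the oscillation are not singular.\<close>

definition phase_speed :: "real \<Rightarrow> real \<Rightarrow> real \<Rightarrow> real" where
  "phase_speed \<alpha> A \<theta> = sqrt (\<alpha> + A\<^sup>2 * (1 + (cos \<theta>)\<^sup>2) / 2)"

definition half_period :: "real \<Rightarrow> real \<Rightarrow> real" where
  "half_period \<alpha> A = integral {0..pi} (\<lambda>\<theta>. 1 / phase_speed \<alpha> A \<theta>)"

lemma phase_speed_bounds:
  shows "sqrt (\<alpha> + A\<^sup>2 / 2) \<le> phase_speed \<alpha> A \<theta>" "phase_speed \<alpha> A \<theta> \<le> sqrt (\<alpha> + A\<^sup>2)"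
proof -
  have "(cos \<theta>)\<^sup>2 \<le> 1" by (simp add: abs_square_le_1)
  then have "A\<^sup>2 * (1 + (cos \<theta>)\<^sup>2) \<le> A\<^sup>2 * 2" by (intro mult_left_mono) auto
  moreover have "A\<^sup>2 * 1 \<le> A\<^sup>2 * (1 + (cos \<theta>)\<^sup>2)" by (intro mult_left_mono) auto
  ultimately show "sqrt (\<alpha> + A\<^sup>2 / 2) \<le> phase_speed \<alpha> A \<theta>" "phase_speed \<alpha> A \<theta> \<le> sqrt (\<alpha> + A\<^sup>2)"
    by (auto simp: phase_speed_def)
qed

lemma phase_speed_pos: "0 < \<alpha> + A\<^sup>2 / 2 \<Longrightarrow> 0 < phase_speed \<alpha> A \<theta>"
  using less_le_trans[OF _ phase_speed_bounds(1)] by simp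

lemma phase_speed_square:
  assumes "0 < \<alpha> + A\<^sup>2 / 2"
  shows "(phase_speed \<alpha> A \<theta>)\<^sup>2 = \<alpha> + A\<^sup>2 * (1 + (cos \<theta>)\<^sup>2) / 2"
  using phase_speed_pos[OF assms, of \<theta>] unfolding phase_speed_def by simp

lemma continuous_on_phase_speed: "continuous_on S (phase_speed \<alpha> A)"
  unfolding phase_speed_def by (intro continuous_intros) auto

lemma half_period_integrand:
  "0 < \<alpha> + A\<^sup>2 / 2 \<Longrightarrow> continuous_on S (\<lambda>\<theta>. 1 / phase_speed \<alpha> A \<theta>)"
  using phase_speed_pos by (intro continuous_intros continuous_on_phase_speed) (metis less_irrefl)

lemma half_period_bounds:
  assumes "0 < \<alpha> + A\<^sup>2 / 2"
  shows "pi / sqrt (\<alpha> + A\<^sup>2) \<le> half_period \<alpha> A" "half_period \<alpha> A \<le> pi / sqrt (\<alpha> + A\<^sup>2 / 2)"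
proof -
  note i = integrable_continuous_interval[OF half_period_integrand[OF assms]]
  have "integral {0..pi} (\<lambda>_. 1 / sqrt (\<alpha> + A\<^sup>2)) \<le> half_period \<alpha> A"
    unfolding half_period_def
    by (intro integral_le i) (auto intro!: divide_left_mono phase_speed_bounds mult_pos_pos phase_speed_pos assms
        less_le_trans[OF phase_speed_pos[OF assms] phase_speed_bounds(2)])
  then show "pi / sqrt (\<alpha> + A\<^sup>2) \<le> half_period \<alpha> A" by simp
  have "half_period \<alpha> A \<le> integral {0..pi} (\<lambda>_. 1 / sqrt (\<alpha> + A\<^sup>2 / 2))"
    unfolding half_period_def
    by (intro integral_le i) (use assms in \<open>auto intro!: divide_left_mono phase_speed_bounds mult_pos_pos phase_speed_pos\<close>)
  then show "half_period \<alpha> A \<le> pi / sqrt (\<alpha> + A\<^sup>2 / 2)" by simp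
qed

text \<open>The cubic force hardens the spring, so the phase moves faster at larger amplitude. This
  makes the orbit of a given period unique.\<close>

lemma half_period_strict_antimono:
  assumes A: "0 < \<alpha> + A\<^sup>2 / 2" and AB: "0 \<le> A" "A < B"
  shows "half_period \<alpha> B < half_period \<alpha> A"
proof -
  have sq: "A\<^sup>2 < B\<^sup>2" using AB by (intro power_strict_mono) auto
  then have B: "0 < \<alpha> + B\<^sup>2 / 2" using A by simp
  have "phase_speed \<alpha> A \<theta> < phase_speed \<alpha> B \<theta>" for \<theta>
  proof -
    have "A\<^sup>2 * (1 + (cos \<theta>)\<^sup>2) < B\<^sup>2 * (1 + (cos \<theta>)\<^sup>2)"
      using sq by (intro mult_strict_right_mono) (auto intro: add_pos_nonneg)
    then show ?thesis by (simp add: phase_speed_def)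
  qed
  then show ?thesis unfolding half_period_def
    by (intro integral_less_real half_period_integrand A B)
       (auto simp: not_le intro!: divide_strict_left_mono mult_pos_pos phase_speed_pos A B)
qed

lemma continuous_on_half_period:
  "continuous_on {A. 0 < \<alpha> + A\<^sup>2 / 2} (half_period \<alpha>)"
proof -
  have "continuous_on ({A. 0 < \<alpha> + A\<^sup>2 / 2} \<times> cbox 0 pi) (\<lambda>(A, \<theta>). 1 / phase_speed \<alpha> A \<theta>)"
  proof -
    have "phase_speed \<alpha> A \<theta> \<noteq> 0" if "0 < \<alpha> + A\<^sup>2 / 2" for A \<theta>
      using phase_speed_pos[OF that] by (metis less_irrefl)
    then show ?thesis unfolding case_prod_beta
      by (intro continuous_on_divide continuous_on_const)
         (auto simp: phase_speed_def intro!: continuous_intros)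
  qed
  then show ?thesis
    unfolding half_period_def using integral_continuous_on_param by fastforce
qed

lemma duffing_orbit_exists:
  assumes A: "0 < A" and pos: "0 < \<alpha> + A\<^sup>2 / 2"
  obtains x where "duffing_solution \<alpha> x" "x 0 = A" "deriv x 0 = 0"
    "\<And>t. x (t + half_period \<alpha> A) = - x t" "minimal_period x (2 * half_period \<alpha> A)"
proof -
  let ?f = "phase_speed \<alpha> A" and ?K = "half_period \<alpha> A"
  have "?f (\<theta> + pi) = ?f \<theta>" for \<theta> by (simp add: phase_speed_def)
  then obtain \<theta> where \<theta>0: "\<theta> 0 = 0" and d\<theta>: "\<And>t. (\<theta> has_real_derivative ?f (\<theta> t)) (at t)"
    and \<theta>K: "\<And>t. \<theta> (t + ?K) = \<theta> t + pi"
    using phase_equation_exists[OF continuous_on_phase_speed phase_speed_pos[OF pos] phase_speed_bounds(2)]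
    unfolding half_period_def by (metis pi_ge_zero)
  note fp = phase_speed_pos[OF pos]
  define x where "x = (\<lambda>t. A * cos (\<theta> t))"
  define x1 where "x1 = (\<lambda>t. - A * sin (\<theta> t) * ?f (\<theta> t))"
  have dx: "(x has_real_derivative x1 t) (at t)" for t
    unfolding x_def x1_def by (rule derivative_eq_intros d\<theta> refl)+ simp
  have df: "(?f has_real_derivative - (A\<^sup>2 * cos s * sin s) / (2 * ?f s)) (at s)" for s
  proof -
    have "0 < \<alpha> + A\<^sup>2 * (1 + (cos s)\<^sup>2) / 2"
      using fp[of s] unfolding phase_speed_def by simp
    then show ?thesis unfolding phase_speed_def
      by (auto intro!: derivative_eq_intros simp: field_simps power2_eq_square)
  qed
  have dx1: "(x1 has_real_derivative - (\<alpha> * x t) - x t ^ 3) (at t)" for t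
  proof -
    let ?c = "cos (\<theta> t)" and ?s = "sin (\<theta> t)" and ?p = "?f (\<theta> t)"
    have "((\<lambda>t. ?f (\<theta> t)) has_real_derivative - (A\<^sup>2 * ?c * ?s) / (2 * ?p) * ?p) (at t)"
      using DERIV_chain[OF df d\<theta>] by (simp add: o_def)
    then have d: "((\<lambda>t. ?f (\<theta> t)) has_real_derivative - (A\<^sup>2 * ?c * ?s) / 2) (at t)"
      using fp[of "\<theta> t"] by (simp add: field_simps)
    have "(x1 has_real_derivative - A * (?c * ?p\<^sup>2 + ?s * (- (A\<^sup>2 * ?c * ?s) / 2))) (at t)"
      unfolding x1_def
      by (rule derivative_eq_intros d d\<theta> refl)+ (simp add: algebra_simps power2_eq_square)
    also have "- A * (?c * ?p\<^sup>2 + ?s * (- (A\<^sup>2 * ?c * ?s) / 2))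
        = - A * ?c * (\<alpha> + A\<^sup>2 * (1 + ?c\<^sup>2 - ?s\<^sup>2) / 2)"
      unfolding phase_speed_square[OF pos] by (simp add: field_simps power2_eq_square)
    also have "\<dots> = - (\<alpha> * x t) - x t ^ 3"
      unfolding sin_squared_eq by (simp add: x_def field_simps power2_eq_square power3_eq_cube)
    finally show ?thesis .
  qed
  have deriv: "deriv x = x1" using dx by (auto intro: DERIV_imp_deriv)
  have K: "0 < ?K"
    using half_period_bounds(1)[OF pos] less_le_trans[OF fp phase_speed_bounds(2)]
    by (meson divide_pos_pos pi_gt_zero less_le_trans)
  have anti: "x (t + ?K) = - x t" for t by (simp add: x_def \<theta>K)
  have mono: "\<theta> s < \<theta> t" if "s < t" for s t
    using DERIV_pos_imp_increasing[OF that, of \<theta>] d\<theta> fp by blast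
  show ?thesis
  proof (rule that)
    show "duffing_solution \<alpha> x" unfolding duffing_solution_def deriv using dx dx1 by blast
    show "x 0 = A" "deriv x 0 = 0" unfolding deriv by (simp_all add: x_def x1_def \<theta>0)
    show "x (t + ?K) = - x t" for t by (rule anti)
    show "minimal_period x (2 * ?K)" unfolding minimal_period_def
    proof (intro conjI allI impI notI)
      show "0 < 2 * ?K" using K by simp
      show "x (t + 2 * ?K) = x t" for t
        using anti[of "t + ?K"] anti[of t] by (simp add: algebra_simps)
      \<comment> \<open>A shorter period \<open>q\<close> would give
        \<open>cos (\<theta> q) = 1\<close> with \<open>0 < \<theta> q < 2 * pi\<close>.\<close>
      fix q assume q: "0 < q \<and> q < 2 * ?K" and "\<forall>t. x (t + q) = x t"
      then have "x (0 + q) = x 0" by blast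
      then have "cos (2 * (\<theta> q / 2)) = 1" using A by (simp add: x_def \<theta>0)
      then have "sin (\<theta> q / 2) = 0" unfolding cos_double_sin by simp
      moreover have "0 < \<theta> q" using mono[of 0 q] q \<theta>0 by simp
      moreover have "\<theta> q < 2 * pi"
        using mono[of q "0 + ?K + ?K"] q \<theta>K[of "0 + ?K"] \<theta>K[of 0] \<theta>0 by simp
      ultimately show False
        using sin_gt_zero[of "\<theta> q / 2"] by simp
    qed
  qed
qed

section \<open>Uniqueness of Duffing orbits with prescribed period\<close>

lemma duffing_solution_unique_forward:
  assumes x: "duffing_solution \<alpha> x" and y: "duffing_solution \<alpha> y"
    and 0: "x 0 = y 0" "deriv x 0 = deriv y 0" and t: "0 \<le> t"
  shows "x t = y t"
proof -
  have dx: "(x has_real_derivative deriv x s) (at s)" "(deriv x has_real_derivative - (\<alpha> * x s) - x s ^ 3) (at s)"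
    and dy: "(y has_real_derivative deriv y s) (at s)" "(deriv y has_real_derivative - (\<alpha> * y s) - y s ^ 3) (at s)" for s
    using x y by (auto simp: duffing_solution_def)
  \<comment> \<open>The cubic is not globally Lipschitz. The difference of the two right-hand sides
    factors as \<open>- Q s * (x s - y s)\<close>, and \<open>Q\<close> is bounded on the compact
    interval \<open>{0..t}\<close>.\<close>
  define Q where "Q s = \<alpha> + (x s)\<^sup>2 + x s * y s + (y s)\<^sup>2" for s
  have "isCont x s" "isCont y s" for s using dx dy DERIV_isCont by blast+
  then have "continuous_on {0..t} x" "continuous_on {0..t} y"
    by (auto intro: continuous_at_imp_continuous_on)
  then have "continuous_on {0..t} Q" unfolding Q_def by (intro continuous_intros)
  then have "bounded (Q ` {0..t})"
    using compact_Icc compact_continuous_image compact_imp_bounded by blast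
  then obtain q where q: "0 < q" "\<And>s. s \<in> {0..t} \<Longrightarrow> norm (Q s) \<le> q"
    unfolding bounded_pos by blast
  have "(norm (x t - y t))\<^sup>2 + (norm (deriv x t - deriv y t))\<^sup>2 \<le>
     ((norm (x 0 - y 0))\<^sup>2 + (norm (deriv x 0 - deriv y 0))\<^sup>2 + 0\<^sup>2) * exp ((q + 2) * t)"
  proof (rule gronwall_second_order[where R = t and f = "\<lambda>s. - Q s * (x s - y s)"])
    fix s assume s: "s \<in> {0..t}"
    show "((\<lambda>s. x s - y s) has_vector_derivative deriv x s - deriv y s) (at s within {0..t})"
      using DERIV_diff[OF dx(1) dy(1)]
      by (simp add: has_real_derivative_iff_has_vector_derivative has_vector_derivative_at_within)
    have "- Q s * (x s - y s) = (- (\<alpha> * x s) - x s ^ 3) - (- (\<alpha> * y s) - y s ^ 3)"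
      by (simp add: Q_def algebra_simps power2_eq_square power3_eq_cube)
    then show "((\<lambda>s. deriv x s - deriv y s) has_vector_derivative - Q s * (x s - y s)) (at s within {0..t})"
      using DERIV_diff[OF dx(2) dy(2)]
      by (simp add: has_real_derivative_iff_has_vector_derivative has_vector_derivative_at_within)
    show "norm (- Q s * (x s - y s)) \<le> q * norm (x s - y s) + 0"
      using mult_right_mono[OF q(2)[OF s], of "norm (x s - y s)"] by (simp add: abs_mult)
  qed (use t q in auto)
  then show ?thesis using 0 by (simp add: sum_power2_le_zero_iff)
qed

lemma duffing_solution_reflect:
  assumes "duffing_solution \<alpha> x"
  shows "duffing_solution \<alpha> (\<lambda>t. x (- t))" "deriv (\<lambda>t. x (- t)) t = - deriv x (- t)"
proof -
  have x: "(x has_real_derivative deriv x s) (at s)" "(deriv x has_real_derivative - (\<alpha> * x s) - x s ^ 3) (at s)" for s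
    using assms by (auto simp: duffing_solution_def)
  have 1: "((\<lambda>t. x (- t)) has_real_derivative - deriv x (- t)) (at t)" for t
    using x(1)[of "-t"] by (simp add: DERIV_mirror)
  then have d: "deriv (\<lambda>t. x (- t)) = (\<lambda>t. - deriv x (- t))"
    by (auto intro: DERIV_imp_deriv)
  then show "deriv (\<lambda>t. x (- t)) t = - deriv x (- t)" by simp
  have "((\<lambda>t. - deriv x (- t)) has_real_derivative - (\<alpha> * x (- t)) - x (- t) ^ 3) (at t)" for t
    using DERIV_minus[OF x(2)[of "-t", unfolded DERIV_mirror]] by (simp add: algebra_simps)
  then show "duffing_solution \<alpha> (\<lambda>t. x (- t))"
    unfolding duffing_solution_def d using 1 by blast
qed

lemma duffing_solution_unique:
  assumes "duffing_solution \<alpha> x" "duffing_solution \<alpha> y" "x 0 = y 0" "deriv x 0 = deriv y 0"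
  shows "x = y"
proof
  fix t :: real
  show "x t = y t"
  proof (cases "0 \<le> t")
    case True
    then show ?thesis by (rule duffing_solution_unique_forward[OF assms])
  next
    case False
    have "x (- (- t)) = y (- (- t))"
      by (rule duffing_solution_unique_forward[of \<alpha> "\<lambda>t. x (- t)" "\<lambda>t. y (- t)"])
         (use False assms duffing_solution_reflect in auto)
    then show ?thesis by simp
  qed
qed

lemma minimal_period_unique:
  assumes "minimal_period x p" "minimal_period x q" shows "p = q"
  using assms unfolding minimal_period_def by (metis linorder_neqE_linordered_idom)

text \<open>At time 0 the Hamiltonian is
  \<open>(\<alpha> + (x 0)\<^sup>2 / 2) * ((x 0)\<^sup>2 / 2)\<close>, so its positivity says
  exactly that the phase equation is admissible at amplitude \<open>x 0\<close>. By uniqueness the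
  orbit is the one constructed from that equation and inherits its antiperiodicity.\<close>

lemma normalized_duffing_orbitD:
  assumes "normalized_duffing_orbit \<alpha> (2 * \<tau>) x"
  shows "0 < \<alpha> + (x 0)\<^sup>2 / 2" "half_period \<alpha> (x 0) = \<tau>" "x (t + \<tau>) = - x t"
proof -
  have x: "duffing_solution \<alpha> x" "minimal_period x (2 * \<tau>)" "0 < x 0" "deriv x 0 = 0"
    and "0 < hamiltonian \<alpha> (x 0) (deriv x 0)"
    using assms unfolding normalized_duffing_orbit_def by blast+
  then have "0 < (\<alpha> + (x 0)\<^sup>2 / 2) * ((x 0)\<^sup>2 / 2)"
    by (simp add: hamiltonian_def algebra_simps power2_eq_square power4_eq_xxxx)
  then show pos: "0 < \<alpha> + (x 0)\<^sup>2 / 2" using x(3) by (simp add: zero_less_mult_iff)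
  obtain y where y: "duffing_solution \<alpha> y" "y 0 = x 0" "deriv y 0 = 0"
    "\<And>t. y (t + half_period \<alpha> (x 0)) = - y t" "minimal_period y (2 * half_period \<alpha> (x 0))"
    using duffing_orbit_exists[OF x(3) pos] by metis
  have "y = x" using x y by (intro duffing_solution_unique) auto
  with y(5) x(2) show K: "half_period \<alpha> (x 0) = \<tau>" using minimal_period_unique by fastforce
  show "x (t + \<tau>) = - x t" using y(4) K \<open>y = x\<close> by simp
qed

lemma hamiltonian_conserved:
  assumes "duffing_solution \<alpha> x"
  shows "hamiltonian \<alpha> (x t) (deriv x t) = hamiltonian \<alpha> (x 0) (deriv x 0)"
proof -
  have x: "(x has_real_derivative deriv x s) (at s)" "(deriv x has_real_derivative - (\<alpha> * x s) - x s ^ 3) (at s)" for s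
    using assms by (auto simp: duffing_solution_def)
  have "((\<lambda>t. hamiltonian \<alpha> (x t) (deriv x t)) has_real_derivative 0) (at s)" for s
    unfolding hamiltonian_def
    by (rule derivative_eq_intros x refl)+ (simp add: algebra_simps power2_eq_square power3_eq_cube)
  then show ?thesis by (intro DERIV_isconst_all) auto
qed

text \<open>Existence is the intermediate value theorem in the amplitude, starting from an
  admissible \<open>A0\<close> whose half period is too long; uniqueness is strict monotonicity of
  the half period.\<close>

lemma normalized_duffing_orbit_ex1:
  assumes A0: "0 < A0" "0 < \<alpha> + A0\<^sup>2 / 2" and \<tau>: "0 < \<tau>" "\<tau> < half_period \<alpha> A0"
  shows "\<exists>!x. normalized_duffing_orbit \<alpha> (2 * \<tau>) x"
proof (rule ex_ex1I)
  \<comment> \<open>Chosen so that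
    \<open>pi / \<tau> \<le> sqrt (\<alpha> + A1\<^sup>2 / 2)\<close>, which pushes the upper bound
    for the half period down to \<open>\<tau>\<close>; the summand \<open>A0\<^sup>2\<close> ensures
    \<open>A0 \<le> A1\<close>.\<close>
  define A1 where "A1 = sqrt (2 * (\<bar>\<alpha>\<bar> + (pi / \<tau>)\<^sup>2) + A0\<^sup>2)"
  have A1: "A1\<^sup>2 = 2 * (\<bar>\<alpha>\<bar> + (pi / \<tau>)\<^sup>2) + A0\<^sup>2"
    unfolding A1_def by (intro real_sqrt_pow2) auto
  have "(pi / \<tau>)\<^sup>2 \<le> \<alpha> + A1\<^sup>2 / 2" unfolding A1 by (simp add: add_divide_distrib) (use zero_le_power2[of A0] in linarith)
  then have 1: "pi / \<tau> \<le> sqrt (\<alpha> + A1\<^sup>2 / 2)" by (simp add: real_le_rsqrt)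
  moreover have "0 < pi / \<tau>" using \<tau> by simp
  ultimately have "0 < sqrt (\<alpha> + A1\<^sup>2 / 2)" by linarith
  then have pos1: "0 < \<alpha> + A1\<^sup>2 / 2" by simp
  have "pi / sqrt (\<alpha> + A1\<^sup>2 / 2) \<le> \<tau>" using 1 \<tau> pos1 by (simp add: field_simps)
  with half_period_bounds(2)[OF pos1] have le: "half_period \<alpha> A1 \<le> \<tau>" by linarith
  have "A0 \<le> A1" unfolding A1_def by (intro real_le_rsqrt) auto
  moreover have "continuous_on {A0..A1} (half_period \<alpha>)"
  proof (rule continuous_on_subset[OF continuous_on_half_period], safe)
    fix A assume "A \<in> {A0..A1}"
    then have "A0\<^sup>2 \<le> A\<^sup>2" using A0 by (intro power_mono) auto
    then show "0 < \<alpha> + A\<^sup>2 / 2" using A0 by simp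
  qed
  ultimately obtain A where A: "A0 \<le> A" "half_period \<alpha> A = \<tau>"
    using IVT2'[of "half_period \<alpha>" A1 \<tau> A0] le \<tau> by auto
  then have A: "A0\<^sup>2 \<le> A\<^sup>2" "0 < A" "half_period \<alpha> A = \<tau>" using A0 by auto
  then have pos: "0 < \<alpha> + A\<^sup>2 / 2" using A0 by linarith
  obtain x where x: "duffing_solution \<alpha> x" "x 0 = A" "deriv x 0 = 0" "minimal_period x (2 * \<tau>)"
    using duffing_orbit_exists[OF \<open>0 < A\<close> pos] A by metis
  have "0 < (\<alpha> + A\<^sup>2 / 2) * (A\<^sup>2 / 2)" using pos \<open>0 < A\<close> by (intro mult_pos_pos) auto
  also have "\<dots> = hamiltonian \<alpha> (x 0) (deriv x 0)"
    by (simp add: x hamiltonian_def algebra_simps power2_eq_square power4_eq_xxxx)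
  finally have "0 < hamiltonian \<alpha> (x 0) (deriv x 0)" .
  then have "0 < hamiltonian \<alpha> (x t) (deriv x t)"
    for t using hamiltonian_conserved[OF x(1), of t] by simp
  then show "\<exists>x. normalized_duffing_orbit \<alpha> (2 * \<tau>) x"
    using x \<open>0 < A\<close> by (auto simp: normalized_duffing_orbit_def)
next
  fix x y assume x: "normalized_duffing_orbit \<alpha> (2 * \<tau>) x" and y: "normalized_duffing_orbit \<alpha> (2 * \<tau>) y"
  then have "0 < x 0" "0 < y 0" by (auto simp: normalized_duffing_orbit_def)
  then have "x 0 = y 0"
    using half_period_strict_antimono[of \<alpha> "x 0" "y 0"] half_period_strict_antimono[of \<alpha> "y 0" "x 0"]
      normalized_duffing_orbitD[OF x] normalized_duffing_orbitD[OF y]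
    by (metis less_irrefl less_imp_le linorder_neqE_linordered_idom)
  then show "x = y"
    using x y by (intro duffing_solution_unique[of \<alpha>]) (auto simp: normalized_duffing_orbit_def)
qed

section \<open>The characteristic equation\<close>

lemma exp_minus_1_minus_id_bound:
  fixes z :: complex
  assumes "cmod z \<le> 1"
  shows "cmod (exp z - 1 - z) \<le> 3 * (cmod z)\<^sup>2"
proof -
  have "(\<Sum>k\<le>(1::nat). z ^ k / fact k) = 1 + z" by simp
  then have "cmod (exp z - 1 - z) \<le> exp \<bar>Re z\<bar> * (cmod z)\<^sup>2"
    using Taylor_exp[of z 1] by (simp add: diff_diff_eq power2_eq_square)
  also have "\<bar>Re z\<bar> \<le> 1" using abs_Re_le_cmod assms by (rule order_trans)
  then have "exp \<bar>Re z\<bar> \<le> 3" using exp_le by (meson exp_le_cancel_iff order_trans)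
  then have "exp \<bar>Re z\<bar> * (cmod z)\<^sup>2 \<le> 3 * (cmod z)\<^sup>2" by (intro mult_right_mono) auto
  finally show ?thesis .
qed

text \<open>Since \<open>\<bar>1 - exp (- \<zeta>)\<bar> \<le> 2\<close> in the right half plane,
  \<open>\<bar>\<zeta>\<bar>\<^sup>2 \<le> 2 * k < pi\<^sup>2\<close>. Then sin (Im \<zeta>) has the
  sign of Im \<zeta>, and the two sides of the imaginary part have incompatible signs unless Im
  \<zeta> = 0. A real \<zeta> has a square that the real part shows to be at most 0.\<close>

lemma characteristic_root_zero:
  fixes \<zeta> :: complex
  assumes eq: "\<zeta>\<^sup>2 = - of_real k * (1 - exp (- \<zeta>))" and k: "0 < k" "2 * k < pi\<^sup>2" and Re: "0 \<le> Re \<zeta>"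
  shows "\<zeta> = 0"
proof -
  let ?x = "Re \<zeta>" and ?w = "Im \<zeta>"
  have "(cmod \<zeta>)\<^sup>2 = k * cmod (1 - exp (- \<zeta>))"
    using arg_cong[OF eq, of cmod] k by (simp add: norm_power norm_mult)
  also have "cmod (1 - exp (- \<zeta>)) \<le> 1 + 1"
    using Re by (intro order_trans[OF norm_triangle_ineq4] add_mono) (auto simp: norm_exp_eq_Re)
  then have "k * cmod (1 - exp (- \<zeta>)) \<le> k * (1 + 1)" using k by (intro mult_left_mono) auto
  finally have "(cmod \<zeta>)\<^sup>2 < pi\<^sup>2" using k by simp
  then have "cmod \<zeta> < pi" by (rule power_less_imp_less_base) simp
  then have w: "- pi < ?w" "?w < pi" using abs_Im_le_cmod[of \<zeta>] by linarith+
  have im: "2 * ?x * ?w = - (k * exp (- ?x) * sin ?w)"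
    using arg_cong[OF eq, of Im] by (simp add: Im_exp Im_power2)
  have "?w = 0"
  proof (rule ccontr)
    assume "?w \<noteq> 0"
    then consider "0 < ?w" | "0 < - ?w" by linarith
    then show False
    proof cases
      case 1
      then have "0 < k * exp (- ?x) * sin ?w" using k w by (intro mult_pos_pos sin_gt_zero) auto
      moreover have "0 \<le> 2 * ?x * ?w" using Re 1 by simp
      ultimately show False using im by linarith
    next
      case 2
      then have "0 < k * exp (- ?x) * sin (- ?w)" using k w by (intro mult_pos_pos sin_gt_zero) auto
      moreover have "0 \<le> 2 * ?x * (- ?w)" using Re 2 by (intro mult_nonneg_nonneg) auto
      ultimately show False using im by simp
    qed
  qed
  moreover have "?x\<^sup>2 = - (k * (1 - exp (- ?x)))"
    using arg_cong[OF eq, of Re] \<open>?w = 0\<close> by (simp add: Re_exp power2_eq_square)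
  moreover have "0 \<le> k * (1 - exp (- ?x))" using k Re by simp
  ultimately have "?x\<^sup>2 \<le> 0" by linarith
  then show ?thesis using \<open>?w = 0\<close> by (simp add: complex_eq_iff)
qed

text \<open>Rescaling around 1: the bound \<open>b\<close> puts \<open>\<sigma>\<close> within order
  \<open>1 / n\<close> of 1, so that \<open>\<zeta> = n * Ln \<sigma>\<close> stays bounded and
  differs from \<open>n * (\<sigma> - 1)\<close> by order \<open>1 / n\<close>. The conditions on
  \<open>n\<close> keep \<open>\<sigma>\<close> so close to 1 that the logarithm and exponential
  estimates apply.\<close>

lemma multiplier_log:
  fixes \<sigma> :: complex and n :: nat
  assumes n: "0 < n" "8 * c \<le> (real n)\<^sup>2" "4 * sqrt (2 * c) < real n" and c: "0 < c"
    and \<sigma>: "1 \<le> cmod \<sigma>" "\<sigma> \<noteq> 1" and b: "(cmod (\<sigma> - 1))\<^sup>2 / cmod \<sigma> \<le> c / (real n)\<^sup>2"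
  obtains \<zeta> where "\<zeta> \<noteq> 0" "0 \<le> Re \<zeta>" "cmod \<zeta> \<le> 2 * sqrt (2 * c)" "inverse (\<sigma> ^ n) = exp (- \<zeta>)"
    "cmod (of_nat n * (\<sigma> - 1) - \<zeta>) \<le> 3 * (cmod \<zeta>)\<^sup>2 / real n" "cmod (\<sigma> - 1) \<le> sqrt (2 * c) / real n"
proof -
  define r where "r = cmod (\<sigma> - 1)"
  have r0: "0 \<le> r" by (simp add: r_def)
  have \<sigma>0: "\<sigma> \<noteq> 0" using \<sigma> by auto
  have "cmod \<sigma> \<le> 1 + r" unfolding r_def using norm_triangle_ineq[of 1 "\<sigma> - 1"] by simp
  have "r\<^sup>2 \<le> c / (real n)\<^sup>2 * cmod \<sigma>"
    using b \<sigma> \<sigma>0 by (simp add: r_def field_simps)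
  also have "\<dots> \<le> c / (real n)\<^sup>2 * (1 + r)"
    using c \<open>cmod \<sigma> \<le> 1 + r\<close> by (intro mult_left_mono) auto
  finally have r2: "r\<^sup>2 \<le> c / (real n)\<^sup>2 * (1 + r)" .
  \<comment> \<open>A bootstrap: \<open>cmod \<sigma>\<close> is itself at most
    \<open>1 + r\<close>, and \<open>r * r \<le> (1 + r) / 8\<close> excludes
    \<open>r > 1 / 2\<close>. With this crude bound the factor \<open>1 + r\<close> becomes 2 and
    the bound of order \<open>1 / n\<close> follows.\<close>
  have "c / (real n)\<^sup>2 \<le> 1 / 8" using n by (simp add: field_simps)
  then have "c / (real n)\<^sup>2 * (1 + r) \<le> 1 / 8 * (1 + r)" using r0 by (intro mult_right_mono) auto
  from order_trans[OF r2 this] have r8: "r * r \<le> 1 / 8 * (1 + r)" by (simp add: power2_eq_square)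
  have "r \<le> 1 / 2"
  proof (rule ccontr)
    assume "\<not> r \<le> 1 / 2"
    then have "1 / 2 * r \<le> r * r" by (intro mult_right_mono) auto
    from order_trans[OF this r8] have "1 / 2 * r \<le> 1 / 8 * (1 + r)" .
    then show False using \<open>\<not> r \<le> 1 / 2\<close> by (simp add: field_simps)
  qed
  then have "c / (real n)\<^sup>2 * (1 + r) \<le> c / (real n)\<^sup>2 * 2" using c by (intro mult_left_mono) auto
  then have "r\<^sup>2 \<le> (sqrt (2 * c) / real n)\<^sup>2"
    using r2 c by (simp add: power_divide)
  then have r: "r \<le> sqrt (2 * c) / real n" by (rule power2_le_imp_le) (use c in simp)
  also have "\<dots> < 1 / 4" using n by (simp add: field_simps)
  finally have r4: "r < 1 / 4" .
  define L where "L = Ln \<sigma>"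
  have eL: "exp L = \<sigma>" by (simp add: L_def \<sigma>0)
  have "cmod (Ln (1 + (\<sigma> - 1))) \<le> 2 * cmod (\<sigma> - 1)" using r4 by (intro norm_Ln_le) (simp add: r_def)
  then have L: "cmod L \<le> 2 * r" by (simp add: L_def r_def)
  have "cmod (exp L - 1 - L) \<le> 3 * (cmod L)\<^sup>2"
    using L r4 by (intro exp_minus_1_minus_id_bound) simp
  then have b: "cmod (\<sigma> - 1 - L) \<le> 3 * (cmod L)\<^sup>2" by (simp add: eL)
  show ?thesis
  proof (rule that[of "of_nat n * L"])
    show "of_nat n * L \<noteq> 0" using eL \<sigma> n by auto
    have "Re L = ln (cmod \<sigma>)" by (simp add: L_def \<sigma>0)
    then show "0 \<le> Re (of_nat n * L)" using \<sigma> by simp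
    have "cmod (of_nat n * L) \<le> real n * (2 * (sqrt (2 * c) / real n))"
      unfolding norm_mult norm_of_nat using L r by (intro mult_left_mono) auto
    then show "cmod (of_nat n * L) \<le> 2 * sqrt (2 * c)" using n by simp
    show "inverse (\<sigma> ^ n) = exp (- (of_nat n * L))"
      by (simp add: exp_minus exp_of_nat_mult eL)
    have "cmod (of_nat n * (\<sigma> - 1) - of_nat n * L) = real n * cmod (\<sigma> - 1 - L)"
      by (simp add: norm_mult flip: right_diff_distrib)
    also have "\<dots> \<le> real n * (3 * (cmod L)\<^sup>2)" using b by (intro mult_left_mono) auto
    also have "\<dots> = 3 * (cmod (of_nat n * L))\<^sup>2 / real n"
      using n by (simp add: norm_mult power_mult_distrib field_simps power2_eq_square)
    finally show "cmod (of_nat n * (\<sigma> - 1) - of_nat n * L) \<le> 3 * (cmod (of_nat n * L))\<^sup>2 / real n" .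
    show "cmod (\<sigma> - 1) \<le> sqrt (2 * c) / real n" using r by (simp add: r_def)
  qed
qed

text \<open>Compactness: counterexamples with n tending to infinity and \<epsilon> to 0 would have
  rescaled logarithms \<zeta> converging, along a subsequence, to a root of the characteristic
  equation, hence to 0. Close to 0 the relative error bound is contradicted directly, because one
  side is quadratic in \<zeta> and the other linear.\<close>

lemma no_unstable_multiplier:
  fixes \<beta> :: real
  assumes \<beta>: "\<beta> < 0" "- \<beta> < 3/2 * pi\<^sup>2"
  obtains \<epsilon> :: real and N :: nat where "0 < \<epsilon>"
    "\<And>n \<sigma> \<delta>. \<lbrakk>N \<le> n; 1 \<le> cmod \<sigma>; \<delta> = of_real (\<beta> / (real n)\<^sup>2) * (inverse (\<sigma> ^ n) - 1);
        cmod ((\<sigma> - 1)\<^sup>2 / \<sigma> + \<delta> / 3) \<le> \<epsilon> * cmod \<delta>\<rbrakk> \<Longrightarrow> \<sigma> = 1"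
proof (rule ccontr)
  note thesisI = that
  assume "\<not> thesis"
  then have neg: "\<not> (\<forall>n \<sigma>. N \<le> n \<longrightarrow> 1 \<le> cmod \<sigma> \<longrightarrow>
        cmod ((\<sigma> - 1)\<^sup>2 / \<sigma> + of_real (\<beta> / (real n)\<^sup>2) * (inverse (\<sigma> ^ n) - 1) / 3)
          \<le> \<epsilon> * cmod (of_real (\<beta> / (real n)\<^sup>2) * (inverse (\<sigma> ^ n) - 1)) \<longrightarrow> \<sigma> = 1)" if "0 < \<epsilon>" for \<epsilon> N
    using thesisI[OF that, of N] by blast
  \<comment> \<open>From \<open>\<bar>(\<sigma> - 1)\<^sup>2 / \<sigma>\<bar> \<le>
    \<bar>\<delta>\<bar> + \<bar>\<delta>\<bar> / 3 \<le> 3 / 2 * \<bar>\<delta>\<bar>\<close> and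
    \<open>\<bar>\<delta>\<bar> \<le> 2 * \<bar>\<beta>\<bar> / n\<^sup>2\<close>.\<close>
  define c where "c = 3 * \<bar>\<beta>\<bar>"
  have c: "0 < c" using \<beta> by (simp add: c_def)
  define R where "R = 2 * sqrt (2 * c)"
  obtain N0 where N0: "max (8 * c + 1) (4 * sqrt (2 * c) + 1) \<le> real N0" using real_arch_simple by blast
  \<comment> \<open>Here \<open>g\<close> stands for \<open>n * (\<sigma> - 1)\<close> and
    \<open>s\<close> for \<open>\<sigma>\<close>, and the error bound has been multiplied by
    \<open>n\<^sup>2\<close>. The tolerance \<open>1 / (m + 6)\<close> tends to 0 and is never above
    1/6, half of the coefficient 1/3 of \<open>\<delta>\<close>.\<close>
  have "\<exists>n \<zeta> g s. N0 + m \<le> n \<and> \<zeta> \<noteq> 0 \<and> 0 \<le> Re \<zeta> \<and> cmod \<zeta> \<le> R \<and> cmod (g - \<zeta>) \<le> 3 * (cmod \<zeta>)\<^sup>2 / real n \<and>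
     cmod (s - 1) \<le> R / real n \<and> 1 \<le> cmod s \<and>
     cmod (g\<^sup>2 / s + of_real \<beta> * (exp (- \<zeta>) - 1) / 3) \<le> \<bar>\<beta>\<bar> / (real m + 6) * cmod (exp (- \<zeta>) - 1)" for m
  proof -
    obtain n \<sigma> where n: "N0 + m \<le> n" and \<sigma>: "1 \<le> cmod \<sigma>" "\<sigma> \<noteq> 1"
      and *: "cmod ((\<sigma> - 1)\<^sup>2 / \<sigma> + of_real (\<beta> / (real n)\<^sup>2) * (inverse (\<sigma> ^ n) - 1) / 3)
          \<le> 1 / (real m + 6) * cmod (of_real (\<beta> / (real n)\<^sup>2) * (inverse (\<sigma> ^ n) - 1))"
      using neg[of "1 / (real m + 6)" "N0 + m"] by auto
    have n1: "8 * c + 1 \<le> real n" "4 * sqrt (2 * c) + 1 \<le> real n"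
      using n N0 by auto
    have n0: "1 \<le> real n" using n1 c by linarith
    then have "real n * 1 \<le> real n * real n" by (intro mult_left_mono) auto
    then have n2: "8 * c \<le> (real n)\<^sup>2" using n1 by (simp add: power2_eq_square)
    let ?d = "of_real (\<beta> / (real n)\<^sup>2) * (inverse (\<sigma> ^ n) - 1)"
    have "cmod (inverse (\<sigma> ^ n)) \<le> 1"
      using \<sigma> by (simp add: norm_inverse norm_power inverse_le_1_iff one_le_power)
    then have "cmod (inverse (\<sigma> ^ n) - 1) \<le> 2" using norm_triangle_ineq4[of "inverse (\<sigma> ^ n)" 1] by simp
    then have "\<bar>\<beta>\<bar> / (real n)\<^sup>2 * cmod (inverse (\<sigma> ^ n) - 1) \<le> \<bar>\<beta>\<bar> / (real n)\<^sup>2 * 2"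
      by (intro mult_left_mono) auto
    then have d: "cmod ?d \<le> 2 * \<bar>\<beta>\<bar> / (real n)\<^sup>2" by (simp add: norm_mult norm_divide norm_power mult.commute)
    have "cmod ((\<sigma> - 1)\<^sup>2 / \<sigma>) \<le> cmod ((\<sigma> - 1)\<^sup>2 / \<sigma> + ?d / 3) + cmod (?d / 3)"
      by (metis add_diff_cancel norm_triangle_ineq4)
    also have "\<dots> \<le> 1 / (real m + 6) * cmod ?d + cmod ?d / 3"
      using * by (simp add: norm_divide)
    also have "\<dots> \<le> 1 * cmod ?d + cmod ?d / 3"
      by (intro add_right_mono mult_right_mono) auto
    also have "\<dots> \<le> 3 / 2 * (2 * \<bar>\<beta>\<bar> / (real n)\<^sup>2)" using d norm_ge_zero[of ?d] by linarith
    also have "\<dots> = c / (real n)\<^sup>2" by (simp add: c_def)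
    finally have "(cmod (\<sigma> - 1))\<^sup>2 / cmod \<sigma> \<le> c / (real n)\<^sup>2" by (simp add: norm_divide norm_power)
    with multiplier_log[of n c \<sigma>] n0 n1 n2 c \<sigma> obtain \<zeta> where
      \<zeta>: "\<zeta> \<noteq> 0" "0 \<le> Re \<zeta>" "cmod \<zeta> \<le> 2 * sqrt (2 * c)" "inverse (\<sigma> ^ n) = exp (- \<zeta>)"
      "cmod (of_nat n * (\<sigma> - 1) - \<zeta>) \<le> 3 * (cmod \<zeta>)\<^sup>2 / real n" "cmod (\<sigma> - 1) \<le> sqrt (2 * c) / real n"
      by auto
    have nn: "(of_nat n :: complex)\<^sup>2 \<noteq> 0" "cmod ((of_nat n)\<^sup>2) = (real n)\<^sup>2" using n0 by (auto simp: norm_power)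
    have "(of_nat n)\<^sup>2 * ((\<sigma> - 1)\<^sup>2 / \<sigma> + ?d / 3) = (of_nat n * (\<sigma> - 1))\<^sup>2 / \<sigma> + of_real \<beta> * (exp (- \<zeta>) - 1) / 3"
    proof -
      have "(of_nat n)\<^sup>2 * ?d = of_real \<beta> * (exp (- \<zeta>) - 1)" using nn by (simp add: \<zeta>(4))
      then show ?thesis using n0 by (simp add: \<zeta>(4) distrib_left power_mult_distrib)
    qed
    then have "cmod ((of_nat n * (\<sigma> - 1))\<^sup>2 / \<sigma> + of_real \<beta> * (exp (- \<zeta>) - 1) / 3)
        = (real n)\<^sup>2 * cmod ((\<sigma> - 1)\<^sup>2 / \<sigma> + ?d / 3)"
      using nn(2) by (metis norm_mult)
    also have "\<dots> \<le> (real n)\<^sup>2 * (1 / (real m + 6) * cmod ?d)" using * by (intro mult_left_mono) auto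
    also have "\<dots> = \<bar>\<beta>\<bar> / (real m + 6) * cmod (exp (- \<zeta>) - 1)"
      using n0 by (simp add: \<zeta>(4) norm_mult norm_divide norm_power)
    finally have "cmod ((of_nat n * (\<sigma> - 1))\<^sup>2 / \<sigma> + of_real \<beta> * (exp (- \<zeta>) - 1) / 3)
      \<le> \<bar>\<beta>\<bar> / (real m + 6) * cmod (exp (- \<zeta>) - 1)" .
    moreover have "cmod (\<sigma> - 1) \<le> R / real n"
    proof -
      have "sqrt (2 * c) / real n \<le> R / real n" using c by (intro divide_right_mono) (auto simp: R_def)
      then show ?thesis using \<zeta>(6) by linarith
    qed
    ultimately show ?thesis using \<zeta> n \<sigma> unfolding R_def by blast
  qed
  then obtain \<nu> \<zeta> g s where
    \<nu>: "\<And>m. N0 + m \<le> \<nu> m" and \<zeta>: "\<And>m. \<zeta> m \<noteq> 0" "\<And>m. 0 \<le> Re (\<zeta> m)" "\<And>m. cmod (\<zeta> m) \<le> R"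
    and g: "\<And>m. cmod (g m - \<zeta> m) \<le> 3 * (cmod (\<zeta> m))\<^sup>2 / real (\<nu> m)"
    and s: "\<And>m. cmod (s m - 1) \<le> R / real (\<nu> m)" "\<And>m. 1 \<le> cmod (s m)"
    and eq: "\<And>m. cmod ((g m)\<^sup>2 / s m + of_real \<beta> * (exp (- \<zeta> m) - 1) / 3) \<le>
        \<bar>\<beta>\<bar> / (real m + 6) * cmod (exp (- \<zeta> m) - 1)"
    by metis
  have \<nu>0: "1 \<le> real (\<nu> m)" "real m \<le> real (\<nu> m)" for m
    using \<nu>[of m] N0 c by linarith+
  obtain l \<rho> where \<rho>: "strict_mono \<rho>" and l: "(\<zeta> \<circ> \<rho>) \<longlonglongrightarrow> l"
    using compact_cball[of "0::complex" R, unfolded compact_eq_seq_compact_metric seq_compact_def] \<zeta>(3)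
    by (metis dist_0_norm mem_cball)
  have \<rho>m: "m \<le> \<rho> m" for m using \<rho> by (rule seq_suble)
  have inv0: "(\<lambda>m. C / real (\<nu> (\<rho> m))) \<longlonglongrightarrow> 0" for C
  proof (rule Lim_null_comparison[OF eventually_sequentiallyI[of 1] lim_const_over_n[of "\<bar>C\<bar>"]])
    fix m :: nat assume "1 \<le> m"
    then show "norm (C / real (\<nu> (\<rho> m))) \<le> \<bar>C\<bar> / of_nat m"
      using \<nu>0[of "\<rho> m"] \<rho>m[of m] by (auto intro!: frac_le)
  qed
  have gl: "(\<lambda>m. g (\<rho> m) - \<zeta> (\<rho> m)) \<longlonglongrightarrow> 0"
  proof (rule Lim_null_comparison[OF always_eventually[OF allI] inv0[of "3 * R\<^sup>2"]])
    fix m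
    have "3 * (cmod (\<zeta> (\<rho> m)))\<^sup>2 / real (\<nu> (\<rho> m)) \<le> 3 * R\<^sup>2 / real (\<nu> (\<rho> m))"
      using \<zeta>(3) by (intro divide_right_mono mult_left_mono power_mono) auto
    then show "norm (g (\<rho> m) - \<zeta> (\<rho> m)) \<le> 3 * R\<^sup>2 / real (\<nu> (\<rho> m))" using g order_trans by blast
  qed
  have \<zeta>l: "(\<lambda>m. \<zeta> (\<rho> m)) \<longlonglongrightarrow> l" using l by (simp add: o_def)
  have "(\<lambda>m. g (\<rho> m)) \<longlonglongrightarrow> l" using tendsto_add[OF gl \<zeta>l] by simp
  moreover have "(\<lambda>m. s (\<rho> m) - 1) \<longlonglongrightarrow> 0"
    by (rule Lim_null_comparison[OF always_eventually[OF allI] inv0[of R]]) (rule s)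
  then have "(\<lambda>m. s (\<rho> m)) \<longlonglongrightarrow> 1" by (simp add: LIM_zero_iff)
  ultimately have lim: "(\<lambda>m. (g (\<rho> m))\<^sup>2 / s (\<rho> m) + of_real \<beta> * (exp (- \<zeta> (\<rho> m)) - 1) / 3)
      \<longlonglongrightarrow> l\<^sup>2 / 1 + of_real \<beta> * (exp (- l) - 1) / 3"
    by (intro tendsto_intros \<zeta>l) auto
  have "(\<lambda>m. (g (\<rho> m))\<^sup>2 / s (\<rho> m) + of_real \<beta> * (exp (- \<zeta> (\<rho> m)) - 1) / 3) \<longlonglongrightarrow> 0"
  proof (rule Lim_null_comparison[OF always_eventually[OF allI]])
    have "(\<lambda>m. \<bar>\<beta>\<bar> * 2 / real m) \<longlonglongrightarrow> 0" by (rule lim_const_over_n)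
    then show "(\<lambda>m. \<bar>\<beta>\<bar> * 2 / real (Suc m)) \<longlonglongrightarrow> 0" by (rule LIMSEQ_Suc)
    fix m
    let ?m = "\<rho> m"
    have "cmod (exp (- \<zeta> ?m) - 1) \<le> 1 + 1"
      using \<zeta>(2) by (intro order_trans[OF norm_triangle_ineq4] add_mono) (auto simp: norm_exp_eq_Re)
    then have "\<bar>\<beta>\<bar> / (real ?m + 6) * cmod (exp (- \<zeta> ?m) - 1) \<le> \<bar>\<beta>\<bar> / (real ?m + 6) * 2"
      by (intro mult_left_mono) auto
    also have "\<dots> \<le> \<bar>\<beta>\<bar> * 2 / real (Suc m)" using \<rho>m[of m] by (auto intro!: frac_le)
    finally show "norm ((g ?m)\<^sup>2 / s ?m + of_real \<beta> * (exp (- \<zeta> ?m) - 1) / 3) \<le> \<bar>\<beta>\<bar> * 2 / real (Suc m)"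
      using eq order_trans by blast
  qed
  from LIMSEQ_unique[OF this lim] have "l\<^sup>2 = - of_real (- \<beta> / 3) * (1 - exp (- l))"
    by (simp add: field_simps)
  moreover have "0 \<le> Re l"
    by (rule LIMSEQ_le_const[OF tendsto_Re[OF \<zeta>l]]) (use \<zeta>(2) in auto)
  ultimately have "l = 0" using \<beta> by (intro characteristic_root_zero[of l "- \<beta> / 3"]) auto
  \<comment> \<open>Below 1/6 the quantity \<open>\<bar>exp (- \<zeta>) - 1\<bar>\<close> is at
    least \<open>\<bar>\<zeta>\<bar> / 2\<close>; the final inequality
    \<open>\<bar>\<beta>\<bar> / 12 \<le> 4 * \<bar>\<zeta>\<bar>\<close> then fails below
    \<open>\<bar>\<beta>\<bar> / 100\<close>.\<close>
  then have "\<forall>\<^sub>F m in sequentially. norm (\<zeta> (\<rho> m)) < min (1 / 6) (\<bar>\<beta>\<bar> / 100)"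
    using \<zeta>l \<beta> order_tendstoD(2)[OF tendsto_norm[OF \<zeta>l], of "min (1 / 6) (\<bar>\<beta>\<bar> / 100)"] by auto
  then obtain m where "cmod (\<zeta> (\<rho> m)) < min (1 / 6) (\<bar>\<beta>\<bar> / 100)"
    unfolding eventually_sequentially by blast
  then obtain m where m: "cmod (\<zeta> m) < 1 / 6" "cmod (\<zeta> m) < \<bar>\<beta>\<bar> / 100" by auto
  let ?z = "cmod (\<zeta> m)" and ?e = "cmod (exp (- \<zeta> m) - 1)" and ?q = "(g m)\<^sup>2 / s m"
  have z0: "0 < ?z" using \<zeta>(1) by simp
  have zz: "3 * ?z\<^sup>2 \<le> 1 / 2 * ?z"
    using mult_right_mono[of ?z "1/6" ?z] m by (simp add: power2_eq_square)
  have "cmod (exp (- \<zeta> m) - 1 - (- \<zeta> m)) \<le> 3 * (cmod (- \<zeta> m))\<^sup>2"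
    by (rule exp_minus_1_minus_id_bound) (use m in simp)
  moreover have "?z \<le> ?e + cmod (exp (- \<zeta> m) - 1 - (- \<zeta> m))"
    by (metis norm_minus_cancel norm_triangle_sub norm_minus_commute)
  ultimately have e: "?z / 2 \<le> ?e" using zz by simp
  have "3 * ?z\<^sup>2 / real (\<nu> m) \<le> 3 * ?z\<^sup>2 / 1"
    using \<nu>0(1)[of m] by (intro divide_left_mono) auto
  then have "cmod (g m - \<zeta> m) \<le> 1 / 2 * ?z" using g[of m] zz by linarith
  then have "cmod (g m) \<le> 2 * ?z" using norm_triangle_sub[of "g m" "\<zeta> m"] z0 by linarith
  then have "(cmod (g m))\<^sup>2 \<le> (2 * ?z)\<^sup>2" by (intro power_mono) auto
  moreover have "cmod ?q \<le> (cmod (g m))\<^sup>2 / 1"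
    unfolding norm_divide norm_power using s(2)[of m] by (intro divide_left_mono) auto
  ultimately have q: "cmod ?q \<le> 4 * (?z * ?z)" by (simp add: power2_eq_square)
  have "\<bar>\<beta>\<bar> / (real m + 6) * ?e \<le> \<bar>\<beta>\<bar> / 6 * ?e" by (intro mult_right_mono divide_left_mono) auto
  with eq[of m] have "cmod (?q + of_real \<beta> * (exp (- \<zeta> m) - 1) / 3) \<le> \<bar>\<beta>\<bar> / 6 * ?e" by linarith
  moreover have "cmod (of_real \<beta> * (exp (- \<zeta> m) - 1) / 3) \<le> cmod ?q + cmod (?q + of_real \<beta> * (exp (- \<zeta> m) - 1) / 3)"
    by (metis add.commute add_diff_cancel norm_triangle_ineq4 add.commute)
  ultimately have "\<bar>\<beta>\<bar> / 3 * ?e \<le> 4 * (?z * ?z) + \<bar>\<beta>\<bar> / 6 * ?e"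
    using q by (simp add: norm_mult norm_divide)
  then have "\<bar>\<beta>\<bar> / 6 * ?e \<le> 4 * (?z * ?z)" by simp
  moreover have "\<bar>\<beta>\<bar> / 6 * (?z / 2) \<le> \<bar>\<beta>\<bar> / 6 * ?e" using e by (intro mult_left_mono) auto
  ultimately have "\<bar>\<beta>\<bar> / 12 * ?z \<le> 4 * ?z * ?z" by simp
  then have "\<bar>\<beta>\<bar> / 12 \<le> 4 * ?z" using z0 by (simp only: mult_le_cancel_right)
  then show False using m z0 by linarith
qed

section \<open>Hill's equation along a rescaled orbit\<close>

text \<open>The potential is complex because the eliminated delay puts a power of the complex
  multiplier into it. Times are nonnegative and the derivative at 0 is one-sided, as for the
  linearized delay equation.\<close>

definition hill_solution :: "(real \<Rightarrow> complex) \<Rightarrow> (real \<Rightarrow> complex) \<Rightarrow> (real \<Rightarrow> complex) \<Rightarrow> bool" where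
  "hill_solution q y y1 \<longleftrightarrow>
     (\<forall>t\<ge>0. (y has_vector_derivative y1 t) (at t within {0..}) \<and>
            (y1 has_vector_derivative - (q t * y t)) (at t within {0..}))"

lemma hill_solutionD:
  assumes "hill_solution q y y1" "0 \<le> t" "S \<subseteq> {0..}"
  shows "(y has_vector_derivative y1 t) (at t within S)"
    "(y1 has_vector_derivative - (q t * y t)) (at t within S)"
  using assms unfolding hill_solution_def by (blast intro: has_vector_derivative_within_subset)+

lemma hill_solution_lincomb:
  assumes "hill_solution q y y1" "hill_solution q z z1"
  shows "hill_solution q (\<lambda>t. a * y t + b * z t) (\<lambda>t. a * y1 t + b * z1 t)"
  using assms unfolding hill_solution_def
  by (auto intro!: derivative_eq_intros simp: algebra_simps)

lemma hill_solution_cnj: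
  assumes "hill_solution q y y1"
  shows "hill_solution (\<lambda>t. cnj (q t)) (\<lambda>t. cnj (y t)) (\<lambda>t. cnj (y1 t))"
proof -
  have "((\<lambda>t. cnj (f t)) has_vector_derivative cnj f') F" if "(f has_vector_derivative f') F" for f f' F
    using bounded_linear.has_vector_derivative[OF bounded_linear_cnj that] .
  then show ?thesis using assms unfolding hill_solution_def
    by (metis complex_cnj_minus complex_cnj_mult)
qed

text \<open>An ordinary equation is a delay equation with delay 0 whose field ignores the delayed
  argument.\<close>

lemma hill_solution_exists:
  assumes q: "continuous_on UNIV q" and K: "\<And>t. cmod (q t) \<le> K"
  obtains y y1 where "hill_solution q y y1" "y 0 = a" "y1 0 = b"
proof -
  define F where "F t p r = (snd p, - (q t * fst p))" for t and p r :: "complex \<times> complex"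
  have K0: "0 \<le> K" using order_trans[OF norm_ge_zero K] .
  have cont: "continuous_on UNIV (\<lambda>(t, p, r). F t p r)"
    unfolding F_def case_prod_beta by (auto intro!: continuous_intros continuous_on_compose2[OF q])
  have lip: "norm (F t p r - F t p' r') \<le> (1 + K) * (norm (p - p') + norm (r - r'))" for t p r p' r'
  proof -
    have "F t p r - F t p' r' = (snd (p - p'), - (q t * fst (p - p')))"
      by (simp add: F_def algebra_simps)
    also have "norm \<dots> \<le> norm (snd (p - p')) + norm (q t * fst (p - p'))"
      using norm_Pair_le[of "snd (p - p')" "- (q t * fst (p - p'))"] by simp
    also have "\<dots> \<le> norm (p - p') + K * norm (p - p')"
    proof -
      have "norm (fst x) \<le> norm x" "norm (snd x) \<le> norm x" for x :: "complex \<times> complex"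
        by (metis norm_fst_le prod.collapse) (metis norm_snd_le prod.collapse)
      then show ?thesis unfolding norm_mult
        by (intro add_mono mult_mono K K0) (auto simp del: fst_diff snd_diff)
    qed
    also have "\<dots> = (1 + K) * norm (p - p')" by (simp add: algebra_simps)
    also have "\<dots> \<le> (1 + K) * (norm (p - p') + norm (r - r'))"
      using K0 by (intro mult_left_mono) auto
    finally show ?thesis .
  qed
  obtain Y where Y: "\<And>t. t \<in> {-0..0} \<Longrightarrow> Y t = (a, b)"
    "\<And>t. 0 \<le> t \<Longrightarrow> (Y has_vector_derivative F t (Y t) (Y (t - 0))) (at t within {0..})"
    using delay_equation_exists[of 0 F "1 + K" 0 "\<lambda>_. (a, b)", OF _ cont lip]
    by (auto simp: F_def)
  show ?thesis
  proof (rule that[of "\<lambda>t. fst (Y t)" "\<lambda>t. snd (Y t)"])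
    show "hill_solution q (\<lambda>t. fst (Y t)) (\<lambda>t. snd (Y t))"
      unfolding hill_solution_def
      using bounded_linear.has_vector_derivative[OF bounded_linear_fst Y(2)]
        bounded_linear.has_vector_derivative[OF bounded_linear_snd Y(2)]
      by (simp add: F_def)
  qed (use Y(1)[of 0] in auto)
qed

lemma hill_perturbation_bound:
  assumes r: "\<And>t. t \<in> {0..1} \<Longrightarrow> (r has_vector_derivative r1 t) (at t within {0..1})"
    "\<And>t. t \<in> {0..1} \<Longrightarrow> (r1 has_vector_derivative - (q t * r t) + f t) (at t within {0..1})"
    and 0: "r 0 = 0" "r1 0 = 0"
    and q: "\<And>t. t \<in> {0..1} \<Longrightarrow> cmod (q t) \<le> K"
    and f: "\<And>t. t \<in> {0..1} \<Longrightarrow> cmod (f t) \<le> F" and t: "t \<in> {0..1}"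
  shows "cmod (r t) \<le> F * exp (K + 2)" "cmod (r1 t) \<le> F * exp (K + 2)"
proof -
  have K: "0 \<le> K" and F: "0 \<le> F" using order_trans[OF norm_ge_zero q] order_trans[OF norm_ge_zero f] t by blast+
  have "(cmod (r t))\<^sup>2 + (cmod (r1 t))\<^sup>2 \<le> ((cmod (r 0))\<^sup>2 + (cmod (r1 0))\<^sup>2 + F\<^sup>2) * exp ((K + 2) * t)"
  proof (rule gronwall_second_order[OF r _ K F t])
    fix t :: real assume t: "t \<in> {0..1}"
    have "cmod (- (q t * r t) + f t) \<le> cmod (q t) * cmod (r t) + cmod (f t)"
      by (metis norm_minus_cancel norm_mult norm_triangle_ineq)
    also have "\<dots> \<le> K * cmod (r t) + F" by (intro add_mono mult_right_mono q f t) auto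
    finally show "cmod (- (q t * r t) + f t) \<le> K * cmod (r t) + F" .
  qed
  also have "\<dots> \<le> F\<^sup>2 * (exp (K + 2))\<^sup>2"
  proof -
    \<comment> \<open>Replacing \<open>t\<close> by 2 instead of 1 makes the bound a perfect square,
      so that a root can be taken.\<close>
    have "(K + 2) * t \<le> (K + 2) * 2" using t K by (intro mult_left_mono) auto
    then have "exp ((K + 2) * t) \<le> (exp (K + 2))\<^sup>2" by (simp flip: exp_double add: mult.commute)
    then show ?thesis by (simp add: 0 mult_left_mono)
  qed
  finally have *: "(cmod (r t))\<^sup>2 + (cmod (r1 t))\<^sup>2 \<le> (F * exp (K + 2))\<^sup>2" by (simp add: power_mult_distrib)
  then have "(cmod (r t))\<^sup>2 \<le> (F * exp (K + 2))\<^sup>2" using zero_le_power2[of "cmod (r1 t)"] by linarith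
  then show "cmod (r t) \<le> F * exp (K + 2)" by (rule power2_le_imp_le) (use F in simp)
  have "(cmod (r1 t))\<^sup>2 \<le> (F * exp (K + 2))\<^sup>2" using * zero_le_power2[of "cmod (r t)"] by linarith
  then show "cmod (r1 t) \<le> F * exp (K + 2)" by (rule power2_le_imp_le) (use F in simp)
qed

lemma hill_solution_unique:
  assumes y: "hill_solution q y y1" and z: "hill_solution q z z1" and 0: "y 0 = z 0" "y1 0 = z1 0"
    and q: "\<And>t. cmod (q t) \<le> K" and t: "0 \<le> t"
  shows "y t = z t \<and> y1 t = z1 t"
proof -
  have K: "0 \<le> K" using order_trans[OF norm_ge_zero q] .
  have "(cmod (y t - z t))\<^sup>2 + (cmod (y1 t - z1 t))\<^sup>2 \<le>
      ((cmod (y 0 - z 0))\<^sup>2 + (cmod (y1 0 - z1 0))\<^sup>2 + 0\<^sup>2) * exp ((K + 2) * t)"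
  proof (rule gronwall_second_order[where R = t and f = "\<lambda>t. - (q t * y t) - - (q t * z t)"])
    fix s assume s: "s \<in> {0..t}"
    then show "((\<lambda>t. y t - z t) has_vector_derivative y1 s - z1 s) (at s within {0..t})"
      "((\<lambda>t. y1 t - z1 t) has_vector_derivative - (q s * y s) - - (q s * z s)) (at s within {0..t})"
      by (auto intro!: has_vector_derivative_diff hill_solutionD[OF y] hill_solutionD[OF z]
            simp del: minus_diff_eq diff_minus_eq_add)
    have "- (q s * y s) - - (q s * z s) = - (q s * (y s - z s))" by (simp add: algebra_simps)
    then show "cmod (- (q s * y s) - - (q s * z s)) \<le> K * cmod (y s - z s) + 0"
      by (simp add: norm_mult mult_right_mono q del: minus_diff_eq diff_minus_eq_add)
  qed (use K t in auto)
  then show ?thesis using 0 by (simp add: sum_power2_le_zero_iff)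
qed

lemma hill_wronskian:
  assumes y: "hill_solution q y y1" and z: "hill_solution q z z1" and t: "0 \<le> t"
  shows "y t * z1 t - z t * y1 t = y 0 * z1 0 - z 0 * y1 0"
proof -
  have "((\<lambda>t. y t * z1 t - z t * y1 t) has_derivative (\<lambda>h. 0)) (at s within {0..})" if "0 \<le> s" for s
  proof -
    have "((\<lambda>t. y t * z1 t - z t * y1 t) has_vector_derivative 0) (at s within {0..})"
      by (rule derivative_eq_intros hill_solutionD[OF y that] hill_solutionD[OF z that] order_refl refl)+
         (simp add: algebra_simps)
    then show ?thesis by (simp add: has_vector_derivative_def)
  qed
  then show ?thesis
    using has_derivative_zero_unique[of "{0..}" "\<lambda>t. y t * z1 t - z t * y1 t" t 0] t by auto
qed

text \<open>\<open>exp 79\<close> is the Gronwall factor for coefficients bounded by 77, see \<open>hq_bound\<close>.\<close>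

definition "trace_const = 1000 * exp (79::real)"

text \<open>Time and amplitude are rescaled so that the half period is 1. The assumption
  \<open>amp\<close> is \<open>half_period_bounds\<close>, solved for pi and squared; it is what
  pins the amplitude down uniformly in n.\<close>

locale scaled_orbit =
  fixes \<eta> B :: real and u u1 :: "real \<Rightarrow> real"
  assumes du: "\<And>s. (u has_real_derivative u1 s) (at s)"
    and du1: "\<And>s. (u1 has_real_derivative - (\<eta> * u s) - u s ^ 3) (at s)"
    and anti: "\<And>s. u (s + 1) = - u s"
    and init: "u 0 = B" "u1 0 = 0" "0 < B"
    and amp: "pi\<^sup>2 \<le> \<eta> + B\<^sup>2" "\<eta> + B\<^sup>2 / 2 \<le> pi\<^sup>2"
    and \<eta>: "\<bar>\<eta>\<bar> \<le> 1"
begin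

text \<open>The acceleration of \<open>u\<close> at time 0.\<close>

definition "v0 = - (\<eta> * B + B ^ 3)"

text \<open>The derivative of \<open>\<lambda> * u (\<lambda> * s)\<close> with respect to \<lambda>
  at 1. For \<open>\<eta> = 0\<close> that family consists of solutions, so \<open>w\<close> solves
  the linearized equation up to a defect proportional to \<open>\<eta>\<close>.\<close>

definition "w s = u s + s * u1 s"
definition "w1 s = 2 * u1 s + s * (- (\<eta> * u s) - u s ^ 3)"

text \<open>With 3 < pi < 16/5 and \<open>\<bar>\<eta>\<bar> \<le> 1\<close>, the bounds
  \<open>9 - 1\<close> and \<open>2 * (10.24 + 1)\<close> come from \<open>amp\<close>; the latter
  is rounded up to a square. All explicit constants below rest on these.\<close>

lemma B_bounds: "8 \<le> B\<^sup>2" "B\<^sup>2 \<le> 25" "2 \<le> B" "B \<le> 5"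
proof -
  have "3\<^sup>2 \<le> pi\<^sup>2" using pi_gt3 by (intro power_mono) auto
  then show 8: "8 \<le> B\<^sup>2" using amp \<eta> by simp
  have "pi\<^sup>2 \<le> (16/5)\<^sup>2" using pi_approx by (intro power_mono) auto
  then show 25: "B\<^sup>2 \<le> 25" using amp \<eta> by (simp add: power2_eq_square)
  show "2 \<le> B" by (rule power2_le_imp_le) (use 8 init in auto)
  show "B \<le> 5" by (rule power2_le_imp_le) (use 25 in auto)
qed

lemma energy: "(u1 s)\<^sup>2 / 2 + \<eta> * (u s)\<^sup>2 / 2 + u s ^ 4 / 4 = \<eta> * B\<^sup>2 / 2 + B ^ 4 / 4"
proof -
  have "((\<lambda>s. (u1 s)\<^sup>2 / 2 + \<eta> * (u s)\<^sup>2 / 2 + u s ^ 4 / 4) has_real_derivative 0) (at s)" for s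
    by (rule derivative_eq_intros du du1 refl | simp)+
       (simp add: algebra_simps power2_eq_square power3_eq_cube)
  then have "(u1 s)\<^sup>2 / 2 + \<eta> * (u s)\<^sup>2 / 2 + u s ^ 4 / 4 = (u1 0)\<^sup>2 / 2 + \<eta> * (u 0)\<^sup>2 / 2 + u 0 ^ 4 / 4"
    by (intro DERIV_isconst_all) auto
  then show ?thesis by (simp add: init)
qed

lemma u_bound: "\<bar>u s\<bar> \<le> B"
proof -
  \<comment> \<open>Conservation of energy factors as \<open>(u\<^sup>2 - B\<^sup>2)\<close> times
    this quantity, equal to \<open>- u1\<^sup>2 / 2\<close>; positivity gives the sign of the first
    factor.\<close>
  have pos: "0 < \<eta> / 2 + ((u s)\<^sup>2 + B\<^sup>2) / 4"
  proof -
    have "- 1 \<le> \<eta>" using \<eta> by simp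
    then have "0 < 2 * \<eta> + ((u s)\<^sup>2 + B\<^sup>2)" using B_bounds(1) zero_le_power2[of "u s"] by linarith
    then show ?thesis by (simp add: field_simps)
  qed
  have "((u s)\<^sup>2 - B\<^sup>2) * (\<eta> / 2 + ((u s)\<^sup>2 + B\<^sup>2) / 4) = - (u1 s)\<^sup>2 / 2"
    using energy[of s] by (simp add: field_simps power2_eq_square power4_eq_xxxx)
  also have "\<dots> \<le> 0" by simp
  finally have "(u s)\<^sup>2 \<le> B\<^sup>2" using pos by (simp add: mult_le_0_iff)
  then have "\<bar>u s\<bar>\<^sup>2 \<le> B\<^sup>2" by simp
  then show ?thesis by (rule power2_le_imp_le) (use init in simp)
qed

lemma u_bound5: "\<bar>u s\<bar> \<le> 5" using u_bound[of s] B_bounds by linarith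

lemma u_square_bound: "(u s)\<^sup>2 \<le> 25"
  using power_mono[OF u_bound5[of s], of 2] by simp

lemma u1_bound: "\<bar>u1 s\<bar> \<le> 20"
proof -
  have "2 * (u1 s)\<^sup>2 = 2 * (\<eta> * (B\<^sup>2 - (u s)\<^sup>2)) + B ^ 4 - u s ^ 4"
    using energy[of s] by (simp add: field_simps)
  moreover have "B ^ 4 \<le> 625" using power_mono[of B 5 4] B_bounds by simp
  moreover have "0 \<le> u s ^ 4" by simp
  moreover have "\<eta> * (B\<^sup>2 - (u s)\<^sup>2) \<le> 1 * 25"
  proof (rule order_trans[OF abs_ge_self])
    have "\<bar>B\<^sup>2 - (u s)\<^sup>2\<bar> \<le> 25"
      using B_bounds u_square_bound[of s] zero_le_power2[of "u s"] zero_le_power2[of B] by linarith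
    then show "\<bar>\<eta> * (B\<^sup>2 - (u s)\<^sup>2)\<bar> \<le> 1 * 25" unfolding abs_mult by (intro mult_mono \<eta>) auto
  qed
  ultimately have "(u1 s)\<^sup>2 \<le> 400" by linarith
  then have "(u1 s)\<^sup>2 \<le> 20\<^sup>2" by simp
  then have "\<bar>u1 s\<bar>\<^sup>2 \<le> 20\<^sup>2" by simp
  then show ?thesis by (rule power2_le_imp_le) simp
qed

lemma w_bound: "s \<in> {0..1} \<Longrightarrow> \<bar>w s\<bar> \<le> 25"
proof -
  assume "s \<in> {0..1}"
  then have "\<bar>s * u1 s\<bar> \<le> 1 * 20" unfolding abs_mult by (intro mult_mono u1_bound) auto
  then show ?thesis unfolding w_def using abs_triangle_ineq[of "u s" "s * u1 s"] u_bound5[of s] by linarith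
qed

lemma v0_bound: "14 \<le> - v0" "v0 \<noteq> 0"
proof -
  have "2 * 7 \<le> B * (\<eta> + B\<^sup>2)" using B_bounds \<eta> by (intro mult_mono) auto
  also have "\<dots> = - v0" by (simp add: v0_def algebra_simps power2_eq_square power3_eq_cube)
  finally show "14 \<le> - v0" by simp
  then show "v0 \<noteq> 0" by auto
qed

lemma u1_anti: "u1 (s + 1) = - u1 s"
proof (rule DERIV_unique)
  show "((\<lambda>s. u (s + 1)) has_real_derivative u1 (s + 1)) (at s)"
    using du[of "s + 1"] by (simp add: DERIV_shift)
  show "((\<lambda>s. u (s + 1)) has_real_derivative - u1 s) (at s)"
    unfolding anti using du by (rule DERIV_minus)
qed

lemma at1: "u 1 = - B" "u1 1 = 0" using anti[of 0] u1_anti[of 0] init by simp_all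

lemma vd:
  "((\<lambda>s. complex_of_real (u s)) has_vector_derivative of_real (u1 s)) (at s within S)"
  "((\<lambda>s. complex_of_real (u1 s)) has_vector_derivative of_real (- (\<eta> * u s) - u s ^ 3)) (at s within S)"
  "((\<lambda>s. complex_of_real (- (\<eta> * u s) - u s ^ 3)) has_vector_derivative of_real (- ((\<eta> + 3 * (u s)\<^sup>2) * u1 s))) (at s within S)"
  "((\<lambda>s. complex_of_real (w s)) has_vector_derivative of_real (w1 s)) (at s within S)"
  "((\<lambda>s. complex_of_real (w1 s)) has_vector_derivative of_real (- ((\<eta> + 3 * (u s)\<^sup>2) * w s) - 2 * \<eta> * u s)) (at s within S)"
proof -
  have d: "(f has_real_derivative f') (at s) \<Longrightarrow>
      ((\<lambda>s. complex_of_real (f s)) has_vector_derivative of_real f') (at s within S)" for f f'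
    by (rule has_vector_derivative_of_real[OF has_field_derivative_at_within])
  have d2: "((\<lambda>s. - (\<eta> * u s) - u s ^ 3) has_real_derivative - ((\<eta> + 3 * (u s)\<^sup>2) * u1 s)) (at s)"
    by (rule derivative_eq_intros du refl)+ (simp add: algebra_simps)
  show "((\<lambda>s. complex_of_real (u s)) has_vector_derivative of_real (u1 s)) (at s within S)"
    by (intro d du)
  show "((\<lambda>s. complex_of_real (u1 s)) has_vector_derivative of_real (- (\<eta> * u s) - u s ^ 3)) (at s within S)"
    by (intro d du1)
  show "((\<lambda>s. complex_of_real (- (\<eta> * u s) - u s ^ 3)) has_vector_derivative of_real (- ((\<eta> + 3 * (u s)\<^sup>2) * u1 s))) (at s within S)"
    by (intro d d2)
  have "(w has_real_derivative w1 s) (at s)"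
    unfolding w_def[abs_def] w1_def by (rule derivative_eq_intros du du1 refl)+ simp
  then show "((\<lambda>s. complex_of_real (w s)) has_vector_derivative of_real (w1 s)) (at s within S)" by (rule d)
  have "(w1 has_real_derivative - ((\<eta> + 3 * (u s)\<^sup>2) * w s) - 2 * \<eta> * u s) (at s)"
    unfolding w_def w1_def[abs_def]
    by (rule derivative_eq_intros du du1 d2 refl)+ (simp add: algebra_simps power2_eq_square power3_eq_cube)
  then show "((\<lambda>s. complex_of_real (w1 s)) has_vector_derivative of_real (- ((\<eta> + 3 * (u s)\<^sup>2) * w s) - 2 * \<eta> * u s)) (at s within S)"
    by (rule d)
qed

definition "hq \<delta> s = of_real (\<eta> + 3 * (u s)\<^sup>2) + (\<delta>::complex)"

lemma hq_bound: "cmod \<delta> \<le> 1 \<Longrightarrow> cmod (hq \<delta> s) \<le> 77"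
proof -
  have "cmod (of_real (\<eta> + 3 * (u s)\<^sup>2)) = \<bar>\<eta> + 3 * (u s)\<^sup>2\<bar>" by (simp only: norm_of_real)
  also have "\<dots> \<le> 76" using \<eta> u_square_bound[of s] zero_le_power2[of "u s"] by linarith
  finally show "cmod \<delta> \<le> 1 \<Longrightarrow> cmod (hq \<delta> s) \<le> 77"
    unfolding hq_def by (intro norm_triangle_le) simp
qed

lemma hq_continuous: "continuous_on S (hq \<delta>)"
proof -
  have "continuous_on S u" using du DERIV_isCont by (blast intro: continuous_at_imp_continuous_on)
  then show ?thesis unfolding hq_def[abs_def] by (intro continuous_intros)
qed

lemma hq_periodic: "hq \<delta> (s + 1) = hq \<delta> s" by (simp add: hq_def anti)

text \<open>The increments over one period of the Wronskians of \<open>\<phi>\<close> and \<open>\<psi>\<close> with \<open>u'\<close> and with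
  \<open>w = u + s u'\<close> (a solution of the unperturbed equation up to \<open>2 \<eta> u\<close>) combine to the trace of the
  monodromy matrix. The remaining terms of \<open>\<Psi>\<close> cancel the leading part of the derivative, using
  \<open>3 u'\<^sup>2 = (u u')' + h - \<eta> u\<^sup>2\<close>, which follows from energy conservation.\<close>

lemma trace_estimate:
  assumes \<delta>: "cmod \<delta> \<le> 1"
    and \<phi>: "hill_solution (hq \<delta>) \<phi> \<phi>1" "\<phi> 0 = 1" "\<phi>1 0 = 0"
    and \<psi>: "hill_solution (hq \<delta>) \<psi> \<psi>1" "\<psi> 0 = 0" "\<psi>1 0 = 1"
  shows "cmod (\<phi> 1 + \<psi>1 1 + 2 - \<delta> / 3) \<le> trace_const * cmod \<delta> * (cmod \<delta> + \<bar>\<eta>\<bar>)"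
proof -
  define M where "M = exp (79::real)"
  have M: "1 \<le> M" by (simp add: M_def)
  let ?c = complex_of_real
  let ?d = "cmod \<delta>"
  define V where "V s = ?c (u1 s)" for s
  define V1 where "V1 s = ?c (- (\<eta> * u s) - u s ^ 3)" for s
  define U where "U s = ?c (u s)" for s
  define W where "W s = ?c (w s)" for s
  define W1 where "W1 s = ?c (w1 s)" for s
  have dU: "(U has_vector_derivative V s) (at s within {0..1})"
    and dV: "(V has_vector_derivative V1 s) (at s within {0..1})"
    and dV1: "(V1 has_vector_derivative - (?c (\<eta> + 3 * (u s)\<^sup>2) * V s)) (at s within {0..1})"
    and dW: "(W has_vector_derivative W1 s) (at s within {0..1})"
    and dW1: "(W1 has_vector_derivative - (?c (\<eta> + 3 * (u s)\<^sup>2) * W s) - 2 * ?c \<eta> * U s) (at s within {0..1})" for s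
    using vd[of s "{0..1}"] by (simp_all add: U_def[abs_def] V_def[abs_def] V1_def[abs_def] W_def[abs_def] W1_def[abs_def])
  have Ub: "cmod (U s) \<le> 5" and Vb: "cmod (V s) \<le> 20" for s
    unfolding U_def V_def norm_of_real by (rule u_bound5 u1_bound)+
  have Wb: "cmod (W s) \<le> 25" if "s \<in> {0..1}" for s
    unfolding W_def norm_of_real by (rule w_bound[OF that])
  define v where "v = ?c v0"
  define b where "b = ?c B"
  have vb: "14 \<le> cmod v" "v \<noteq> 0" and bb: "2 \<le> cmod b" "b \<noteq> 0"
    using v0_bound B_bounds by (auto simp: v_def b_def)
  have ends: "U 0 = b" "V 0 = 0" "V1 0 = v" "W 0 = b" "W1 0 = 0"
     "U 1 = - b" "V 1 = 0" "V1 1 = - v" "W 1 = - b" "W1 1 = - v"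
    by (simp_all add: U_def V_def V1_def W_def W1_def v_def b_def v0_def w_def w1_def init at1)
  note d\<phi> = hill_solutionD[OF \<phi>(1)] and d\<psi> = hill_solutionD[OF \<psi>(1)]
  \<comment> \<open>\<open>W / b\<close> and \<open>V / v\<close> have the initial data of
    \<open>\<phi>\<close> and \<open>\<psi>\<close>. The defect of \<open>V\<close> is of order
    \<delta>, that of \<open>W\<close> of order \<delta> and \<eta>, so \<open>p\<close> is of order
    \<delta> and \<open>r\<close> of order \<delta> + \<eta>.\<close>
  define r where "r s = \<phi> s - W s / b" for s
  define p where "p s = \<psi> s - V s / v" for s
  have rb: "cmod (r s) \<le> (13 * ?d + 5 * \<bar>\<eta>\<bar>) * M" if s: "s \<in> {0..1}" for s
  proof -
    have "cmod (r s) \<le> (13 * ?d + 5 * \<bar>\<eta>\<bar>) * exp (77 + 2)"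
    proof (rule hill_perturbation_bound(1)[where ?r1.0 = "\<lambda>s. \<phi>1 s - W1 s / b" and q = "hq \<delta>"
            and f = "\<lambda>s. - (\<delta> * W s / b) + 2 * ?c \<eta> * U s / b", OF _ _ _ _ _ _ s])
      fix s :: real assume s: "s \<in> {0..1}"
      show "(r has_vector_derivative \<phi>1 s - W1 s / b) (at s within {0..1})"
        unfolding r_def[abs_def] by (intro derivative_intros d\<phi> dW) (use s in auto)
      have "((\<lambda>s. \<phi>1 s - W1 s / b) has_vector_derivative
         - (hq \<delta> s * \<phi> s) - (- (?c (\<eta> + 3 * (u s)\<^sup>2) * W s) - 2 * ?c \<eta> * U s) / b) (at s within {0..1})"
        by (intro derivative_intros d\<phi> dW1) (use s in auto)
      also have "- (hq \<delta> s * \<phi> s) - (- (?c (\<eta> + 3 * (u s)\<^sup>2) * W s) - 2 * ?c \<eta> * U s) / b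
          = - (hq \<delta> s * r s) + (- (\<delta> * W s / b) + 2 * ?c \<eta> * U s / b)"
        using bb by (simp add: r_def hq_def field_simps)
      finally show "((\<lambda>s. \<phi>1 s - W1 s / b) has_vector_derivative
         - (hq \<delta> s * r s) + (- (\<delta> * W s / b) + 2 * ?c \<eta> * U s / b)) (at s within {0..1})" .
      have "cmod (\<delta> * W s / b) \<le> ?d * 25 / 2"
        unfolding norm_divide norm_mult by (intro frac_le mult_left_mono Wb s bb) auto
      moreover have "cmod (2 * ?c \<eta> * U s / b) \<le> 2 * \<bar>\<eta>\<bar> * 5 / 2"
        unfolding norm_divide norm_mult norm_of_real by (intro frac_le mult_mono Ub bb) auto
      ultimately show "cmod (- (\<delta> * W s / b) + 2 * ?c \<eta> * U s / b) \<le> 13 * ?d + 5 * \<bar>\<eta>\<bar>"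
        using norm_triangle_ineq[of "- (\<delta> * W s / b)" "2 * ?c \<eta> * U s / b"] norm_ge_zero[of \<delta>]
        unfolding norm_minus_cancel by linarith
    qed (use \<phi> ends bb hq_bound[OF \<delta>] in \<open>auto simp: r_def\<close>)
    then show ?thesis by (simp add: M_def)
  qed
  have pb: "cmod (p s) \<le> 2 * ?d * M" if s: "s \<in> {0..1}" for s
  proof -
    have "cmod (p s) \<le> (2 * ?d) * exp (77 + 2)"
    proof (rule hill_perturbation_bound(1)[where ?r1.0 = "\<lambda>s. \<psi>1 s - V1 s / v" and q = "hq \<delta>"
            and f = "\<lambda>s. - (\<delta> * V s / v)", OF _ _ _ _ _ _ s])
      fix s :: real assume s: "s \<in> {0..1}"
      show "(p has_vector_derivative \<psi>1 s - V1 s / v) (at s within {0..1})"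
        unfolding p_def[abs_def] by (intro derivative_intros d\<psi> dV) (use s in auto)
      have "((\<lambda>s. \<psi>1 s - V1 s / v) has_vector_derivative
         - (hq \<delta> s * \<psi> s) - (- (?c (\<eta> + 3 * (u s)\<^sup>2) * V s)) / v) (at s within {0..1})"
        by (intro derivative_intros d\<psi> dV1) (use s in auto)
      also have "- (hq \<delta> s * \<psi> s) - (- (?c (\<eta> + 3 * (u s)\<^sup>2) * V s)) / v
          = - (hq \<delta> s * p s) + - (\<delta> * V s / v)"
        using vb by (simp add: p_def hq_def field_simps)
      finally show "((\<lambda>s. \<psi>1 s - V1 s / v) has_vector_derivative
         - (hq \<delta> s * p s) + - (\<delta> * V s / v)) (at s within {0..1})" .
      have "cmod (\<delta> * V s / v) \<le> ?d * 20 / 14"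
        unfolding norm_divide norm_mult by (intro frac_le mult_left_mono Vb s vb) auto
      then show "cmod (- (\<delta> * V s / v)) \<le> 2 * ?d"
        using norm_ge_zero[of \<delta>] unfolding norm_minus_cancel by linarith
    qed (use \<psi> ends vb hq_bound[OF \<delta>] in \<open>auto simp: p_def\<close>)
    then show ?thesis by (simp add: M_def)
  qed
  \<comment> \<open>Four times the conserved energy.\<close>
  define h where "h = ?c (B ^ 4 + 2 * \<eta> * B\<^sup>2)"
  \<comment> \<open>\<open>W1\<close> ends at \<open>- v\<close>, so the Wronskian of
    \<open>\<psi>\<close> with \<open>W\<close> alone would retain \<open>\<psi> 1\<close>; the
    difference with that for \<open>V\<close> leaves just \<open>\<psi>1 1\<close>. The last term
    removes the product of the defect \<open>2 * \<eta> * u\<close> with the leading part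
    \<open>V / v\<close> of \<open>\<psi>\<close>, which would be of order \<eta> without a factor
    \<delta>.\<close>
  define \<Psi> where "\<Psi> s = (\<phi>1 s * V s - \<phi> s * V1 s) / v
      + ((\<psi>1 s * V s - \<psi> s * V1 s) - (\<psi>1 s * W s - \<psi> s * W1 s)) / b
      + \<delta> / (b * v) * ((U s * V s + h * ?c s) / 3) + ?c \<eta> / (v * b) * (U s * U s)" for s
  \<comment> \<open>Every term is now a product of \<delta>, or of \<open>p\<close>, with a second
    small factor.\<close>
  define D where "D s = - (\<delta> * r s * V s / v) - \<delta> * p s * V s / b + \<delta> * p s * W s / b
      - 2 * ?c \<eta> * U s * p s / b + \<delta> * ?c \<eta> * (U s * U s) / (3 * (b * v))" for s
  have d\<Psi>: "(\<Psi> has_vector_derivative D s) (at s within {0..1})" if s: "s \<in> {0..1}" for s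
  proof -
    have s': "0 \<le> s" "{0..1::real} \<subseteq> {0..}" using s by auto
    let ?k = "?c (\<eta> + 3 * (u s)\<^sup>2)"
    have "(u1 s)\<^sup>2 = (B ^ 4 + 2 * \<eta> * B\<^sup>2) / 2 - \<eta> * (u s)\<^sup>2 - u s ^ 4 / 2"
      using energy[of s] by (simp add: field_simps)
    from arg_cong[OF this, of ?c] have VV: "V s * V s = h / 2 - ?c \<eta> * U s * U s - U s ^ 4 / 2"
      by (simp add: h_def U_def V_def power2_eq_square)
    have "(\<Psi> has_vector_derivative
       (\<phi>1 s * V1 s + - (hq \<delta> s * \<phi> s) * V s - (\<phi> s * - (?k * V s) + \<phi>1 s * V1 s)) / v
      + ((\<psi>1 s * V1 s + - (hq \<delta> s * \<psi> s) * V s - (\<psi> s * - (?k * V s) + \<psi>1 s * V1 s))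
        - (\<psi>1 s * W1 s + - (hq \<delta> s * \<psi> s) * W s - (\<psi> s * (- (?k * W s) - 2 * ?c \<eta> * U s) + \<psi>1 s * W1 s))) / b
      + \<delta> / (b * v) * ((U s * V1 s + V s * V s + h * ?c 1) / 3) + ?c \<eta> / (v * b) * (U s * V s + V s * U s))
      (at s within {0..1})"
      unfolding \<Psi>_def[abs_def]
      by (intro derivative_intros dU dV dV1 dW dW1 d\<phi>[OF s'] d\<psi>[OF s'])
    also have "(\<phi>1 s * V1 s + - (hq \<delta> s * \<phi> s) * V s - (\<phi> s * - (?k * V s) + \<phi>1 s * V1 s)) / v
        = - (\<delta> * r s * V s / v) - \<delta> * (W s / b) * V s / v"
      using vb bb by (simp add: hq_def r_def field_simps)
    also have "((\<psi>1 s * V1 s + - (hq \<delta> s * \<psi> s) * V s - (\<psi> s * - (?k * V s) + \<psi>1 s * V1 s))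
        - (\<psi>1 s * W1 s + - (hq \<delta> s * \<psi> s) * W s - (\<psi> s * (- (?k * W s) - 2 * ?c \<eta> * U s) + \<psi>1 s * W1 s))) / b
       = (- \<delta> * (p s + V s / v) * V s + \<delta> * (p s + V s / v) * W s - 2 * ?c \<eta> * U s * (p s + V s / v)) / b"
      by (simp add: hq_def p_def algebra_simps)
    also have "U s * V1 s + V s * V s + h * ?c 1 = 3 * (V s * V s) + ?c \<eta> * (U s * U s)"
      unfolding VV by (simp add: V1_def U_def field_simps power2_eq_square power3_eq_cube power4_eq_xxxx)
    also have "- (\<delta> * r s * V s / v) - \<delta> * (W s / b) * V s / v
       + (- \<delta> * (p s + V s / v) * V s + \<delta> * (p s + V s / v) * W s - 2 * ?c \<eta> * U s * (p s + V s / v)) / b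
       + \<delta> / (b * v) * ((3 * (V s * V s) + ?c \<eta> * (U s * U s)) / 3) + ?c \<eta> / (v * b) * (U s * V s + V s * U s) = D s"
      using vb bb unfolding D_def by (simp add: field_simps)
    finally show ?thesis .
  qed
  let ?m = "?d * (?d + \<bar>\<eta>\<bar>)"
  \<comment> \<open>The five terms contribute at most 26, 20, 25, 10 and 1 times
    \<open>M * ?m\<close>, so 900 is generous.\<close>
  have Db: "cmod (D s) \<le> 900 * M * ?m" if s: "s \<in> {0..1}" for s
  proof -
    have d0: "0 \<le> ?d" and dd: "?d * ?d \<le> ?m" "?d * \<bar>\<eta>\<bar> \<le> ?m" by (auto intro: mult_left_mono)
    have M0: "0 \<le> M" using M by simp
    have m0: "0 \<le> ?m" by simp
    have 1: "cmod (\<delta> * r s * V s / v) \<le> ?d * ((13 * ?d + 5 * \<bar>\<eta>\<bar>) * M) * 20 / 14"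
      unfolding norm_divide norm_mult using M0 by (intro frac_le mult_mono rb[OF s] Vb vb) auto
    have "?d * ((13 * ?d + 5 * \<bar>\<eta>\<bar>) * M) * 20 / 14 = M * (13 * (?d * ?d) + 5 * (?d * \<bar>\<eta>\<bar>)) * (20 / 14)"
      by (simp add: algebra_simps)
    also have "\<dots> \<le> M * (13 * ?m + 5 * ?m) * (20 / 14)"
      using dd M0 by (intro mult_mono add_mono) auto
    finally have 1: "cmod (\<delta> * r s * V s / v) \<le> 26 * M * ?m"
      using 1 mult_nonneg_nonneg[OF M0 m0] by (simp add: algebra_simps)
    have 2: "cmod (\<delta> * p s * V s / b) \<le> ?d * (2 * ?d * M) * 20 / 2"
      unfolding norm_divide norm_mult using M0 by (intro frac_le mult_mono pb[OF s] Vb bb) auto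
    have 3: "cmod (\<delta> * p s * W s / b) \<le> ?d * (2 * ?d * M) * 25 / 2"
      unfolding norm_divide norm_mult using M0 by (intro frac_le mult_mono pb[OF s] Wb[OF s] bb) auto
    have 4: "cmod (2 * ?c \<eta> * U s * p s / b) \<le> 2 * \<bar>\<eta>\<bar> * 5 * (2 * ?d * M) / 2"
      unfolding norm_divide norm_mult norm_of_real using M0 by (intro frac_le mult_mono pb[OF s] Ub bb) auto
    have 5: "cmod (\<delta> * ?c \<eta> * (U s * U s) / (3 * (b * v))) \<le> ?d * \<bar>\<eta>\<bar> * (5 * 5) / (3 * (2 * 14))"
      unfolding norm_divide norm_mult norm_of_real using bb vb by (intro frac_le mult_mono Ub) auto
    have Mdd: "M * (?d * ?d) \<le> M * ?m" "M * (?d * \<bar>\<eta>\<bar>) \<le> M * ?m" using dd M0 by (auto intro: mult_left_mono)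
    have "1 * (?d * \<bar>\<eta>\<bar>) \<le> M * (?d * \<bar>\<eta>\<bar>)" using M by (intro mult_right_mono) auto
    then have 5: "cmod (\<delta> * ?c \<eta> * (U s * U s) / (3 * (b * v))) \<le> M * ?m"
      using 5 Mdd mult_nonneg_nonneg[OF d0 abs_ge_zero[of \<eta>]] by linarith
    have 2: "cmod (\<delta> * p s * V s / b) \<le> 20 * (M * ?m)" using 2 Mdd by (simp add: algebra_simps)
    have 3: "cmod (\<delta> * p s * W s / b) \<le> 25 * (M * ?m)" using 3 Mdd by (simp add: algebra_simps)
    have 4: "cmod (2 * ?c \<eta> * U s * p s / b) \<le> 10 * (M * ?m)" using 4 Mdd by (simp add: algebra_simps)
    have "cmod (D s) \<le> cmod (\<delta> * r s * V s / v) + cmod (\<delta> * p s * V s / b) + cmod (\<delta> * p s * W s / b)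
      + cmod (2 * ?c \<eta> * U s * p s / b) + cmod (\<delta> * ?c \<eta> * (U s * U s) / (3 * (b * v)))"
      unfolding D_def
      by (intro norm_triangle_le order_trans[OF norm_triangle_ineq4] add_right_mono) simp
    also have "\<dots> \<le> 900 * M * ?m" using 1 2 3 4 5 mult_nonneg_nonneg[OF M0 m0] by simp
    finally show ?thesis .
  qed
  have "(D has_integral \<Psi> 1 - \<Psi> 0) {0..1}"
    by (intro fundamental_theorem_of_calculus d\<Psi>) auto
  then have "cmod (\<Psi> 1 - \<Psi> 0) \<le> 900 * M * ?m * measure lborel (cbox 0 (1::real))"
    using M Db by (intro has_integral_bound[of _ D]) auto
  then have *: "cmod (\<Psi> 1 - \<Psi> 0) \<le> 900 * M * ?m" by simp
  have "\<Psi> 1 - \<Psi> 0 = \<phi> 1 + \<psi>1 1 + 2 + \<delta> / 3 * (h / (b * v))"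
    unfolding \<Psi>_def ends \<phi>(2,3) \<psi>(2,3) using vb bb by (simp add: field_simps)
  \<comment> \<open>At \<open>\<eta> = 0\<close> this ratio is exactly -1, which is the source of
    the slope 1/3 of the trace; the correction is again of order \<delta> times \<eta>.\<close>
  also have "h / (b * v) = - 1 - ?c (\<eta> / (\<eta> + B\<^sup>2))"
  proof -
    have pos: "\<eta> + B\<^sup>2 \<noteq> 0" "B \<noteq> 0" using B_bounds \<eta> by auto
    have "(B ^ 4 + 2 * \<eta> * B\<^sup>2) / (B * v0) = - 1 - \<eta> / (\<eta> + B\<^sup>2)"
    proof -
      have "B * v0 = - (B\<^sup>2 * (\<eta> + B\<^sup>2))"
        by (simp add: v0_def algebra_simps power2_eq_square power3_eq_cube)
      moreover have "B ^ 4 + 2 * \<eta> * B\<^sup>2 = B\<^sup>2 * ((\<eta> + B\<^sup>2) + \<eta>)"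
        by (simp add: algebra_simps power2_eq_square power4_eq_xxxx)
      ultimately have "(B ^ 4 + 2 * \<eta> * B\<^sup>2) / (B * v0) = - (((\<eta> + B\<^sup>2) + \<eta>) / (\<eta> + B\<^sup>2))"
        using pos by simp
      also have "\<dots> = - 1 - \<eta> / (\<eta> + B\<^sup>2)"
        unfolding add_divide_distrib[of "\<eta> + B\<^sup>2" \<eta>] divide_self[OF pos(1)] by simp
      finally show ?thesis .
    qed
    from arg_cong[OF this, of ?c] show ?thesis by (simp only: h_def b_def v_def) simp
  qed
  finally have E: "\<phi> 1 + \<psi>1 1 + 2 - \<delta> / 3 = (\<Psi> 1 - \<Psi> 0) + \<delta> / 3 * ?c (\<eta> / (\<eta> + B\<^sup>2))"
    by (simp add: algebra_simps)
  have "\<bar>\<eta> / (\<eta> + B\<^sup>2)\<bar> \<le> \<bar>\<eta>\<bar> / 1" unfolding abs_divide using B_bounds \<eta> by (intro frac_le) auto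
  then have "cmod (\<delta> / 3 * ?c (\<eta> / (\<eta> + B\<^sup>2))) \<le> ?d / 3 * \<bar>\<eta>\<bar>"
    unfolding norm_mult norm_of_real by (intro mult_mono) (auto simp: norm_divide)
  also have "\<dots> \<le> ?d * (?d + \<bar>\<eta>\<bar>)" by (intro mult_mono) auto
  also have "\<dots> \<le> M * ?m" using M mult_right_mono[of 1 M ?m] by simp
  finally have "cmod (\<phi> 1 + \<psi>1 1 + 2 - \<delta> / 3) \<le> 900 * M * ?m + M * ?m"
    unfolding E using * by (intro norm_triangle_le add_mono)
  also have "\<dots> \<le> trace_const * ?m" using M by (simp add: trace_const_def M_def)
  finally show ?thesis by (simp add: mult.assoc)
qed

section \<open>Continuity, reality and nondegeneracy of the monodromy matrix\<close>

lemma continuous_on_parameter: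
  assumes y: "\<And>\<delta>. cmod \<delta> \<le> 1 \<Longrightarrow> hill_solution (hq \<delta>) (y \<delta>) (y1 \<delta>)"
    and 0: "\<And>\<delta>. y \<delta> 0 = c" "\<And>\<delta>. y1 \<delta> 0 = d"
  shows "continuous_on (cball 0 1) (\<lambda>\<delta>. y \<delta> 1)" "continuous_on (cball 0 1) (\<lambda>\<delta>. y1 \<delta> 1)"
proof -
  have "((\<lambda>\<delta>. y \<delta> 1) \<longlongrightarrow> y \<delta>' 1) (at \<delta>' within cball 0 1) \<and> ((\<lambda>\<delta>. y1 \<delta> 1) \<longlongrightarrow> y1 \<delta>' 1) (at \<delta>' within cball 0 1)"
    if \<delta>': "\<delta>' \<in> cball 0 1" for \<delta>'
  proof -
    note y' = y[of \<delta>', unfolded mem_cball_0[symmetric], OF \<delta>']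
    have "continuous_on {0..1} (y \<delta>')"
      unfolding continuous_on_eq_continuous_within
      using hill_solutionD(1)[OF y', of _ "{0..1}"] has_vector_derivative_continuous by fastforce
    then have "bounded (y \<delta>' ` {0..1})"
      using compact_Icc compact_continuous_image compact_imp_bounded by blast
    then obtain L where L: "\<And>s. s \<in> {0..1} \<Longrightarrow> cmod (y \<delta>' s) \<le> L" unfolding bounded_iff by blast
    \<comment> \<open>The difference of two solutions satisfies the equation for \<delta> with
      forcing \<open>(\<delta> - \<delta>') * y \<delta>'\<close>, where \<open>y \<delta>'\<close>
      is fixed and bounded.\<close>
    have *: "cmod (y \<delta> 1 - y \<delta>' 1) \<le> (cmod (\<delta> - \<delta>') * L) * exp (77 + 2) \<and>
        cmod (y1 \<delta> 1 - y1 \<delta>' 1) \<le> (cmod (\<delta> - \<delta>') * L) * exp (77 + 2)" if \<delta>: "cmod \<delta> \<le> 1" for \<delta>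
    proof -
      have d1: "((\<lambda>s. y \<delta> s - y \<delta>' s) has_vector_derivative y1 \<delta> s - y1 \<delta>' s) (at s within {0..1})" if s: "s \<in> {0..1}" for s
        using s by (intro derivative_intros hill_solutionD(1)[OF y[OF \<delta>]] hill_solutionD(1)[OF y']) auto
      have d2: "((\<lambda>s. y1 \<delta> s - y1 \<delta>' s) has_vector_derivative
         - (hq \<delta> s * (y \<delta> s - y \<delta>' s)) + - ((\<delta> - \<delta>') * y \<delta>' s)) (at s within {0..1})" if s: "s \<in> {0..1}" for s
      proof -
        have "((\<lambda>s. y1 \<delta> s - y1 \<delta>' s) has_vector_derivative - (hq \<delta> s * y \<delta> s) - - (hq \<delta>' s * y \<delta>' s)) (at s within {0..1})"
          using s by (intro has_vector_derivative_diff hill_solutionD(2)[OF y[OF \<delta>]] hill_solutionD(2)[OF y']) auto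
        also have "- (hq \<delta> s * y \<delta> s) - - (hq \<delta>' s * y \<delta>' s) = - (hq \<delta> s * (y \<delta> s - y \<delta>' s)) + - ((\<delta> - \<delta>') * y \<delta>' s)"
          by (simp add: hq_def algebra_simps)
        finally show ?thesis .
      qed
      have f: "cmod (- ((\<delta> - \<delta>') * y \<delta>' s)) \<le> cmod (\<delta> - \<delta>') * L" if s: "s \<in> {0..1}" for s
        unfolding norm_minus_cancel norm_mult by (intro mult_left_mono L s) auto
      have "y \<delta> 0 - y \<delta>' 0 = 0" "y1 \<delta> 0 - y1 \<delta>' 0 = 0" by (simp_all add: 0)
      from hill_perturbation_bound[OF d1 d2 this hq_bound[OF \<delta>] f, of 1] show ?thesis by simp
    qed
    have ev: "\<forall>\<^sub>F \<delta> in at \<delta>' within cball 0 1. cmod \<delta> \<le> 1"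
      by (simp add: eventually_at_filter)
    have lim: "((\<lambda>\<delta>. (cmod (\<delta> - \<delta>') * L) * exp (77 + 2)) \<longlongrightarrow> (cmod (\<delta>' - \<delta>') * L) * exp (77 + 2)) (at \<delta>' within cball 0 1)"
      by (intro tendsto_intros)
    have "((\<lambda>\<delta>. y \<delta> 1 - y \<delta>' 1) \<longlongrightarrow> 0) (at \<delta>' within cball 0 1)" "((\<lambda>\<delta>. y1 \<delta> 1 - y1 \<delta>' 1) \<longlongrightarrow> 0) (at \<delta>' within cball 0 1)"
      by (rule Lim_null_comparison[OF eventually_mono[OF ev] lim[simplified]]; use * in simp)+
    then show ?thesis by (simp add: LIM_zero_iff)
  qed
  then show "continuous_on (cball 0 1) (\<lambda>\<delta>. y \<delta> 1)" "continuous_on (cball 0 1) (\<lambda>\<delta>. y1 \<delta> 1)"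
    unfolding continuous_on_def by blast+
qed

text \<open>Conjugation preserves the equation for real \<delta>, and uniqueness does the rest. The
  intermediate value argument for the unstable case needs a real trace.\<close>

lemma hill_real_at_1:
  assumes y: "hill_solution (hq \<delta>) y y1" and \<delta>: "cmod \<delta> \<le> 1" "cnj \<delta> = \<delta>"
    and 0: "cnj (y 0) = y 0" "cnj (y1 0) = y1 0"
  shows "Im (y 1) = 0" "Im (y1 1) = 0"
proof -
  have "cnj (hq \<delta> s) = hq \<delta> s" for s by (simp add: hq_def \<delta>)
  with hill_solution_cnj[OF y] have "hill_solution (hq \<delta>) (\<lambda>t. cnj (y t)) (\<lambda>t. cnj (y1 t))" by simp
  from hill_solution_unique[OF this y _ _ hq_bound[OF \<delta>(1)], of 1] 0
  have "cnj (y 1) = y 1" "cnj (y1 1) = y1 1" by auto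
  then show "Im (y 1) = 0" "Im (y1 1) = 0" by (simp_all add: complex_eq_iff)
qed

text \<open>At \<delta> = 0 the double eigenvalue -1 has a one-dimensional eigenspace, because the
  half period varies with the amplitude. Quantitatively, \<open>\<phi>\<close> is close to
  \<open>w / B\<close>, whose derivative at 1 is \<open>\<eta> + B\<^sup>2 \<ge> 7\<close>, and
  \<open>small\<close> bounds the error by 1.\<close>

lemma monodromy_not_scalar:
  assumes small: "\<bar>\<eta>\<bar> * 5 * exp 79 \<le> 1"
    and \<phi>: "hill_solution (hq 0) \<phi> \<phi>1" "\<phi> 0 = 1" "\<phi>1 0 = 0"
  shows "\<phi>1 1 \<noteq> 0"
proof -
  let ?c = complex_of_real
  note d\<phi> = hill_solutionD[OF \<phi>(1)]
  have B0: "B \<noteq> 0" using B_bounds by simp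
  have "cmod (\<phi>1 1 - ?c (w1 1) / ?c B) \<le> (5 * \<bar>\<eta>\<bar>) * exp (77 + 2)"
  proof (rule hill_perturbation_bound(2)[where r = "\<lambda>s. \<phi> s - ?c (w s) / ?c B"
        and ?r1.0 = "\<lambda>s. \<phi>1 s - ?c (w1 s) / ?c B" and q = "hq 0" and f = "\<lambda>s. ?c (2 * \<eta> * u s / B)"])
    fix s :: real assume s: "s \<in> {0..1}"
    show "((\<lambda>s. \<phi> s - ?c (w s) / ?c B) has_vector_derivative \<phi>1 s - ?c (w1 s) / ?c B) (at s within {0..1})"
      by (intro derivative_intros d\<phi> vd) (use s in auto)
    have "((\<lambda>s. \<phi>1 s - ?c (w1 s) / ?c B) has_vector_derivative
         - (hq 0 s * \<phi> s) - ?c (- ((\<eta> + 3 * (u s)\<^sup>2) * w s) - 2 * \<eta> * u s) / ?c B) (at s within {0..1})"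
      by (intro derivative_intros d\<phi> vd) (use s in auto)
    also have "- (hq 0 s * \<phi> s) - ?c (- ((\<eta> + 3 * (u s)\<^sup>2) * w s) - 2 * \<eta> * u s) / ?c B
       = - (hq 0 s * (\<phi> s - ?c (w s) / ?c B)) + ?c (2 * \<eta> * u s / B)"
      using B0 by (simp add: hq_def field_simps)
    finally show "((\<lambda>s. \<phi>1 s - ?c (w1 s) / ?c B) has_vector_derivative
        - (hq 0 s * (\<phi> s - ?c (w s) / ?c B)) + ?c (2 * \<eta> * u s / B)) (at s within {0..1})" .
    show "cmod (hq 0 s) \<le> 77" by (rule hq_bound) simp
    have "\<bar>2 * \<eta> * u s / B\<bar> \<le> 2 * \<bar>\<eta>\<bar> * 5 / 2"
      unfolding abs_divide abs_mult using B_bounds by (intro frac_le mult_mono u_bound5) auto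
    then show "cmod (?c (2 * \<eta> * u s / B)) \<le> 5 * \<bar>\<eta>\<bar>" unfolding norm_of_real by simp
  qed (use \<phi> B0 in \<open>auto simp: w_def w1_def init\<close>)
  also have "\<dots> \<le> 1" using small by simp
  finally have *: "cmod (\<phi>1 1 - ?c (w1 1) / ?c B) \<le> 1" .
  have "w1 1 / B = \<eta> + B\<^sup>2"
    using B0 by (simp add: w1_def at1 field_simps power2_eq_square power3_eq_cube)
  then have "?c (w1 1) / ?c B = ?c (\<eta> + B\<^sup>2)" by (metis of_real_divide)
  moreover have "7 \<le> cmod (?c (\<eta> + B\<^sup>2))" unfolding norm_of_real using B_bounds \<eta> by linarith
  ultimately show ?thesis using * by (auto simp del: of_real_add of_real_power)
qed

end

section \<open>The linearized delay equation\<close>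

lemma has_vector_derivative_affine:
  assumes f: "(f has_vector_derivative f') (at (c * s + d) within S)"
    and S: "\<And>s. s \<in> S' \<Longrightarrow> c * s + d \<in> S"
  shows "((\<lambda>s. f (c * s + d)) has_vector_derivative c *\<^sub>R f') (at s within S')"
proof -
  have "((\<lambda>s. c * s + d) has_vector_derivative c) (at s within S')"
    by (auto intro!: derivative_eq_intros simp flip: has_real_derivative_iff_has_vector_derivative)
  from vector_diff_chain_within[OF this, of f f'] show ?thesis
    using has_vector_derivative_within_subset[OF f] S by (auto simp: o_def image_subset_iff)
qed

text \<open>The value space is left open because the estimate serves both the real linearization and
  its complexification.\<close>

lemma delay_field_lipschitz:
  fixes p p' r r' :: "'a::real_normed_vector \<times> 'a"
  shows "norm ((snd p, - (a *\<^sub>R fst p) - b *\<^sub>R fst r - c *\<^sub>R fst p) -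
    (snd p', - (a *\<^sub>R fst p') - b *\<^sub>R fst r' - c *\<^sub>R fst p'))
    \<le> (1 + \<bar>a\<bar> + \<bar>b\<bar> + \<bar>c\<bar>) * (norm (p - p') + norm (r - r'))"
proof -
  have fs: "norm (fst q) \<le> norm q" "norm (snd q) \<le> norm q" for q :: "'a \<times> 'a"
    by (metis norm_fst_le prod.collapse) (metis norm_snd_le prod.collapse)
  let ?p = "p - p'" and ?r = "r - r'"
  let ?N = "norm ?p + norm ?r"
  have N: "norm ?p \<le> ?N" "norm ?r \<le> ?N" by auto
  have "(snd p, - (a *\<^sub>R fst p) - b *\<^sub>R fst r - c *\<^sub>R fst p) -
    (snd p', - (a *\<^sub>R fst p') - b *\<^sub>R fst r' - c *\<^sub>R fst p')
     = (snd ?p, - (a *\<^sub>R fst ?p) - b *\<^sub>R fst ?r - c *\<^sub>R fst ?p)"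
    by (simp add: algebra_simps)
  also have "norm \<dots> \<le> norm (snd ?p) + norm (- (a *\<^sub>R fst ?p) - b *\<^sub>R fst ?r - c *\<^sub>R fst ?p)"
    by (rule norm_Pair_le)
  also have "\<dots> \<le> norm (snd ?p) + (norm (a *\<^sub>R fst ?p) + norm (b *\<^sub>R fst ?r) + norm (c *\<^sub>R fst ?p))"
    by (intro add_left_mono order_trans[OF norm_triangle_ineq4] add_right_mono) simp
  also have "\<dots> \<le> ?N + (\<bar>a\<bar> * ?N + \<bar>b\<bar> * ?N + \<bar>c\<bar> * ?N)"
    unfolding norm_scaleR using order_trans[OF fs(1) N(1)] order_trans[OF fs(2) N(1)] order_trans[OF fs(1) N(2)]
    by (intro add_mono mult_left_mono) auto
  also have "\<dots> = (1 + \<bar>a\<bar> + \<bar>b\<bar> + \<bar>c\<bar>) * ?N" by (simp add: algebra_simps)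
  finally show ?thesis .
qed

text \<open>The complexified counterpart of \<open>linearized_solution\<close>, with the components
  named separately and without the history, so that shifts and linear combinations stay within the
  notion.\<close>

definition delay_solution ::
  "real \<Rightarrow> real \<Rightarrow> real \<Rightarrow> (real \<Rightarrow> real) \<Rightarrow> (real \<Rightarrow> complex) \<Rightarrow> (real \<Rightarrow> complex) \<Rightarrow> bool" where
  "delay_solution a b T x y y1 \<longleftrightarrow> continuous_on {-T..} y \<and> continuous_on {-T..} y1 \<and>
     (\<forall>t\<ge>0. (y has_vector_derivative y1 t) (at t within {0..}) \<and>
       (y1 has_vector_derivative - (a *\<^sub>R y t) - b *\<^sub>R y (t - T) - (3 * (x t)\<^sup>2) *\<^sub>R y t) (at t within {0..}))"

lemma delay_solution_lincomb:
  assumes "delay_solution a b T x y y1" "delay_solution a b T x z z1"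
  shows "delay_solution a b T x (\<lambda>t. c * y t + d * z t) (\<lambda>t. c * y1 t + d * z1 t)"
  using assms unfolding delay_solution_def
  by (auto intro!: derivative_eq_intros continuous_intros simp: algebra_simps)

lemma delay_solution_shift:
  assumes y: "delay_solution a b T x y y1" and s: "0 \<le> s" and x: "\<And>t. (x (t + s))\<^sup>2 = (x t)\<^sup>2"
  shows "delay_solution a b T x (\<lambda>t. y (t + s)) (\<lambda>t. y1 (t + s))"
  unfolding delay_solution_def
proof (intro conjI allI impI)
  have "continuous_on {-T..} y" "continuous_on {-T..} y1"
    using y by (auto simp: delay_solution_def)
  then show "continuous_on {-T..} (\<lambda>t. y (t + s))" "continuous_on {-T..} (\<lambda>t. y1 (t + s))"
    by (auto intro!: continuous_on_compose2[of "{-T..}"] continuous_intros simp: s add_increasing2)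
  fix t :: real assume t: "0 \<le> t"
  then have "(y has_vector_derivative y1 (1 * t + s)) (at (1 * t + s) within {0..})"
    "(y1 has_vector_derivative - (a *\<^sub>R y (t + s)) - b *\<^sub>R y (t - T + s) - (3 * (x t)\<^sup>2) *\<^sub>R y (t + s)) (at (1 * t + s) within {0..})"
    using y[unfolded delay_solution_def, THEN conjunct2, THEN conjunct2, rule_format, of "t + s"] s
    by (auto simp: x add_diff_eq diff_add_eq)
  from this[THEN has_vector_derivative_affine, of "{0..}"] s
  show "((\<lambda>t. y (t + s)) has_vector_derivative y1 (t + s)) (at t within {0..})"
    "((\<lambda>t. y1 (t + s)) has_vector_derivative
       - (a *\<^sub>R y (t + s)) - b *\<^sub>R y (t - T + s) - (3 * (x t)\<^sup>2) *\<^sub>R y (t + s)) (at t within {0..})"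
    by auto
qed

locale bounded_coefficient =
  fixes a b T M :: real and x :: "real \<Rightarrow> real"
  assumes T: "0 < T" and xc: "continuous_on UNIV x" and xM: "\<And>t. (x t)\<^sup>2 \<le> M"
begin

lemma field_lipschitz:
  fixes p p' r r' :: "'a::real_normed_vector \<times> 'a"
  shows "norm ((snd p, - (a *\<^sub>R fst p) - b *\<^sub>R fst r - (3 * (x t)\<^sup>2) *\<^sub>R fst p) -
    (snd p', - (a *\<^sub>R fst p') - b *\<^sub>R fst r' - (3 * (x t)\<^sup>2) *\<^sub>R fst p'))
    \<le> (1 + \<bar>a\<bar> + \<bar>b\<bar> + 3 * M) * (norm (p - p') + norm (r - r'))"
proof -
  have "1 + \<bar>a\<bar> + \<bar>b\<bar> + \<bar>3 * (x t)\<^sup>2\<bar> \<le> 1 + \<bar>a\<bar> + \<bar>b\<bar> + 3 * M" using xM[of t] by simp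
  then show ?thesis
    by (intro order_trans[OF delay_field_lipschitz] mult_right_mono) auto
qed

lemma delay_solution_exists:
  fixes \<phi> :: "real \<Rightarrow> complex \<times> complex"
  assumes \<phi>: "\<phi> \<in> phase_space T"
  obtains y y1 where "delay_solution a b T x y y1" "\<And>t. t \<in> {-T..0} \<Longrightarrow> \<phi> t = (y t, y1 t)"
proof -
  define F where "F t p r = (snd p, - (a *\<^sub>R fst p) - b *\<^sub>R fst r - (3 * (x t)\<^sup>2) *\<^sub>R fst p)"
    for t and p r :: "complex \<times> complex"
  have cont: "continuous_on UNIV (\<lambda>(t, p, r). F t p r)"
    unfolding F_def case_prod_beta by (auto intro!: continuous_intros continuous_on_compose2[OF xc])
  have lip: "norm (F t p r - F t p' r') \<le> (1 + \<bar>a\<bar> + \<bar>b\<bar> + 3 * M) * (norm (p - p') + norm (r - r'))" for t p r p' r'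
    unfolding F_def by (rule field_lipschitz)
  have zero: "norm (F t 0 0) \<le> 0" for t by (simp add: F_def)
  have "continuous_on {-T..0} \<phi>" using \<phi> by (simp add: phase_space_def)
  from delay_equation_exists[OF less_imp_le[OF T] cont lip zero this] obtain Y where Y: "continuous_on {-T..} Y" "\<And>t. t \<in> {-T..0} \<Longrightarrow> Y t = \<phi> t"
    "\<And>t. 0 \<le> t \<Longrightarrow> (Y has_vector_derivative F t (Y t) (Y (t - T))) (at t within {0..})"
    by blast
  show ?thesis
  proof (rule that[of "\<lambda>t. fst (Y t)" "\<lambda>t. snd (Y t)"])
    show "delay_solution a b T x (\<lambda>t. fst (Y t)) (\<lambda>t. snd (Y t))"
      unfolding delay_solution_def
      using bounded_linear.has_vector_derivative[OF bounded_linear_fst Y(3)]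
        bounded_linear.has_vector_derivative[OF bounded_linear_snd Y(3)] Y(1)
      by (auto simp: F_def intro!: continuous_intros)
  qed (use Y in auto)
qed

lemma delay_solution_unique:
  assumes y: "delay_solution a b T x y y1" and z: "delay_solution a b T x z z1"
    and eq: "\<And>t. t \<in> {-T..0} \<Longrightarrow> y t = z t \<and> y1 t = z1 t" and t: "-T \<le> t"
  shows "y t = z t \<and> y1 t = z1 t"
proof -
  define F where "F t p r = (snd p, - (a *\<^sub>R fst p) - b *\<^sub>R fst r - (3 * (x t)\<^sup>2) *\<^sub>R fst p)"
    for t and p r :: "complex \<times> complex"
  have "(y t, y1 t) = (z t, z1 t)"
  proof (rule delay_equation_unique[where F = F and K = "1 + \<bar>a\<bar> + \<bar>b\<bar> + 3 * M" and T = T])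
    show "norm (F t p r - F t p' r) \<le> (1 + \<bar>a\<bar> + \<bar>b\<bar> + 3 * M) * norm (p - p')" for t p p' r
      using field_lipschitz[of p r t p' r] by (simp add: F_def)
    fix t :: real assume "0 \<le> t"
    then show "((\<lambda>t. (y t, y1 t)) has_vector_derivative F t (y t, y1 t) (y (t - T), y1 (t - T))) (at t within {0..})"
      "((\<lambda>t. (z t, z1 t)) has_vector_derivative F t (z t, z1 t) (z (t - T), z1 (t - T))) (at t within {0..})"
      using y z unfolding F_def delay_solution_def by (auto intro!: has_vector_derivative_Pair)
  qed (use T eq t in auto)
  then show ?thesis by simp
qed

lemma monodromy_segment:
  assumes y: "linearized_solution a b T x \<phi> y" and p: "0 \<le> p"
  shows "monodromy a b T x p \<phi> = segment T y p"
proof -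
  define z where "z = (SOME y. linearized_solution a b T x \<phi> y)"
  have z: "linearized_solution a b T x \<phi> z" unfolding z_def by (rule someI[of "linearized_solution a b T x \<phi>", OF y])
  define F where "F t p r = (snd p, - (a * fst p) - b * fst r - (3 * (x t)\<^sup>2) * fst p)"
    for t and p r :: "real \<times> real"
  have "z t = y t" if t: "-T \<le> t" for t
  proof (rule delay_equation_unique[where F = F and K = "1 + \<bar>a\<bar> + \<bar>b\<bar> + 3 * M" and T = T])
    show "norm (F t p r - F t p' r) \<le> (1 + \<bar>a\<bar> + \<bar>b\<bar> + 3 * M) * norm (p - p')" for t p p' r
      using field_lipschitz[of p r t p' r] by (simp add: F_def)
    fix t assume "t \<in> {-T..0}"
    moreover have "segment T z 0 t = segment T y 0 t" using y z by (simp add: linearized_solution_def)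
    ultimately show "z t = y t" by (simp add: segment_def)
  qed (use T t y z in \<open>auto simp: linearized_solution_def F_def\<close>)
  then show ?thesis using p unfolding monodromy_def z_def[symmetric] by (auto simp: segment_def)
qed

lemma complexify_monodromy:
  assumes \<phi>: "\<phi> \<in> phase_space T" and y: "delay_solution a b T x y y1"
    and hist: "\<And>t. t \<in> {-T..0} \<Longrightarrow> \<phi> t = (y t, y1 t)" and p: "0 \<le> p"
  shows "complexify (monodromy a b T x p) \<phi> = segment T (\<lambda>t. (y t, y1 t)) p"
proof -
  have out: "\<phi> t = 0" if "t \<notin> {-T..0}" for t using \<phi> that unfolding phase_space_def by blast
  \<comment> \<open>Real and imaginary part are treated at once: a real-linear functional commutes
    with the real coefficients of the equation.\<close>
  have lin: "linearized_solution a b T x (\<lambda>t. (h (fst (\<phi> t)), h (snd (\<phi> t)))) (\<lambda>t. (h (y t), h (y1 t)))"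
    if h: "bounded_linear h" for h :: "complex \<Rightarrow> real"
    unfolding linearized_solution_def
  proof (intro conjI allI impI)
    interpret h: bounded_linear h by (rule h)
    show "continuous_on {-T..} (\<lambda>t. (h (y t), h (y1 t)))"
      using y unfolding delay_solution_def by (auto intro!: continuous_intros h.continuous_on)
    show "segment T (\<lambda>t. (h (y t), h (y1 t))) 0 = (\<lambda>t. (h (fst (\<phi> t)), h (snd (\<phi> t))))"
      using hist out by (auto simp: segment_def fun_eq_iff h.zero zero_prod_def)
    fix t :: real assume "0 \<le> t"
    then have "(y has_vector_derivative y1 t) (at t within {0..})"
      "(y1 has_vector_derivative - (a *\<^sub>R y t) - b *\<^sub>R y (t - T) - (3 * (x t)\<^sup>2) *\<^sub>R y t) (at t within {0..})"
      using y unfolding delay_solution_def by auto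
    from this[THEN h.has_vector_derivative]
    show "((\<lambda>t. (h (y t), h (y1 t))) has_vector_derivative
        (snd (h (y t), h (y1 t)), - (a * fst (h (y t), h (y1 t))) - b * fst (h (y (t - T)), h (y1 (t - T)))
          - 3 * (x t)\<^sup>2 * fst (h (y t), h (y1 t)))) (at t within {0..})"
      by (auto intro!: has_vector_derivative_Pair simp: h.diff h.neg h.scaleR)
  qed
  show ?thesis
    unfolding complexify_def Let_def monodromy_segment[OF lin[OF bounded_linear_Re] p]
      monodromy_segment[OF lin[OF bounded_linear_Im] p]
    by (auto simp: segment_def fun_eq_iff zero_prod_def complex_eq_iff)
qed

lemma segment_phase_space:
  assumes "delay_solution a b T x y y1" "0 \<le> p"
  shows "segment T (\<lambda>t. (y t, y1 t)) p \<in> phase_space T"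
proof -
  have "continuous_on {-T..0} (\<lambda>t. (y (p + t), y1 (p + t)))"
    using assms unfolding delay_solution_def
    by (auto intro!: continuous_intros continuous_on_compose2[of "{-T..}"])
  then have "continuous_on {-T..0} (segment T (\<lambda>t. (y t, y1 t)) p)"
    by (rule continuous_on_eq) (simp add: segment_def)
  then show ?thesis by (auto simp: phase_space_def segment_def)
qed

end

lemma anti_iterate:
  fixes f :: "real \<Rightarrow> real"
  assumes "\<And>s. f (s + \<tau>) = - f s"
  shows "f (s + real k * \<tau>) = (-1) ^ k * f s"
  using assms[of "s + real k' * \<tau>" for k'] by (induction k) (simp_all add: algebra_simps)

lemma stable_not_unstable:
  assumes "linearly_stable a b T x p" shows "\<not> linearly_unstable a b T x p"
  using assms unfolding linearly_stable_def linearly_unstable_def by (metis less_asym norm_one less_irrefl)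

section \<open>Floquet multipliers\<close>

locale delayed_orbit =
  fixes a b T \<alpha> \<tau> :: real and n :: nat and x :: "real \<Rightarrow> real"
  assumes b: "b \<noteq> 0" and T0: "0 < T" and n: "0 < n" and \<tau>: "\<tau> = T / real n"
    and \<alpha>: "\<alpha> = a + (-1) ^ n * b"
    and orbit: "normalized_duffing_orbit \<alpha> (2 * \<tau>) x"
    and small: "\<bar>\<tau>\<^sup>2 * \<alpha>\<bar> * 5 * exp 79 \<le> 1"
begin

lemma \<tau>0: "0 < \<tau>" using T0 n by (simp add: \<tau>)

lemma n\<tau>: "real n * \<tau> = T" using n by (simp add: \<tau>)

lemma dx: "(x has_real_derivative deriv x s) (at s)"
  "(deriv x has_real_derivative - (\<alpha> * x s) - x s ^ 3) (at s)"
  using orbit by (auto simp: normalized_duffing_orbit_def duffing_solution_def)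

lemma x0: "0 < x 0" "deriv x 0 = 0"
  using orbit by (auto simp: normalized_duffing_orbit_def)

lemma anti: "x (t + \<tau>) = - x t"
  by (rule normalized_duffing_orbitD(3)[OF orbit])

lemma deriv_anti: "deriv x (t + \<tau>) = - deriv x t"
proof (rule DERIV_unique)
  show "((\<lambda>s. x (s + \<tau>)) has_real_derivative deriv x (t + \<tau>)) (at t)"
    using dx(1)[of "t + \<tau>"] by (simp add: DERIV_shift)
  show "((\<lambda>s. x (s + \<tau>)) has_real_derivative - deriv x t) (at t)"
    unfolding anti using dx(1) by (rule DERIV_minus)
qed

lemma square_periodic: "(x (t + \<tau>))\<^sup>2 = (x t)\<^sup>2" "(x (t + 2 * \<tau>))\<^sup>2 = (x t)\<^sup>2"
proof -
  show "(x (t + \<tau>))\<^sup>2 = (x t)\<^sup>2" by (simp add: anti)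
  have "t + 2 * \<tau> = t + \<tau> + \<tau>" by simp
  then show "(x (t + 2 * \<tau>))\<^sup>2 = (x t)\<^sup>2" by (simp only: anti) simp
qed

lemma shift_iterate:
  fixes f :: "real \<Rightarrow> complex"
  assumes "\<And>t. - T \<le> t \<Longrightarrow> f (t + \<tau>) = \<rho> * f t" and t: "- T \<le> t"
  shows "f (t + real k * \<tau>) = \<rho> ^ k * f t"
proof (induction k)
  case (Suc k)
  have "- T \<le> t + real k * \<tau>" using t \<tau>0 by (simp add: add_increasing2)
  from assms(1)[OF this] Suc show ?case by (simp add: algebra_simps)
qed simp

lemma x_delay: "x (t - T) = (-1) ^ n * x t" "deriv x (t - T) = (-1) ^ n * deriv x t"
proof -
  show "x (t - T) = (-1) ^ n * x t"
    using anti_iterate[of x \<tau> "t - T" n, OF anti] n\<tau> by (simp add: mult.assoc[symmetric] flip: power_add mult_2)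
  show "deriv x (t - T) = (-1) ^ n * deriv x t"
    using anti_iterate[of "deriv x" \<tau> "t - T" n, OF deriv_anti] n\<tau> by (simp add: mult.assoc[symmetric] flip: power_add mult_2)
qed

lemma delayed: "delayed_duffing_solution a b T x"
  unfolding delayed_duffing_solution_def using dx by (auto simp: x_delay \<alpha> algebra_simps)

lemma deriv2_at_0: "- (\<alpha> * x 0) - x 0 ^ 3 \<noteq> 0"
proof -
  have "0 < \<alpha> + (x 0)\<^sup>2 / 2" by (rule normalized_duffing_orbitD(1)[OF orbit])
  then have "0 < \<alpha> + (x 0)\<^sup>2" using zero_le_power2[of "x 0"] by linarith
  then have "0 < x 0 * (\<alpha> + (x 0)\<^sup>2)" using x0 by simp
  then show ?thesis by (simp add: algebra_simps power2_eq_square power3_eq_cube)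
qed

sublocale S: scaled_orbit "\<tau>\<^sup>2 * \<alpha>" "\<tau> * x 0" "\<lambda>s. \<tau> * x (\<tau> * s)" "\<lambda>s. \<tau>\<^sup>2 * deriv x (\<tau> * s)"
proof
  show "((\<lambda>s. \<tau> * x (\<tau> * s)) has_real_derivative \<tau>\<^sup>2 * deriv x (\<tau> * s)) (at s)" for s
    by (rule derivative_eq_intros DERIV_chain2[OF dx(1)] refl)+ (simp add: power2_eq_square)
  show "((\<lambda>s. \<tau>\<^sup>2 * deriv x (\<tau> * s)) has_real_derivative
      - (\<tau>\<^sup>2 * \<alpha> * (\<tau> * x (\<tau> * s))) - (\<tau> * x (\<tau> * s)) ^ 3) (at s)" for s
    by (rule derivative_eq_intros DERIV_chain2[OF dx(2)] refl)+
       (simp add: algebra_simps power2_eq_square power3_eq_cube)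
  show "\<tau> * x (\<tau> * (s + 1)) = - (\<tau> * x (\<tau> * s))" for s
    using anti[of "\<tau> * s"] by (simp add: algebra_simps)
  show "\<tau> * x (\<tau> * 0) = \<tau> * x 0" "\<tau>\<^sup>2 * deriv x (\<tau> * 0) = 0" "0 < \<tau> * x 0"
    using x0 \<tau>0 by simp_all
  have pos: "0 < \<alpha> + (x 0)\<^sup>2 / 2" and K: "half_period \<alpha> (x 0) = \<tau>"
    by (rule normalized_duffing_orbitD(1,2)[OF orbit])+
  have pos': "0 < \<alpha> + (x 0)\<^sup>2" using pos zero_le_power2[of "x 0"] by linarith
  have "pi \<le> \<tau> * sqrt (\<alpha> + (x 0)\<^sup>2)"
    using half_period_bounds(1)[OF pos] pos' unfolding K by (simp add: pos_divide_le_eq)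
  then have "pi\<^sup>2 \<le> (\<tau> * sqrt (\<alpha> + (x 0)\<^sup>2))\<^sup>2" by (intro power_mono) auto
  also have "\<dots> = \<tau>\<^sup>2 * (\<alpha> + (x 0)\<^sup>2)" using pos' by (simp add: power_mult_distrib)
  finally show "pi\<^sup>2 \<le> \<tau>\<^sup>2 * \<alpha> + (\<tau> * x 0)\<^sup>2" by (simp add: algebra_simps)
  have "\<tau> * sqrt (\<alpha> + (x 0)\<^sup>2 / 2) \<le> pi"
    using half_period_bounds(2)[OF pos] pos unfolding K by (simp add: pos_le_divide_eq)
  then have "(\<tau> * sqrt (\<alpha> + (x 0)\<^sup>2 / 2))\<^sup>2 \<le> pi\<^sup>2"
    using \<tau>0 pos by (intro power_mono) auto
  moreover have "(\<tau> * sqrt (\<alpha> + (x 0)\<^sup>2 / 2))\<^sup>2 = \<tau>\<^sup>2 * (\<alpha> + (x 0)\<^sup>2 / 2)"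
    using pos by (simp add: power_mult_distrib)
  ultimately show "\<tau>\<^sup>2 * \<alpha> + (\<tau> * x 0)\<^sup>2 / 2 \<le> pi\<^sup>2" by (simp add: algebra_simps)
  have "1 \<le> 5 * exp (79::real)" using one_le_exp_iff[of "79::real"] by linarith
  then have "\<bar>\<tau>\<^sup>2 * \<alpha>\<bar> * 1 \<le> \<bar>\<tau>\<^sup>2 * \<alpha>\<bar> * (5 * exp 79)" by (intro mult_left_mono) auto
  then show "\<bar>\<tau>\<^sup>2 * \<alpha>\<bar> \<le> 1" using small by (simp add: mult.assoc)
qed

sublocale C: bounded_coefficient a b T "25 / \<tau>\<^sup>2" x
proof
  show "0 < T" by (rule T0)
  show "continuous_on UNIV x" using dx(1) DERIV_isCont by (blast intro: continuous_at_imp_continuous_on)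
  show "(x t)\<^sup>2 \<le> 25 / \<tau>\<^sup>2" for t
    using S.u_square_bound[of "t / \<tau>"] \<tau>0 by (simp add: power_mult_distrib field_simps)
qed

definition "\<beta> = (-1) ^ n * b * T\<^sup>2"

definition detuning :: "complex \<Rightarrow> complex" where
  "detuning \<sigma> = of_real (\<beta> / (real n)\<^sup>2) * (inverse (\<sigma> ^ n) - 1)"

text \<open>The sign \<open>(-1) ^ n\<close> in \<open>\<beta>\<close> cancels the one in
  \<open>(- \<rho>) ^ n\<close>. What remains is the change of the delay coefficient
  \<open>b * inverse (\<rho> ^ n)\<close> from its value at \<rho> = -1, the value already contained
  in \<alpha>.\<close>

lemma detuning_eq:
  assumes "\<rho> \<noteq> 0"
  shows "detuning (- \<rho>) = of_real (\<tau>\<^sup>2 * b) * inverse (\<rho> ^ n) - of_real (\<tau>\<^sup>2 * ((-1) ^ n * b))"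
proof -
  have "\<beta> / (real n)\<^sup>2 = \<tau>\<^sup>2 * ((-1) ^ n * b)" by (simp add: \<beta>_def \<tau> power_divide)
  moreover have "inverse ((- \<rho>) ^ n) = (-1) ^ n * inverse (\<rho> ^ n)"
    unfolding power_minus[of \<rho>] inverse_mult_distrib by (simp add: power_inverse[symmetric])
  moreover have "(-1) ^ n * (-1) ^ n = (1::complex)" by (simp flip: power_add mult_2)
  then have "of_real (\<tau>\<^sup>2 * ((-1) ^ n * b)) * ((-1) ^ n * inverse (\<rho> ^ n)) = of_real (\<tau>\<^sup>2 * b) * inverse (\<rho> ^ n)"
    by (simp add: mult.assoc mult.left_commute[of "(-1) ^ n"])
  ultimately show ?thesis unfolding detuning_def by (simp add: right_diff_distrib)
qed

lemma hq_detuning: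
  assumes "\<rho> \<noteq> 0"
  shows "S.hq (detuning (- \<rho>)) s = of_real (\<tau>\<^sup>2) * (of_real a + of_real b * inverse (\<rho> ^ n) + of_real (3 * (x (\<tau> * s))\<^sup>2))"
  unfolding S.hq_def detuning_eq[OF assms]
  by (simp add: \<alpha> algebra_simps power_mult_distrib power2_eq_square)

text \<open>Nontriviality is asked on the history interval, since the history determines the
  solution.\<close>

definition floquet_solution :: "complex \<Rightarrow> (real \<Rightarrow> complex) \<Rightarrow> (real \<Rightarrow> complex) \<Rightarrow> bool" where
  "floquet_solution \<rho> w w1 \<longleftrightarrow> delay_solution a b T x w w1 \<and> \<rho> \<noteq> 0 \<and>
     (\<forall>t\<ge>-T. w (t + \<tau>) = \<rho> * w t \<and> w1 (t + \<tau>) = \<rho> * w1 t) \<and>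
     (\<exists>t\<in>{-T..0}. w t \<noteq> 0 \<or> w1 t \<noteq> 0)"

lemma floquet_delay:
  assumes w: "floquet_solution \<rho> w w1" and t: "0 \<le> t"
  shows "w (t - T) = inverse (\<rho> ^ n) * w t" "w1 (t - T) = inverse (\<rho> ^ n) * w1 t"
  using shift_iterate[of w \<rho> "t - T" n] shift_iterate[of w1 \<rho> "t - T" n] w t n\<tau>
  unfolding floquet_solution_def by (auto simp: field_simps)

lemma scaled_hill:
  assumes r: "\<rho> \<noteq> 0"
    and w: "\<And>t. 0 \<le> t \<Longrightarrow> (w has_vector_derivative w1 t) (at t within {0..})"
      "\<And>t. 0 \<le> t \<Longrightarrow> (w1 has_vector_derivative
        - ((of_real a + of_real b * inverse (\<rho> ^ n) + of_real (3 * (x t)\<^sup>2)) * w t)) (at t within {0..})"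
  shows "hill_solution (S.hq (detuning (- \<rho>))) (\<lambda>s. w (\<tau> * s)) (\<lambda>s. of_real \<tau> * w1 (\<tau> * s))"
  unfolding hill_solution_def
proof (intro allI impI conjI)
  fix s :: real assume "0 \<le> s"
  then have s: "0 \<le> \<tau> * s + 0" using \<tau>0 by simp
  have S: "0 \<le> \<tau> * s' + 0" if "s' \<in> {0..}" for s' using \<tau>0 that by simp
  show "((\<lambda>s. w (\<tau> * s)) has_vector_derivative of_real \<tau> * w1 (\<tau> * s)) (at s within {0..})"
    using has_vector_derivative_affine[OF w(1)[OF s], of "{0..}"] S by (simp add: scaleR_conv_of_real)
  have "((\<lambda>s. of_real \<tau> * w1 (\<tau> * s)) has_vector_derivative of_real \<tau> *
     (\<tau> *\<^sub>R - ((of_real a + of_real b * inverse (\<rho> ^ n) + of_real (3 * (x (\<tau> * s + 0))\<^sup>2)) * w (\<tau> * s + 0)))) (at s within {0..})"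
    using has_vector_derivative_affine[OF w(2)[OF s], of "{0..}"] S by (intro derivative_intros) simp
  then show "((\<lambda>s. of_real \<tau> * w1 (\<tau> * s)) has_vector_derivative
      - (S.hq (detuning (- \<rho>)) s * w (\<tau> * s))) (at s within {0..})"
    unfolding hq_detuning[OF r] by (simp add: scaleR_conv_of_real power2_eq_square mult.assoc)
qed

lemma delay_solutionD:
  assumes "delay_solution a b T x w w1" "0 \<le> t"
  shows "(w has_vector_derivative w1 t) (at t within {0..})"
    "(w1 has_vector_derivative - (a *\<^sub>R w t) - b *\<^sub>R w (t - T) - (3 * (x t)\<^sup>2) *\<^sub>R w t) (at t within {0..})"
  using assms unfolding delay_solution_def by blast+

text \<open>After the delay has been replaced by \<open>inverse (\<rho> ^ n)\<close>, the number
  \<rho> is an eigenvalue of the monodromy matrix of Hill's equation, whose determinant is 1 by the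
  Wronskian. The initial data \<open>c\<close> and \<open>d\<close> form the eigenvector.\<close>

lemma floquet_quadratic:
  assumes w: "floquet_solution \<rho> w w1" and \<delta>: "cmod (detuning (- \<rho>)) \<le> 1"
    and \<phi>: "hill_solution (S.hq (detuning (- \<rho>))) \<phi> \<phi>1" "\<phi> 0 = 1" "\<phi>1 0 = 0"
    and \<psi>: "hill_solution (S.hq (detuning (- \<rho>))) \<psi> \<psi>1" "\<psi> 0 = 0" "\<psi>1 0 = 1"
  shows "\<rho>\<^sup>2 - (\<phi> 1 + \<psi>1 1) * \<rho> + 1 = 0"
proof -
  let ?q = "S.hq (detuning (- \<rho>))"
  have r: "\<rho> \<noteq> 0" and dw: "delay_solution a b T x w w1" using w by (auto simp: floquet_solution_def)
  define Y where "Y s = w (\<tau> * s)" for s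
  define Y1 where "Y1 s = of_real \<tau> * w1 (\<tau> * s)" for s
  have Y: "hill_solution ?q Y Y1"
    unfolding Y_def[abs_def] Y1_def[abs_def]
  proof (rule scaled_hill[OF r delay_solutionD(1)[OF dw]])
    fix t :: real assume t: "0 \<le> t"
    from delay_solutionD(2)[OF dw t]
    show "(w1 has_vector_derivative - ((of_real a + of_real b * inverse (\<rho> ^ n) + of_real (3 * (x t)\<^sup>2)) * w t)) (at t within {0..})"
      unfolding floquet_delay(1)[OF w t] by (simp add: scaleR_conv_of_real algebra_simps)
  qed
  define c d where "c = Y 0" and "d = Y1 0"
  have eq: "Y s = c * \<phi> s + d * \<psi> s \<and> Y1 s = c * \<phi>1 s + d * \<psi>1 s" if "0 \<le> s" for s
    by (rule hill_solution_unique[OF Y hill_solution_lincomb[OF \<phi>(1) \<psi>(1)] _ _ S.hq_bound[OF \<delta>] that])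
       (simp_all add: c_def d_def \<phi> \<psi>)
  \<comment> \<open>Zero data at time 0 make \<open>w\<close> vanish from then on, and the relation
    over n half periods carries this back to the history interval.\<close>
  have "c \<noteq> 0 \<or> d \<noteq> 0"
  proof (rule ccontr)
    assume "\<not> ?thesis"
    then have 0: "Y s = 0" "Y1 s = 0" if "0 \<le> s" for s using eq[OF that] by auto
    obtain t where t: "t \<in> {-T..0}" "w t \<noteq> 0 \<or> w1 t \<noteq> 0" using w by (auto simp: floquet_solution_def)
    have "w (t + T) = 0" "w1 (t + T) = 0"
      using 0[of "(t + T) / \<tau>"] t \<tau>0 by (auto simp: Y_def Y1_def)
    then show False using floquet_delay[OF w, of "t + T"] t by auto
  qed
  moreover have "Y 1 = \<rho> * c" "Y1 1 = \<rho> * d"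
    using w T0 by (auto simp: floquet_solution_def Y_def Y1_def c_def d_def dest: spec[of _ 0])
  then have e: "c * \<phi> 1 + d * \<psi> 1 = \<rho> * c" "c * \<phi>1 1 + d * \<psi>1 1 = \<rho> * d"
    using eq[of 1] by auto
  have "((\<phi> 1 - \<rho>) * (\<psi>1 1 - \<rho>) - \<psi> 1 * \<phi>1 1) * c = 0" "((\<phi> 1 - \<rho>) * (\<psi>1 1 - \<rho>) - \<psi> 1 * \<phi>1 1) * d = 0"
    using e by algebra+
  ultimately have "(\<phi> 1 - \<rho>) * (\<psi>1 1 - \<rho>) - \<psi> 1 * \<phi>1 1 = 0" by auto
  moreover have "\<phi> 1 * \<psi>1 1 - \<psi> 1 * \<phi>1 1 = 1"
    using hill_wronskian[OF \<phi>(1) \<psi>(1), of 1] by (simp add: \<phi> \<psi>)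
  ultimately show ?thesis by algebra
qed

lemma delay_solution_agree:
  assumes "delay_solution a b T x y y1" "delay_solution a b T x z z1"
    "\<And>t. t \<in> {-T..0} \<Longrightarrow> y t = z t \<and> y1 t = z1 t" "-T \<le> t"
  shows "y t = z t" "y1 t = z1 t"
  using C.delay_solution_unique[OF assms] by auto

text \<open>The shift S by \<tau> squares to the monodromy. For an eigenvector y with eigenvalue
  \<open>\<rho>\<^sup>2\<close>, either \<open>z = S y - \<rho> y\<close> is nonzero and belongs to
  \<open>- \<rho>\<close>, or y itself belongs to \<rho>.\<close>

lemma multiplier_floquet:
  assumes "\<mu> \<in> floquet_multipliers a b T x (2 * \<tau>)"
  obtains \<rho> w w1 where "\<rho>\<^sup>2 = \<mu>" "floquet_solution \<rho> w w1"
proof -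
  obtain \<phi> where \<mu>: "\<mu> \<noteq> 0" and \<phi>: "\<phi> \<in> phase_space T" "\<phi> \<noteq> 0"
    and eig: "complexify (monodromy a b T x (2 * \<tau>)) \<phi> = cscale \<mu> \<phi>"
    using assms by (auto simp: floquet_multipliers_def)
  obtain y y1 where y: "delay_solution a b T x y y1" and hist: "\<And>t. t \<in> {-T..0} \<Longrightarrow> \<phi> t = (y t, y1 t)"
    using C.delay_solution_exists[OF \<phi>(1)] by blast
  have "segment T (\<lambda>t. (y t, y1 t)) (2 * \<tau>) = cscale \<mu> \<phi>"
    using C.complexify_monodromy[OF \<phi>(1) y hist, of "2 * \<tau>"] eig \<tau>0 by simp
  from fun_cong[OF this]
  \<comment> \<open>The summands with coefficient 0 give the right-hand sides the form of
    \<open>delay_solution_lincomb\<close>.\<close>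
  have "y (t + 2 * \<tau>) = \<mu> * y t + 0 * y t \<and> y1 (t + 2 * \<tau>) = \<mu> * y1 t + 0 * y1 t" if "t \<in> {-T..0}" for t
    using hist[OF that] that by (auto simp: segment_def cscale_def algebra_simps dest!: meta_spec[of _ t])
  note * = delay_solution_agree[OF delay_solution_shift[OF y _ square_periodic(2)] delay_solution_lincomb[OF y y] this]
  have y2: "y (t + 2 * \<tau>) = \<mu> * y t" "y1 (t + 2 * \<tau>) = \<mu> * y1 t" if "-T \<le> t" for t
    using *[of t] that \<tau>0 by auto
  define \<rho> where "\<rho> = csqrt \<mu>"
  have \<rho>: "\<rho>\<^sup>2 = \<mu>" "\<rho> \<noteq> 0" using \<mu> by (auto simp: \<rho>_def)
  define z where "z t = 1 * y (t + \<tau>) + (- \<rho>) * y t" for t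
  define z1 where "z1 t = 1 * y1 (t + \<tau>) + (- \<rho>) * y1 t" for t
  have z: "delay_solution a b T x z z1"
    unfolding z_def[abs_def] z1_def[abs_def]
    by (intro delay_solution_lincomb delay_solution_shift y square_periodic) (use \<tau>0 in simp)
  have zs: "z (t + \<tau>) = (- \<rho>) * z t" "z1 (t + \<tau>) = (- \<rho>) * z1 t" if "-T \<le> t" for t
    using y2[OF that] \<rho>(1) by (auto simp: z_def z1_def algebra_simps power2_eq_square)
  show ?thesis
  proof (cases "\<exists>t\<in>{-T..0}. z t \<noteq> 0 \<or> z1 t \<noteq> 0")
    case True
    then have "floquet_solution (- \<rho>) z z1" using z zs \<rho> by (auto simp: floquet_solution_def)
    then show ?thesis using that[of "- \<rho>"] \<rho> by simp
  next
    case False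
    then have "y (t + \<tau>) = \<rho> * y t + 0 * y t \<and> y1 (t + \<tau>) = \<rho> * y1 t + 0 * y1 t" if "t \<in> {-T..0}" for t
      using that by (auto simp: z_def z1_def)
    note * = delay_solution_agree[OF delay_solution_shift[OF y _ square_periodic(1)] delay_solution_lincomb[OF y y] this]
    have "\<exists>t\<in>{-T..0}. y t \<noteq> 0 \<or> y1 t \<noteq> 0"
    proof (rule ccontr)
      assume "\<not> ?thesis"
      then have "\<phi> t = 0" for t
        using hist[of t] \<phi>(1) unfolding phase_space_def by (cases "t \<in> {-T..0}") (auto simp: zero_prod_def)
      then show False using \<phi>(2) by (auto simp: fun_eq_iff)
    qed
    then have "floquet_solution \<rho> y y1" using y * \<rho> \<tau>0 by (auto simp: floquet_solution_def)
    then show ?thesis using that \<rho> by simp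
  qed
qed

lemma velocity_solution:
  "delay_solution a b T x (\<lambda>t. of_real (deriv x t)) (\<lambda>t. of_real (- (\<alpha> * x t) - x t ^ 3))"
  unfolding delay_solution_def
proof (intro conjI allI impI)
  have c: "continuous_on S x" "continuous_on S (deriv x)" for S
    using dx DERIV_isCont by (blast intro: continuous_at_imp_continuous_on)+
  show "continuous_on {-T..} (\<lambda>t. complex_of_real (deriv x t))"
    "continuous_on {-T..} (\<lambda>t. complex_of_real (- (\<alpha> * x t) - x t ^ 3))"
    by (intro continuous_intros c)+
  fix t :: real
  show "((\<lambda>t. complex_of_real (deriv x t)) has_vector_derivative of_real (- (\<alpha> * x t) - x t ^ 3)) (at t within {0..})"
    by (rule has_vector_derivative_of_real[OF has_field_derivative_at_within[OF dx(2)]])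
  have "((\<lambda>t. - (\<alpha> * x t) - x t ^ 3) has_real_derivative - (a * deriv x t) - b * deriv x (t - T) - 3 * (x t)\<^sup>2 * deriv x t) (at t)"
    by (rule derivative_eq_intros dx(1) refl)+ (simp add: x_delay \<alpha> algebra_simps)
  from has_vector_derivative_of_real[OF has_field_derivative_at_within[OF this]]
  show "((\<lambda>t. complex_of_real (- (\<alpha> * x t) - x t ^ 3)) has_vector_derivative
       - (a *\<^sub>R complex_of_real (deriv x t)) - b *\<^sub>R complex_of_real (deriv x (t - T)) - (3 * (x t)\<^sup>2) *\<^sub>R complex_of_real (deriv x t))
     (at t within {0..})"
    by (simp add: scaleR_conv_of_real)
qed

text \<open>Converse direction: an eigenvector of the monodromy matrix at
  \<open>\<rho> = - \<sigma>\<close> yields a Hill solution multiplied by \<rho> over each unit of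
  time, and this property reproduces the delay term that had been eliminated.\<close>

lemma unstable_if_root:
  assumes \<sigma>: "1 < \<sigma>" and \<delta>: "cmod (detuning (of_real \<sigma>)) \<le> 1"
    and \<phi>: "hill_solution (S.hq (detuning (of_real \<sigma>))) \<phi> \<phi>1" "\<phi> 0 = 1" "\<phi>1 0 = 0"
    and \<psi>: "hill_solution (S.hq (detuning (of_real \<sigma>))) \<psi> \<psi>1" "\<psi> 0 = 0" "\<psi>1 0 = 1"
    and tr: "\<phi> 1 + \<psi>1 1 = - of_real (\<sigma> + 1 / \<sigma>)"
  shows "linearly_unstable a b T x (2 * \<tau>)"
proof -
  define \<rho> where "\<rho> = - complex_of_real \<sigma>"
  have r: "\<rho> \<noteq> 0" and \<sigma>\<rho>: "complex_of_real \<sigma> = - \<rho>" using \<sigma> by (auto simp: \<rho>_def)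
  let ?q = "S.hq (detuning (of_real \<sigma>))"
  have W: "\<phi> 1 * \<psi>1 1 - \<psi> 1 * \<phi>1 1 = 1"
    using hill_wronskian[OF \<phi>(1) \<psi>(1), of 1] by (simp add: \<phi> \<psi>)
  have "\<rho> * (\<phi> 1 + \<psi>1 1) = \<rho>\<^sup>2 + 1"
    unfolding tr \<rho>_def using \<sigma> by (simp add: field_simps power2_eq_square)
  then have det: "(\<phi> 1 - \<rho>) * (\<psi>1 1 - \<rho>) = \<psi> 1 * \<phi>1 1" using W by algebra
  \<comment> \<open>An eigenvector of a 2 by 2 matrix is read off from a nonzero row of the matrix
    minus \<rho>; if both rows vanish, any vector serves.\<close>
  obtain c d where cd: "c \<noteq> 0 \<or> d \<noteq> 0" "c * \<phi> 1 + d * \<psi> 1 = \<rho> * c" "c * \<phi>1 1 + d * \<psi>1 1 = \<rho> * d"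
  proof (cases "\<psi> 1 = 0 \<and> \<phi> 1 = \<rho>")
    case False
    show ?thesis
      by (rule that[of "- \<psi> 1" "\<phi> 1 - \<rho>"]) (use False det in \<open>auto simp: algebra_simps\<close>)
  next
    case True
    show ?thesis
    proof (cases "\<psi>1 1 = \<rho> \<and> \<phi>1 1 = 0")
      case False
      then show ?thesis
        by (intro that[of "\<psi>1 1 - \<rho>" "- \<phi>1 1"]) (use True in \<open>auto simp: algebra_simps\<close>)
    next
      case True': True
      then show ?thesis by (intro that[of 1 0]) (use True in auto)
    qed
  qed
  define Y where "Y s = c * \<phi> s + d * \<psi> s" for s
  define Y1 where "Y1 s = c * \<phi>1 s + d * \<psi>1 s" for s
  have Y: "hill_solution ?q Y Y1" unfolding Y_def[abs_def] Y1_def[abs_def]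
    by (rule hill_solution_lincomb[OF \<phi>(1) \<psi>(1)])
  have YS: "hill_solution ?q (\<lambda>s. Y (s + 1)) (\<lambda>s. Y1 (s + 1))"
    unfolding hill_solution_def
  proof (intro allI impI)
    fix s :: real assume s: "0 \<le> s"
    have "S.hq (detuning (of_real \<sigma>)) (1 * s + 1) = ?q s" using S.hq_periodic[of _ s] by simp
    then show "((\<lambda>s. Y (s + 1)) has_vector_derivative Y1 (s + 1)) (at s within {0..}) \<and>
       ((\<lambda>s. Y1 (s + 1)) has_vector_derivative - (?q s * Y (s + 1))) (at s within {0..})"
      using has_vector_derivative_affine[OF hill_solutionD(1)[OF Y, of "1 * s + 1" "{0..}"], of "{0..}"]
        has_vector_derivative_affine[OF hill_solutionD(2)[OF Y, of "1 * s + 1" "{0..}"], of "{0..}"] s by simp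
  qed
  have per: "Y (s + 1) = \<rho> * Y s + 0 * Y s \<and> Y1 (s + 1) = \<rho> * Y1 s + 0 * Y1 s" if "0 \<le> s" for s
    by (rule hill_solution_unique[OF YS hill_solution_lincomb[OF Y Y] _ _ S.hq_bound[OF \<delta>] that])
       (use cd in \<open>simp_all add: Y_def Y1_def \<phi> \<psi> algebra_simps\<close>)
  have iter: "Y (s + real k) = \<rho> ^ k * Y s" if "0 \<le> s" for s k
  proof (induction k)
    case (Suc k)
    then show ?case using per[of "s + real k"] that by (simp add: algebra_simps)
  qed simp
  \<comment> \<open>Hill solutions live on nonnegative times, so \<open>Y\<close> is started at time
    \<open>-T\<close>. The offset is \<open>n\<close> half periods and does not change the
    potential.\<close>
  define w where "w t = Y ((t + T) / \<tau>)" for t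
  define w1 where "w1 t = Y1 ((t + T) / \<tau>) / of_real \<tau>" for t
  have aff: "(t + T) / \<tau> = 1 / \<tau> * t + real n" for t
    using n\<tau> \<tau>0 by (simp add: field_simps)
  have shq: "?q (1 / \<tau> * t + real n) = ?q (t / \<tau>)" for t
  proof -
    have "?q (s + real k) = ?q s" for s k
    proof (induction k)
      case (Suc k)
      then show ?case using S.hq_periodic[of "detuning (of_real \<sigma>)" "s + real k"] by (simp add: algebra_simps)
    qed simp
    then show ?thesis by simp
  qed
  have dsol: "delay_solution a b T x w w1"
    unfolding delay_solution_def
  proof (intro conjI allI impI)
    have c: "continuous_on {0..} Y" "continuous_on {0..} Y1"
      unfolding continuous_on_eq_continuous_within
      using Y has_vector_derivative_continuous unfolding hill_solution_def by blast+
    have i: "continuous_on {-T..} (\<lambda>t. (t + T) / \<tau>)" "(\<lambda>t. (t + T) / \<tau>) ` {-T..} \<subseteq> {0..}"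
      using \<tau>0 by (auto intro!: continuous_intros)
    show "continuous_on {-T..} w" "continuous_on {-T..} w1"
      unfolding w_def[abs_def] w1_def[abs_def] using \<tau>0
      by (auto intro!: continuous_on_divide continuous_on_const
            continuous_on_compose2[OF c(1) i] continuous_on_compose2[OF c(2) i])
    fix t :: real assume t: "0 \<le> t"
    have s: "0 \<le> 1 / \<tau> * t + real n" using t \<tau>0 by simp
    have S: "1 / \<tau> * s' + real n \<in> {0..}" if "s' \<in> {0..}" for s' using that \<tau>0 by simp
    show "(w has_vector_derivative w1 t) (at t within {0..})"
      unfolding w_def[abs_def] w1_def aff
      using has_vector_derivative_affine[OF hill_solutionD(1)[OF Y s order_refl] S, of "{0..}"]
      by (simp add: scaleR_conv_of_real divide_inverse mult.commute)
    have w': "w (t - T) = inverse (\<rho> ^ n) * w t"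
    proof -
      have "w t = \<rho> ^ n * Y (t / \<tau>)" using iter[of "t / \<tau>" n] t \<tau>0 by (simp add: w_def aff)
      then show ?thesis using r by (simp add: w_def)
    qed
    have "(w1 has_vector_derivative (1 / \<tau>) *\<^sub>R (- (?q (1 / \<tau> * t + real n) * Y (1 / \<tau> * t + real n))) / of_real \<tau>) (at t within {0..})"
      unfolding w1_def[abs_def] aff
      by (intro derivative_intros has_vector_derivative_affine[OF hill_solutionD(2)[OF Y s order_refl] S])
    also have "Y (1 / \<tau> * t + real n) = w t" by (simp add: w_def aff)
    also have "(1 / \<tau>) *\<^sub>R (- (?q (1 / \<tau> * t + real n) * w t)) / of_real \<tau>
        = - (a *\<^sub>R w t) - b *\<^sub>R w (t - T) - (3 * (x t)\<^sup>2) *\<^sub>R w t"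
      unfolding shq unfolding \<sigma>\<rho> hq_detuning[OF r] w' using \<tau>0
      by (simp add: scaleR_conv_of_real field_simps power2_eq_square)
    finally show "(w1 has_vector_derivative - (a *\<^sub>R w t) - b *\<^sub>R w (t - T) - (3 * (x t)\<^sup>2) *\<^sub>R w t) (at t within {0..})" .
  qed
  have shift: "w (t + \<tau>) = \<rho> * w t" "w1 (t + \<tau>) = \<rho> * w1 t" if "-T \<le> t" for t
  proof -
    have "(t + \<tau> + T) / \<tau> = (t + T) / \<tau> + 1" "0 \<le> (t + T) / \<tau>" using \<tau>0 that by (simp_all add: field_simps)
    then show "w (t + \<tau>) = \<rho> * w t" "w1 (t + \<tau>) = \<rho> * w1 t"
      using per[of "(t + T) / \<tau>"] by (simp_all add: w_def w1_def)
  qed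
  define \<phi>0 where "\<phi>0 = segment T (\<lambda>t. (w t, w1 t)) 0"
  have ps: "\<phi>0 \<in> phase_space T" unfolding \<phi>0_def by (rule C.segment_phase_space[OF dsol]) simp
  have "complexify (monodromy a b T x (2 * \<tau>)) \<phi>0 = segment T (\<lambda>t. (w t, w1 t)) (2 * \<tau>)"
    by (rule C.complexify_monodromy[OF ps dsol]) (use \<tau>0 in \<open>auto simp: \<phi>0_def segment_def\<close>)
  also have "\<dots> = cscale (\<rho>\<^sup>2) \<phi>0"
  proof
    fix t
    have "w (2 * \<tau> + t) = \<rho>\<^sup>2 * w t" "w1 (2 * \<tau> + t) = \<rho>\<^sup>2 * w1 t" if "t \<in> {-T..0}"
      using shift[of t] shift[of "t + \<tau>"] that \<tau>0 by (simp_all add: algebra_simps power2_eq_square)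
    then show "segment T (\<lambda>t. (w t, w1 t)) (2 * \<tau>) t = cscale (\<rho>\<^sup>2) \<phi>0 t"
      by (auto simp: segment_def cscale_def \<phi>0_def zero_prod_def)
  qed
  finally have eig: "complexify (monodromy a b T x (2 * \<tau>)) \<phi>0 = cscale (\<rho>\<^sup>2) \<phi>0" .
  have "\<phi>0 (-T) = (c, d / of_real \<tau>)"
    using T0 by (simp add: \<phi>0_def segment_def w_def w1_def Y_def Y1_def \<phi> \<psi>)
  then have "\<phi>0 \<noteq> 0" using cd(1) \<tau>0 by (auto simp: zero_prod_def)
  then have "\<rho>\<^sup>2 \<in> floquet_multipliers a b T x (2 * \<tau>)"
    using ps eig r unfolding floquet_multipliers_def by auto
  moreover have "1 < cmod (\<rho>\<^sup>2)" using \<sigma> by (simp add: \<rho>_def norm_power one_less_power)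
  ultimately show ?thesis unfolding linearly_unstable_def by blast
qed

section \<open>The trivial multiplier and its multiplicity\<close>

definition "velocity = segment T (\<lambda>t. (complex_of_real (deriv x t), complex_of_real (- (\<alpha> * x t) - x t ^ 3))) 0"

lemma velocity_phase_space: "velocity \<in> phase_space T"
  unfolding velocity_def by (rule C.segment_phase_space[OF velocity_solution]) simp

lemma velocity_nonzero: "velocity \<noteq> 0"
proof -
  have "snd (velocity 0) \<noteq> 0"
    using deriv2_at_0 T0 by (simp add: velocity_def segment_def del: of_real_diff of_real_minus)
  then show ?thesis by (auto simp: zero_prod_def)
qed

text \<open>A Jordan chain \<open>y (t + \<tau>) = - y t + \<gamma> x' t\<close> makes \<open>y (t - T)\<close> pick up the term \<open>n \<gamma> x' t\<close>, and
  the equation is then not solvable, because its right-hand side is not orthogonal to \<open>x'\<close>.\<close>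

lemma no_jordan_chain:
  assumes y: "delay_solution a b T x y y1"
    and rep: "\<And>t. -T \<le> t \<Longrightarrow> y (t + \<tau>) = - y t + \<gamma> * of_real (deriv x t)"
  shows "\<gamma> = 0"
proof (rule ccontr)
  assume "\<gamma> \<noteq> 0"
  have iter: "y (t + real k * \<tau>) = (-1) ^ k * (y t - of_nat k * \<gamma> * of_real (deriv x t))" if t: "-T \<le> t" for t k
  proof (induction k)
    case (Suc k)
    have "-T \<le> t + real k * \<tau>" using t \<tau>0 by (simp add: add_increasing2)
    note r = rep[OF this]
    have e: "t + real (Suc k) * \<tau> = t + real k * \<tau> + \<tau>" by (simp add: algebra_simps)
    show ?case unfolding e r Suc.IH anti_iterate[of "deriv x" \<tau> t k, OF deriv_anti] by (simp add: algebra_simps)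
  qed simp
  have sg: "(-1) ^ n * (-1) ^ n = (1::complex)" by (simp flip: power_add mult_2)
  have del: "y (t - T) = (-1) ^ n * (y t + of_nat n * \<gamma> * of_real (deriv x t))" if t: "0 \<le> t" for t
  proof -
    have "y t = (-1) ^ n * (y (t - T) - of_nat n * \<gamma> * of_real (deriv x (t - T)))"
      using iter[of "t - T" n] t n\<tau> by simp
    then have "(-1) ^ n * y t = y (t - T) - of_nat n * \<gamma> * of_real (deriv x (t - T))"
      using sg by (metis mult.assoc mult_1)
    then show ?thesis by (simp add: x_delay algebra_simps)
  qed
  define \<kappa> where "\<kappa> = - (complex_of_real ((-1) ^ n * b * real n) * \<gamma>)"
  have \<kappa>: "\<kappa> \<noteq> 0" using b n \<open>\<gamma> \<noteq> 0\<close> by (simp add: \<kappa>_def)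
  have dy1: "(y1 has_vector_derivative
      - (of_real (\<alpha> + 3 * (x t)\<^sup>2) * y t) + \<kappa> * of_real (deriv x t)) (at t within {0..})" if t: "0 \<le> t" for t
    using delay_solutionD(2)[OF y t] unfolding del[OF t]
    by (simp add: scaleR_conv_of_real \<alpha> \<kappa>_def algebra_simps)
  \<comment> \<open>The Wronskian of \<open>y\<close> with the velocity, divided by
    \<open>\<kappa>\<close>: the forcing then contributes exactly
    \<open>(deriv x t)\<^sup>2\<close>, which is nonnegative, so \<open>g\<close> is
    monotone.\<close>
  define g where "g t = Re ((y1 t * of_real (deriv x t) - y t * of_real (- (\<alpha> * x t) - x t ^ 3)) / \<kappa>)" for t
  have dg: "(g has_real_derivative (deriv x t)\<^sup>2) (at t within {0..})" if t: "0 \<le> t" for t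
  proof -
    have d2: "((\<lambda>t. - (\<alpha> * x t) - x t ^ 3) has_real_derivative - ((\<alpha> + 3 * (x t)\<^sup>2) * deriv x t)) (at t)"
      by (rule derivative_eq_intros dx(1) refl)+ (simp add: algebra_simps)
    have "((\<lambda>t. (y1 t * of_real (deriv x t) - y t * of_real (- (\<alpha> * x t) - x t ^ 3)) / \<kappa>) has_vector_derivative
       ((y1 t * of_real (- (\<alpha> * x t) - x t ^ 3) + (- (of_real (\<alpha> + 3 * (x t)\<^sup>2) * y t) + \<kappa> * of_real (deriv x t)) * of_real (deriv x t))
        - (y t * of_real (- ((\<alpha> + 3 * (x t)\<^sup>2) * deriv x t)) + y1 t * of_real (- (\<alpha> * x t) - x t ^ 3))) / \<kappa>) (at t within {0..})"
      by (intro derivative_intros dy1 t delay_solutionD(1)[OF y t]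
          has_vector_derivative_of_real[OF has_field_derivative_at_within[OF dx(2)]]
          has_vector_derivative_of_real[OF has_field_derivative_at_within[OF d2]])
    also have "((y1 t * of_real (- (\<alpha> * x t) - x t ^ 3) + (- (of_real (\<alpha> + 3 * (x t)\<^sup>2) * y t) + \<kappa> * of_real (deriv x t)) * of_real (deriv x t))
        - (y t * of_real (- ((\<alpha> + 3 * (x t)\<^sup>2) * deriv x t)) + y1 t * of_real (- (\<alpha> * x t) - x t ^ 3))) / \<kappa>
      = of_real ((deriv x t)\<^sup>2)"
      using \<kappa> by (simp add: field_simps power2_eq_square)
    finally have "((\<lambda>t. (y1 t * of_real (deriv x t) - y t * of_real (- (\<alpha> * x t) - x t ^ 3)) / \<kappa>)
        has_vector_derivative of_real ((deriv x t)\<^sup>2)) (at t within {0..})" .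
    from bounded_linear.has_vector_derivative[OF bounded_linear_Re this]
    show ?thesis unfolding g_def[abs_def] has_real_derivative_iff_has_vector_derivative by simp
  qed
  have dg': "(g has_real_derivative (deriv x t)\<^sup>2) (at t)" if "0 < t" for t
    using dg[of t] that at_within_interior[of t "{0..}"] by simp
  have gc: "continuous_on {0..} g" using dg by (intro DERIV_continuous_on) auto
  have mono: "g s \<le> g t" if "0 \<le> s" "s \<le> t" for s t
  proof (rule DERIV_nonneg_imp_increasing_open[where f = g, OF that(2)])
    show "\<exists>y. (g has_real_derivative y) (at r) \<and> 0 \<le> y" if "s < r" "r < t" for r
      using dg'[of r] that \<open>0 \<le> s\<close> by (intro exI[of _ "(deriv x r)\<^sup>2"]) simp
    show "continuous_on {s..t} g" by (rule continuous_on_subset[OF gc]) (use that in auto)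
  qed
  have x\<tau>: "deriv x \<tau> = 0" "x \<tau> = - x 0" using deriv_anti[of 0] anti[of 0] x0 by auto
  have y\<tau>: "y \<tau> = - y 0" using rep[of 0] T0 x0 by simp
  have e: "complex_of_real (- (\<alpha> * x \<tau>) - x \<tau> ^ 3) = - complex_of_real (- (\<alpha> * x 0) - x 0 ^ 3)"
    by (simp add: x\<tau>)
  \<comment> \<open>The velocity vanishes at 0 and \<tau>, so only the product of \<open>y\<close>
    with the acceleration counts, and both factors change sign. Thus \<open>g\<close> is constant on
    the half period and \<open>x\<close> cannot move there.\<close>
  have "g \<tau> = g 0"
    by (simp only: g_def x\<tau>(1) x0(2) e y\<tau> minus_mult_minus of_real_0 mult_zero_right)
  then have const: "g t = g 0" if "0 \<le> t" "t \<le> \<tau>" for t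
    using mono[of 0 t] mono[of t \<tau>] that by simp
  have "deriv x t = 0" if t: "0 < t" "t < \<tau>" for t
  proof -
    have "((\<lambda>_. g 0) has_real_derivative (deriv x t)\<^sup>2) (at t)"
    proof (rule has_field_derivative_transform_within_open[where f = g and S = "{0<..<\<tau>}", OF dg'[OF t(1)]])
      show "g s = g 0" if "s \<in> {0<..<\<tau>}" for s using that by (intro const) auto
    qed (use t in auto)
    from DERIV_unique[OF this DERIV_const] show ?thesis by simp
  qed
  note const = this
  have "x \<tau> = x 0"
  proof (rule DERIV_isconst_end[where f = x, OF \<tau>0])
    show "continuous_on {0..\<tau>} x" using dx(1) DERIV_isCont by (blast intro: continuous_at_imp_continuous_on)
    show "(x has_real_derivative 0) (at t)" if "0 < t" "t < \<tau>" for t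
      using dx(1)[of t] const[OF that] by simp
  qed
  then show False using x\<tau> x0 by simp
qed

text \<open>Subtracting a multiple of the velocity achieves \<open>z1 0 = 0\<close>. The rest is,
  after rescaling, a multiple of \<open>\<phi>\<close> at detuning 0 whose derivative vanishes again
  at time 1, and \<open>monodromy_not_scalar\<close> leaves only zero.\<close>

lemma antiperiodic_solution:
  assumes y: "delay_solution a b T x y y1"
    and rep: "\<And>t. -T \<le> t \<Longrightarrow> y (t + \<tau>) = - y t \<and> y1 (t + \<tau>) = - y1 t"
  obtains k where "\<And>t. -T \<le> t \<Longrightarrow> y t = k * of_real (deriv x t) \<and> y1 t = k * of_real (- (\<alpha> * x t) - x t ^ 3)"
proof -
  let ?q = "S.hq (detuning (- (-1)))"
  define v0 where "v0 = complex_of_real (- (\<alpha> * x 0) - x 0 ^ 3)"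
  have v0: "v0 \<noteq> 0" unfolding v0_def of_real_eq_0_iff by (rule deriv2_at_0)
  define k where "k = y1 0 / v0"
  define z where "z t = 1 * y t + (- k) * of_real (deriv x t)" for t
  define z1 where "z1 t = 1 * y1 t + (- k) * of_real (- (\<alpha> * x t) - x t ^ 3)" for t
  have z: "delay_solution a b T x z z1"
    unfolding z_def[abs_def] z1_def[abs_def] by (rule delay_solution_lincomb[OF y velocity_solution])
  have zrep: "z (t + \<tau>) = - 1 * z t" "z1 (t + \<tau>) = - 1 * z1 t" if "-T \<le> t" for t
    unfolding z_def z1_def anti deriv_anti rep[OF that, THEN conjunct1] rep[OF that, THEN conjunct2]
    by (simp_all add: algebra_simps)
  have "z t = 0 \<and> z1 t = 0" if t: "t \<in> {-T..0}" for t
  proof (rule ccontr)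
    assume nz: "\<not> (z t = 0 \<and> z1 t = 0)"
    then have fl: "floquet_solution (- 1) z z1"
      using z zrep t unfolding floquet_solution_def by auto
    define Y where "Y s = z (\<tau> * s)" for s
    define Y1 where "Y1 s = of_real \<tau> * z1 (\<tau> * s)" for s
    have Y: "hill_solution ?q Y Y1"
      unfolding Y_def[abs_def] Y1_def[abs_def]
    proof (rule scaled_hill[OF _ delay_solutionD(1)[OF z]])
      fix t :: real assume t: "0 \<le> t"
      from delay_solutionD(2)[OF z t]
      show "(z1 has_vector_derivative - ((of_real a + of_real b * inverse ((- 1) ^ n) + of_real (3 * (x t)\<^sup>2)) * z t)) (at t within {0..})"
        unfolding floquet_delay(1)[OF fl t] by (simp add: scaleR_conv_of_real algebra_simps)
    qed simp
    have q: "?q = S.hq 0" by (simp add: detuning_def)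
    obtain \<phi> \<phi>1 where \<phi>: "hill_solution (S.hq 0) \<phi> \<phi>1" "\<phi> 0 = 1" "\<phi>1 0 = 0"
      using hill_solution_exists[OF S.hq_continuous S.hq_bound, of 0 1 0] by auto
    have z10: "z1 0 = 0" unfolding z1_def v0_def[symmetric] using v0 by (simp add: k_def)
    have eq: "Y s = Y 0 * \<phi> s + 0 * \<phi> s \<and> Y1 s = Y 0 * \<phi>1 s + 0 * \<phi>1 s" if "0 \<le> s" for s
      by (rule hill_solution_unique[OF Y[unfolded q] hill_solution_lincomb[OF \<phi>(1) \<phi>(1)] _ _ S.hq_bound that])
         (simp_all add: \<phi> Y1_def z10)
    have "Y1 1 = 0" using zrep(2)[of 0] T0 z10 by (simp add: Y1_def)
    moreover have "\<phi>1 1 \<noteq> 0" by (rule S.monodromy_not_scalar[OF small \<phi>])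
    ultimately have "Y 0 = 0" using eq[of 1] by simp
    then have 0: "Y s = 0" "Y1 s = 0" if "0 \<le> s" for s using eq[OF that] by auto
    have "z (t + T) = 0" "z1 (t + T) = 0"
      using 0[of "(t + T) / \<tau>"] t \<tau>0 by (auto simp: Y_def Y1_def)
    then have "z t = 0" "z1 t = 0" using floquet_delay[OF fl, of "t + T"] t by auto
    then show False using nz by blast
  qed
  then have "y t = k * of_real (deriv x t) + 0 * of_real (deriv x t)
      \<and> y1 t = k * of_real (- (\<alpha> * x t) - x t ^ 3) + 0 * of_real (- (\<alpha> * x t) - x t ^ 3)" if "t \<in> {-T..0}" for t
    using that by (force simp: z_def z1_def)
  from delay_solution_agree[OF y delay_solution_lincomb[OF velocity_solution velocity_solution] this]
  show ?thesis using that[of k] by auto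
qed

lemma velocity_eigenvector:
  "complexify (monodromy a b T x (2 * \<tau>)) (cscale c velocity) = cscale c velocity"
proof -
  let ?v = "\<lambda>t. complex_of_real (deriv x t)" and ?v1 = "\<lambda>t. complex_of_real (- (\<alpha> * x t) - x t ^ 3)"
  have sol: "delay_solution a b T x (\<lambda>t. c * ?v t + 0 * ?v t) (\<lambda>t. c * ?v1 t + 0 * ?v1 t)"
    by (rule delay_solution_lincomb[OF velocity_solution velocity_solution])
  have eq: "cscale c velocity = segment T (\<lambda>t. (c * ?v t + 0 * ?v t, c * ?v1 t + 0 * ?v1 t)) 0"
    by (auto simp: cscale_def velocity_def segment_def fun_eq_iff zero_prod_def)
  have "cscale c velocity \<in> phase_space T"
    unfolding eq by (rule C.segment_phase_space[OF sol]) simp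
  then have "complexify (monodromy a b T x (2 * \<tau>)) (cscale c velocity) =
      segment T (\<lambda>t. (c * ?v t + 0 * ?v t, c * ?v1 t + 0 * ?v1 t)) (2 * \<tau>)"
    by (rule C.complexify_monodromy[OF _ sol]) (use \<tau>0 in \<open>auto simp: eq segment_def\<close>)
  also have "\<dots> = cscale c velocity"
  proof -
    have "2 * \<tau> + \<theta> = \<theta> + \<tau> + \<tau>" for \<theta> by simp
    then have "deriv x (2 * \<tau> + \<theta>) = deriv x \<theta>" "x (2 * \<tau> + \<theta>) = x \<theta>" for \<theta>
      by (simp_all only: anti deriv_anti minus_minus)
    then show ?thesis unfolding eq by (simp add: segment_def fun_eq_iff)
  qed
  finally show ?thesis .
qed

text \<open>With \<open>c = 0\<close> this concerns eigenvectors, otherwise the next vector of a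
  Jordan chain; one argument excludes the chain and identifies the eigenvector.\<close>

lemma eigenvalue_one_chain:
  assumes no1: "\<And>w w1. \<not> floquet_solution 1 w w1"
    and \<phi>: "\<phi> \<in> phase_space T"
    and chain: "complexify (monodromy a b T x (2 * \<tau>)) \<phi> - cscale 1 \<phi> = cscale c velocity"
  obtains k where "\<phi> = cscale k velocity"
proof -
  let ?v = "\<lambda>t. complex_of_real (deriv x t)" and ?v1 = "\<lambda>t. complex_of_real (- (\<alpha> * x t) - x t ^ 3)"
  note vs = velocity_solution
  obtain y y1 where y: "delay_solution a b T x y y1" and hist: "\<And>t. t \<in> {-T..0} \<Longrightarrow> \<phi> t = (y t, y1 t)"
    using C.delay_solution_exists[OF \<phi>] by blast
  have "segment T (\<lambda>t. (y t, y1 t)) (2 * \<tau>) - cscale 1 \<phi> = cscale c velocity"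
    using C.complexify_monodromy[OF \<phi> y hist, of "2 * \<tau>"] chain \<tau>0 by simp
  then have "(segment T (\<lambda>t. (y t, y1 t)) (2 * \<tau>) - cscale 1 \<phi>) t = cscale c velocity t" for t by simp
  then have eq: "y (t + 2 * \<tau>) = 1 * y t + c * ?v t \<and> y1 (t + 2 * \<tau>) = 1 * y1 t + c * ?v1 t" if "t \<in> {-T..0}" for t
    using hist[OF that] that
    by (auto simp: segment_def cscale_def velocity_def algebra_simps dest!: meta_spec[of _ t])
  have y2: "y (t + 2 * \<tau>) = y t + c * ?v t" "y1 (t + 2 * \<tau>) = y1 t + c * ?v1 t" if "-T \<le> t" for t
    using delay_solution_agree[OF delay_solution_shift[OF y _ square_periodic(2)] delay_solution_lincomb[OF y vs] eq that] \<tau>0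
    by auto
  \<comment> \<open>Let S be the shift by \<tau> and v the velocity, so S v = - v. From
    \<open>S\<^sup>2 y - y = c v\<close> it follows that \<open>z = S y + y + (c / 2) v\<close>
    satisfies S z = z, hence vanishes by \<open>no1\<close>. This is the relation
    \<open>S y = - y + \<gamma> v\<close> with \<open>\<gamma> = - c / 2\<close>.\<close>
  define z where "z t = 1 * (1 * y (t + \<tau>) + 1 * y t) + c / 2 * ?v t" for t
  define z1 where "z1 t = 1 * (1 * y1 (t + \<tau>) + 1 * y1 t) + c / 2 * ?v1 t" for t
  have z: "delay_solution a b T x z z1"
    unfolding z_def[abs_def] z1_def[abs_def]
    by (intro delay_solution_lincomb delay_solution_shift y vs square_periodic) (use \<tau>0 in simp)
  have "z (t + \<tau>) = 1 * z t \<and> z1 (t + \<tau>) = 1 * z1 t" if "-T \<le> t" for t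
  proof -
    have e: "t + \<tau> + \<tau> = t + 2 * \<tau>" by simp
    show ?thesis unfolding z_def z1_def anti deriv_anti e y2[OF that] by (simp add: field_simps)
  qed
  then have z0: "z t = 0 \<and> z1 t = 0" if "t \<in> {-T..0}" for t
    using no1[of z z1] z that unfolding floquet_solution_def by auto
  define \<gamma> where "\<gamma> = - c / 2"
  have "y (t + \<tau>) = (- 1) * y t + \<gamma> * ?v t \<and> y1 (t + \<tau>) = (- 1) * y1 t + \<gamma> * ?v1 t" if "t \<in> {-T..0}" for t
  proof -
    have "y (t + \<tau>) - ((- 1) * y t + \<gamma> * ?v t) = 0" "y1 (t + \<tau>) - ((- 1) * y1 t + \<gamma> * ?v1 t) = 0"
      using z0[OF that] unfolding z_def z1_def \<gamma>_def by (simp_all only: mult_1 diff_conv_add_uminus) (simp_all add: algebra_simps)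
    then show ?thesis unfolding right_minus_eq by blast
  qed
  note * = delay_solution_agree[OF delay_solution_shift[OF y _ square_periodic(1)] delay_solution_lincomb[OF y vs] this]
  have y3: "y (t + \<tau>) = - y t + \<gamma> * ?v t" "y1 (t + \<tau>) = - y1 t + \<gamma> * ?v1 t" if "-T \<le> t" for t
    using *[of t] that \<tau>0 by auto
  have "\<gamma> = 0" by (rule no_jordan_chain[OF y y3(1)])
  then obtain k where k: "\<And>t. -T \<le> t \<Longrightarrow> y t = k * ?v t \<and> y1 t = k * ?v1 t"
    using antiperiodic_solution[OF y] y3 by auto
  have "\<phi> t = cscale k velocity t" for t
  proof (cases "t \<in> {-T..0}")
    case True
    then show ?thesis using k[of t] hist[of t] by (simp add: cscale_def velocity_def segment_def)
  next
    case False
    then have "\<phi> t = 0" using \<phi> unfolding phase_space_def by blast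
    then show ?thesis using False by (auto simp: cscale_def velocity_def segment_def zero_prod_def)
  qed
  then show ?thesis using that by blast
qed

lemma multiplicity_one:
  assumes no1: "\<And>w w1. \<not> floquet_solution 1 w w1"
  shows "algebraic_multiplicity a b T x (2 * \<tau>) 1 = 1"
proof -
  interpret vector_space cscale by (rule vector_space_cscale)
  define N where "N = (\<lambda>\<psi>. complexify (monodromy a b T x (2 * \<tau>)) \<psi> - cscale 1 \<psi>)"
  have N_ps: "N \<phi> \<in> phase_space T" if \<phi>: "\<phi> \<in> phase_space T" for \<phi>
  proof -
    obtain y y1 where y: "delay_solution a b T x y y1" and hist: "\<And>t. t \<in> {-T..0} \<Longrightarrow> \<phi> t = (y t, y1 t)"
      using C.delay_solution_exists[OF \<phi>] by blast
    have "complexify (monodromy a b T x (2 * \<tau>)) \<phi> \<in> phase_space T"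
      using C.complexify_monodromy[OF \<phi> y hist] C.segment_phase_space[OF y] \<tau>0 by simp
    then show ?thesis using \<phi>
      unfolding N_def phase_space_def cscale_def by (auto intro!: continuous_intros)
  qed
  \<comment> \<open>Induction along the chain: the image under \<open>N\<close> is a multiple of the
    velocity, and \<open>eigenvalue_one_chain\<close> then gives the same for the vector
    itself.\<close>
  have nilp: "\<exists>k. \<phi> = cscale k velocity" if "\<phi> \<in> phase_space T" "(N ^^ m) \<phi> = 0" for \<phi> m
    using that
  proof (induction m arbitrary: \<phi>)
    case 0
    then show ?case by (intro exI[of _ 0]) (auto simp: cscale_def fun_eq_iff zero_prod_def)
  next
    case (Suc m)
    then have "(N ^^ m) (N \<phi>) = 0" by (simp only: funpow_Suc_right o_apply)
    from Suc.IH[OF N_ps[OF Suc.prems(1)] this] obtain c where "N \<phi> = cscale c velocity" by blast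
    from eigenvalue_one_chain[OF no1 Suc.prems(1) this[unfolded N_def]] show ?case by blast
  qed
  have N0: "N (cscale k velocity) = 0" for k
    unfolding N_def velocity_eigenvector by (simp add: cscale_def)
  have ps: "cscale k velocity \<in> phase_space T" for k
    using velocity_phase_space unfolding phase_space_def cscale_def
    by (auto intro!: continuous_intros simp: zero_prod_def)
  have "generalized_eigenspace a b T x (2 * \<tau>) 1 = span {velocity}"
  proof
    show "generalized_eigenspace a b T x (2 * \<tau>) 1 \<subseteq> span {velocity}"
      using nilp unfolding generalized_eigenspace_def N_def[symmetric] span_singleton by blast
    show "span {velocity} \<subseteq> generalized_eigenspace a b T x (2 * \<tau>) 1"
      using ps N0 unfolding generalized_eigenspace_def N_def[symmetric] span_singleton
      by (auto intro!: exI[of _ 1])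
  qed
  moreover have "independent {velocity}"
    using velocity_nonzero by (simp add: dependent_single)
  ultimately show ?thesis
    unfolding algebraic_multiplicity_def by (simp add: dim_eq_card_independent)
qed

lemma stable_if_trivial:
  assumes triv: "\<And>\<rho> w w1. floquet_solution \<rho> w w1 \<Longrightarrow> 1 \<le> cmod \<rho> \<Longrightarrow> \<rho> = - 1"
  shows "linearly_stable a b T x (2 * \<tau>)"
  unfolding linearly_stable_def
proof (intro conjI ballI impI)
  show "algebraic_multiplicity a b T x (2 * \<tau>) 1 = 1"
    using triv[of 1] by (intro multiplicity_one) auto
  fix \<mu> assume \<mu>: "\<mu> \<in> floquet_multipliers a b T x (2 * \<tau>)" "\<mu> \<noteq> 1"
  show "cmod \<mu> < 1"
  proof (rule ccontr)
    assume "\<not> cmod \<mu> < 1"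
    obtain \<rho> w w1 where \<rho>: "\<rho>\<^sup>2 = \<mu>" "floquet_solution \<rho> w w1" using multiplier_floquet[OF \<mu>(1)] .
    have "1 \<le> (cmod \<rho>)\<^sup>2" using \<open>\<not> cmod \<mu> < 1\<close> \<rho>(1) by (auto simp: norm_power)
    then have "1 \<le> cmod \<rho>" by (metis abs_norm_cancel abs_square_less_1 not_le)
    from triv[OF \<rho>(2) this] show False using \<rho>(1) \<mu>(2) by simp
  qed
qed

section \<open>From the trace estimate to stability and instability for large n\<close>

lemma detuning_bound:
  assumes "1 \<le> cmod \<sigma>"
  shows "cmod (detuning \<sigma>) \<le> 2 * \<bar>\<beta>\<bar> / (real n)\<^sup>2"
proof -
  have "cmod (inverse (\<sigma> ^ n)) \<le> 1"
    using assms by (simp add: norm_inverse norm_power inverse_le_1_iff one_le_power)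
  then have "cmod (inverse (\<sigma> ^ n) - 1) \<le> 2" using norm_triangle_ineq4[of "inverse (\<sigma> ^ n)" 1] by simp
  then have "\<bar>\<beta>\<bar> / (real n)\<^sup>2 * cmod (inverse (\<sigma> ^ n) - 1) \<le> \<bar>\<beta>\<bar> / (real n)\<^sup>2 * 2"
    by (intro mult_left_mono) auto
  then show ?thesis by (simp add: detuning_def norm_mult norm_divide norm_power mult.commute)
qed

text \<open>Both small parameters are of order \<open>1 / n\<^sup>2\<close>, so for large n the
  factor \<open>trace_const * (\<bar>\<delta>\<bar> + \<bar>\<eta>\<bar>)\<close> is below any
  prescribed relative tolerance \<epsilon>.\<close>

lemma trace_detuning:
  assumes \<sigma>: "1 \<le> cmod \<sigma>"
    and big: "2 * \<bar>\<beta>\<bar> \<le> real n" "trace_const * (2 * \<bar>\<beta>\<bar> + T\<^sup>2 * \<bar>\<alpha>\<bar>) \<le> \<epsilon> * real n"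
    and \<phi>: "hill_solution (S.hq (detuning \<sigma>)) \<phi> \<phi>1" "\<phi> 0 = 1" "\<phi>1 0 = 0"
    and \<psi>: "hill_solution (S.hq (detuning \<sigma>)) \<psi> \<psi>1" "\<psi> 0 = 0" "\<psi>1 0 = 1"
  shows "cmod (\<phi> 1 + \<psi>1 1 + 2 - detuning \<sigma> / 3) \<le> \<epsilon> * cmod (detuning \<sigma>)" "cmod (detuning \<sigma>) \<le> 1"
proof -
  let ?d = "cmod (detuning \<sigma>)"
  have n1: "1 \<le> real n" using n by simp
  have nn: "real n \<le> (real n)\<^sup>2" using mult_left_mono[OF n1, of "real n"] by (simp add: power2_eq_square)
  have d: "?d \<le> 2 * \<bar>\<beta>\<bar> / (real n)\<^sup>2" by (rule detuning_bound[OF \<sigma>])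
  also have "\<dots> \<le> 2 * \<bar>\<beta>\<bar> / real n" using n1 nn by (intro divide_left_mono) auto
  finally have d': "?d \<le> 2 * \<bar>\<beta>\<bar> / real n" .
  also have "\<dots> \<le> 1" using big(1) n1 by simp
  finally show d1: "?d \<le> 1" .
  have "\<bar>\<tau>\<^sup>2 * \<alpha>\<bar> = T\<^sup>2 * \<bar>\<alpha>\<bar> / (real n)\<^sup>2" by (simp add: \<tau> abs_mult power_divide)
  also have "\<dots> \<le> T\<^sup>2 * \<bar>\<alpha>\<bar> / real n" using n1 nn by (intro divide_left_mono) auto
  finally have "?d + \<bar>\<tau>\<^sup>2 * \<alpha>\<bar> \<le> (2 * \<bar>\<beta>\<bar> + T\<^sup>2 * \<bar>\<alpha>\<bar>) / real n"
    using d' by (simp add: add_divide_distrib)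
  then have "trace_const * (?d + \<bar>\<tau>\<^sup>2 * \<alpha>\<bar>) \<le> trace_const * ((2 * \<bar>\<beta>\<bar> + T\<^sup>2 * \<bar>\<alpha>\<bar>) / real n)"
    by (intro mult_left_mono) (simp_all add: trace_const_def)
  also have "\<dots> \<le> \<epsilon>" using big(2) n1 by (simp add: pos_divide_le_eq)
  finally have "?d * (trace_const * (?d + \<bar>\<tau>\<^sup>2 * \<alpha>\<bar>)) \<le> ?d * \<epsilon>" by (intro mult_left_mono) auto
  then show "cmod (\<phi> 1 + \<psi>1 1 + 2 - detuning \<sigma> / 3) \<le> \<epsilon> * ?d"
    using S.trace_estimate[OF d1 \<phi> \<psi>] by (simp add: mult_ac)
qed

lemma detuning_scale_le_1:
  assumes "2 * \<bar>\<beta>\<bar> \<le> real n" shows "2 * \<bar>\<beta>\<bar> / (real n)\<^sup>2 \<le> 1"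
proof -
  have n1: "1 \<le> real n" using n by simp
  have "real n * 1 \<le> real n * real n" using n1 by (intro mult_left_mono) auto
  then have "2 * \<bar>\<beta>\<bar> \<le> 1 * (real n)\<^sup>2" using assms unfolding power2_eq_square by linarith
  then show ?thesis using n by (subst pos_divide_le_eq) auto
qed

lemma standard_solutions:
  assumes "cmod \<delta> \<le> 1"
  obtains \<phi> \<phi>1 \<psi> \<psi>1 where "hill_solution (S.hq \<delta>) \<phi> \<phi>1" "\<phi> 0 = 1" "\<phi>1 0 = 0"
    "hill_solution (S.hq \<delta>) \<psi> \<psi>1" "\<psi> 0 = 0" "\<psi>1 0 = 1"
  using hill_solution_exists[OF S.hq_continuous S.hq_bound[OF assms], of 1 0]
    hill_solution_exists[OF S.hq_continuous S.hq_bound[OF assms], of 0 1] by metis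

lemma stable_case:
  assumes big: "2 * \<bar>\<beta>\<bar> \<le> real n" "trace_const * (2 * \<bar>\<beta>\<bar> + T\<^sup>2 * \<bar>\<alpha>\<bar>) \<le> \<epsilon> * real n"
    and none: "\<And>\<sigma> \<delta>. \<lbrakk>1 \<le> cmod \<sigma>; \<delta> = of_real (\<beta> / (real n)\<^sup>2) * (inverse (\<sigma> ^ n) - 1);
        cmod ((\<sigma> - 1)\<^sup>2 / \<sigma> + \<delta> / 3) \<le> \<epsilon> * cmod \<delta>\<rbrakk> \<Longrightarrow> \<sigma> = 1"
  shows "linearly_stable a b T x (2 * \<tau>)"
proof (rule stable_if_trivial)
  fix \<rho> w w1 assume w: "floquet_solution \<rho> w w1" and r: "1 \<le> cmod \<rho>"
  let ?\<delta> = "detuning (- \<rho>)"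
  have r0: "\<rho> \<noteq> 0" using r by auto
  have r1: "1 \<le> cmod (- \<rho>)" using r by simp
  have d1: "cmod ?\<delta> \<le> 1"
    using detuning_bound[OF r1] detuning_scale_le_1[OF big(1)] by linarith
  obtain \<phi> \<phi>1 \<psi> \<psi>1 where \<phi>: "hill_solution (S.hq ?\<delta>) \<phi> \<phi>1" "\<phi> 0 = 1" "\<phi>1 0 = 0"
    and \<psi>: "hill_solution (S.hq ?\<delta>) \<psi> \<psi>1" "\<psi> 0 = 0" "\<psi>1 0 = 1"
    using standard_solutions[OF d1] .
  define D where "D = \<phi> 1 + \<psi>1 1"
  have q: "\<rho>\<^sup>2 - D * \<rho> + 1 = 0"
    unfolding D_def by (rule floquet_quadratic[OF w d1 \<phi> \<psi>])
  \<comment> \<open>The quadratic equation in terms of \<open>\<sigma> = - \<rho>\<close>: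
    \<open>(\<sigma> - 1)\<^sup>2 / \<sigma>\<close> is minus the trace, minus 2.\<close>
  have "(- \<rho> - 1)\<^sup>2 = (- (D + 2)) * (- \<rho>)"
    using q by (simp add: power2_eq_square algebra_simps)
  then have "(- \<rho> - 1)\<^sup>2 / (- \<rho>) = - (D + 2)" using r0 by simp
  then have "cmod ((- \<rho> - 1)\<^sup>2 / (- \<rho>) + ?\<delta> / 3) = cmod (D + 2 - ?\<delta> / 3)"
    by (metis minus_diff_eq norm_minus_cancel diff_conv_add_uminus add.commute)
  also have "\<dots> \<le> \<epsilon> * cmod ?\<delta>"
    unfolding D_def by (rule trace_detuning(1)[OF r1 big \<phi> \<psi>])
  finally have "- \<rho> = 1" by (rule none[OF r1 detuning_def])
  then show "\<rho> = - 1" by (metis minus_minus)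
qed

text \<open>For real \<sigma> > 1 the detuning \<open>s \<sigma>\<close> is negative and pushes the
  trace below -2 by at least \<open>\<bar>s \<sigma>\<bar> / 6\<close>. Just above 1 this beats the
  quadratically small excess of \<open>\<sigma> + 1 / \<sigma>\<close> over 2, whereas at 3 the
  excess wins; in between the two balance.\<close>

lemma unstable_case:
  assumes \<beta>: "0 < \<beta>"
    and big: "2 * \<bar>\<beta>\<bar> \<le> real n" "trace_const * (2 * \<bar>\<beta>\<bar> + T\<^sup>2 * \<bar>\<alpha>\<bar>) \<le> 1 / 6 * real n"
  shows "linearly_unstable a b T x (2 * \<tau>)"
proof -
  have n1: "1 \<le> real n" using n by simp
  \<comment> \<open>Outside the unit ball only the initial values are prescribed, because
    \<open>continuous_on_parameter\<close> wants them for every \<delta>.\<close>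
  have "\<forall>\<delta>. \<exists>\<phi> \<phi>1 \<psi> \<psi>1. (cmod \<delta> \<le> 1 \<longrightarrow> hill_solution (S.hq \<delta>) \<phi> \<phi>1 \<and> hill_solution (S.hq \<delta>) \<psi> \<psi>1)
      \<and> \<phi> 0 = 1 \<and> \<phi>1 0 = 0 \<and> \<psi> 0 = 0 \<and> \<psi>1 0 = 1"
  proof
    fix \<delta>
    show "\<exists>\<phi> \<phi>1 \<psi> \<psi>1. (cmod \<delta> \<le> 1 \<longrightarrow> hill_solution (S.hq \<delta>) \<phi> \<phi>1 \<and> hill_solution (S.hq \<delta>) \<psi> \<psi>1)
      \<and> \<phi> 0 = 1 \<and> \<phi>1 0 = 0 \<and> \<psi> 0 = 0 \<and> \<psi>1 0 = 1"
    proof (cases "cmod \<delta> \<le> 1")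
      case True
      then show ?thesis using standard_solutions[OF True] by metis
    next
      case False
      then show ?thesis by (intro exI[of _ "\<lambda>_. 1"] exI[of _ "\<lambda>_. 0"]) auto
    qed
  qed
  then obtain \<phi> \<phi>1 \<psi> \<psi>1 where hs: "\<And>\<delta>. cmod \<delta> \<le> 1 \<Longrightarrow> hill_solution (S.hq \<delta>) (\<phi> \<delta>) (\<phi>1 \<delta>)"
      "\<And>\<delta>. cmod \<delta> \<le> 1 \<Longrightarrow> hill_solution (S.hq \<delta>) (\<psi> \<delta>) (\<psi>1 \<delta>)"
    and h0: "\<And>\<delta>. \<phi> \<delta> 0 = 1" "\<And>\<delta>. \<phi>1 \<delta> 0 = 0" "\<And>\<delta>. \<psi> \<delta> 0 = 0" "\<And>\<delta>. \<psi>1 \<delta> 0 = 1"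
    by metis
  define D where "D \<delta> = \<phi> \<delta> 1 + \<psi>1 \<delta> 1" for \<delta>
  have Dc: "continuous_on (cball 0 1) D" unfolding D_def[abs_def]
    by (intro continuous_on_add S.continuous_on_parameter(1)[OF hs(1) h0(1,2)]
        S.continuous_on_parameter(2)[OF hs(2) h0(3,4)])
  define s where "s \<sigma> = \<beta> / (real n)\<^sup>2 * (inverse (\<sigma> ^ n) - 1)" for \<sigma> :: real
  have det: "detuning (of_real \<sigma>) = of_real (s \<sigma>)" for \<sigma> by (simp add: detuning_def s_def)
  have bounds: "\<bar>Re (D (of_real (s \<sigma>))) + 2 - s \<sigma> / 3\<bar> \<le> 1 / 6 * \<bar>s \<sigma>\<bar>" "\<bar>s \<sigma>\<bar> \<le> 1"
    "Im (D (of_real (s \<sigma>))) = 0" if \<sigma>: "1 \<le> \<sigma>" for \<sigma>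
  proof -
    have \<sigma>': "1 \<le> cmod (of_real \<sigma>)" using \<sigma> by simp
    have d1: "cmod (of_real (s \<sigma>)) \<le> 1"
      using detuning_bound[OF \<sigma>'] detuning_scale_le_1[OF big(1)] unfolding det by linarith
    then show "\<bar>s \<sigma>\<bar> \<le> 1" by simp
    have "cmod (D (of_real (s \<sigma>)) + 2 - of_real (s \<sigma>) / 3) \<le> 1 / 6 * cmod (of_real (s \<sigma>))"
      using trace_detuning(1)[OF \<sigma>' big, unfolded det, OF hs(1)[OF d1] h0(1,2) hs(2)[OF d1] h0(3,4)]
      by (simp add: D_def)
    moreover have "\<bar>Re (D (of_real (s \<sigma>)) + 2 - of_real (s \<sigma>) / 3)\<bar> \<le> cmod (D (of_real (s \<sigma>)) + 2 - of_real (s \<sigma>) / 3)"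
      by (rule abs_Re_le_cmod)
    moreover have "Re (D (of_real (s \<sigma>)) + 2 - of_real (s \<sigma>) / 3) = Re (D (of_real (s \<sigma>))) + 2 - s \<sigma> / 3" by simp
    ultimately show "\<bar>Re (D (of_real (s \<sigma>))) + 2 - s \<sigma> / 3\<bar> \<le> 1 / 6 * \<bar>s \<sigma>\<bar>" by simp
    show "Im (D (of_real (s \<sigma>))) = 0"
      using S.hill_real_at_1(1)[OF hs(1)[OF d1] d1] S.hill_real_at_1(2)[OF hs(2)[OF d1] d1]
      by (simp add: D_def h0)
  qed
  define G where "G \<sigma> = Re (D (of_real (s \<sigma>))) + \<sigma> + 1 / \<sigma>" for \<sigma>
  \<comment> \<open>With \<open>e = \<sigma>0 - 1\<close> one has
    \<open>\<bar>s \<sigma>0\<bar> \<ge> 12 * e\<^sup>2 / \<sigma>0\<close>, so the trace is below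
    -2 by at least \<open>2 * e\<^sup>2 / \<sigma>0\<close>, twice the excess
    \<open>e\<^sup>2 / \<sigma>0\<close>.\<close>
  define \<sigma>0 where "\<sigma>0 = 1 + \<beta> / (12 * (real n)\<^sup>2)"
  have \<sigma>0: "1 < \<sigma>0" using \<beta> n1 by (simp add: \<sigma>0_def)
  have "\<beta> / (12 * (real n)\<^sup>2) \<le> 2 * \<bar>\<beta>\<bar> / (real n)\<^sup>2" using n1 by (intro frac_le) auto
  then have "\<beta> / (12 * (real n)\<^sup>2) \<le> 1" using detuning_scale_le_1[OF big(1)] by linarith
  then have \<sigma>03: "\<sigma>0 \<le> 3" by (simp add: \<sigma>0_def)
  have neg: "s \<sigma> \<le> 0" if "1 \<le> \<sigma>" for \<sigma>
    unfolding s_def using \<beta> that by (intro mult_nonneg_nonpos) (auto simp: inverse_le_1_iff one_le_power)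
  have "G \<sigma>0 \<le> 0"
  proof -
    let ?e = "\<beta> / (12 * (real n)\<^sup>2)"
    have "\<sigma>0 ^ 1 \<le> \<sigma>0 ^ n" using \<sigma>0 n by (intro power_increasing) auto
    then have "inverse (\<sigma>0 ^ n) \<le> inverse \<sigma>0" using \<sigma>0 by (intro le_imp_inverse_le) auto
    then have "\<beta> / (real n)\<^sup>2 * (1 - inverse \<sigma>0) \<le> \<beta> / (real n)\<^sup>2 * (1 - inverse (\<sigma>0 ^ n))"
      using \<beta> by (intro mult_left_mono) auto
    also have "\<dots> = \<bar>s \<sigma>0\<bar>" using neg[of \<sigma>0] \<sigma>0 by (simp add: s_def right_diff_distrib)
    also have "\<beta> / (real n)\<^sup>2 * (1 - inverse \<sigma>0) = 12 * ?e * (?e / \<sigma>0)"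
    proof -
      have e: "?e = \<sigma>0 - 1" by (simp add: \<sigma>0_def)
      have "1 - inverse \<sigma>0 = ?e / \<sigma>0" unfolding e using \<sigma>0 by (simp add: field_simps)
      moreover have "\<beta> / (real n)\<^sup>2 = 12 * ?e" by simp
      ultimately show ?thesis by (simp only:)
    qed
    finally have abs: "12 * (?e * (?e / \<sigma>0)) \<le> \<bar>s \<sigma>0\<bar>" by (simp only: mult.assoc)
    have "Re (D (of_real (s \<sigma>0))) + 2 \<le> - \<bar>s \<sigma>0\<bar> / 6"
      using bounds(1)[of \<sigma>0] neg[of \<sigma>0] \<sigma>0 by linarith
    moreover have "\<sigma>0 + 1 / \<sigma>0 - 2 = ?e * (?e / \<sigma>0)"
    proof -
      have e: "?e = \<sigma>0 - 1" by (simp add: \<sigma>0_def)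
      show ?thesis unfolding e using \<sigma>0 by (simp add: field_simps power2_eq_square)
    qed
    moreover have "0 \<le> ?e * (?e / \<sigma>0)" using \<beta> \<sigma>0 by (intro mult_nonneg_nonneg divide_nonneg_nonneg) auto
    ultimately show ?thesis unfolding G_def using abs by linarith
  qed
  moreover have "0 \<le> G 3"
  proof -
    have "- 1 \<le> Re (D (of_real (s 3))) + 2" using bounds(1,2)[of 3] by linarith
    then show ?thesis by (simp add: G_def)
  qed
  moreover have "continuous_on {\<sigma>0..3} G"
  proof -
    have "continuous_on {\<sigma>0..3} (\<lambda>\<sigma>. D (of_real (s \<sigma>)))"
    proof (rule continuous_on_compose2[OF Dc])
      show "continuous_on {\<sigma>0..3} (\<lambda>\<sigma>. complex_of_real (s \<sigma>))"
        unfolding s_def using \<sigma>0 n by (intro continuous_intros) auto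
      show "(\<lambda>\<sigma>. complex_of_real (s \<sigma>)) ` {\<sigma>0..3} \<subseteq> cball 0 1"
        using bounds(2) \<sigma>0 by auto
    qed
    then show ?thesis unfolding G_def[abs_def] using \<sigma>0 by (intro continuous_intros) auto
  qed
  ultimately obtain \<sigma> where \<sigma>: "\<sigma>0 \<le> \<sigma>" "G \<sigma> = 0"
    using IVT'[of G \<sigma>0 0 3] \<sigma>03 by auto
  then have \<sigma>1: "1 < \<sigma>" using \<sigma>0 by simp
  have d1: "cmod (of_real (s \<sigma>)) \<le> 1" using bounds(2)[of \<sigma>] \<sigma>1 by simp
  have tr: "\<phi> (of_real (s \<sigma>)) 1 + \<psi>1 (of_real (s \<sigma>)) 1 = - of_real (\<sigma> + 1 / \<sigma>)"
    using \<sigma>(2) bounds(3)[of \<sigma>] \<sigma>1 by (simp add: G_def D_def[symmetric] complex_eq_iff)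
  show ?thesis
    by (rule unstable_if_root[OF \<sigma>1, unfolded det, OF d1 hs(1)[OF d1] h0(1,2) hs(2)[OF d1] h0(3,4) tr])
qed

end

text \<open>For a fixed parity the coefficient \<alpha> and the constant \<beta> do not depend on n,
  so that finitely many largeness conditions suffice.\<close>

lemma eventually_stability:
  fixes a b T sg :: real
  assumes b: "b \<noteq> 0" and T: "0 < T" and sg: "sg = 1 \<or> sg = - 1"
  shows "\<exists>N. \<forall>n\<ge>N. (-1) ^ n = sg \<longrightarrow> - (sg * b * T\<^sup>2) < 3/2 * pi\<^sup>2 \<longrightarrow>
    (\<exists>!x. normalized_duffing_orbit (a + sg * b) (2 * T / real n) x) \<and>
    (\<forall>x. normalized_duffing_orbit (a + sg * b) (2 * T / real n) x \<longrightarrow>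
       delayed_duffing_solution a b T x \<and>
       (linearly_stable a b T x (2 * T / real n) \<longleftrightarrow> sg * b < 0) \<and>
       (linearly_unstable a b T x (2 * T / real n) \<longleftrightarrow> sg * b > 0))"
proof -
  define \<alpha> where "\<alpha> = a + sg * b"
  define bt where "bt = sg * b * T\<^sup>2"
  have sgb: "sg * b \<noteq> 0" using b sg by auto
  have bt_sign: "bt < 0 \<longleftrightarrow> sg * b < 0" "0 < bt \<longleftrightarrow> 0 < sg * b"
    using T by (simp_all add: bt_def mult_less_0_iff zero_less_mult_iff)
  \<comment> \<open>A single \<epsilon> serves both signs: it is capped at 1/6 for the unstable
    case, and the statement about \<sigma> is vacuous there.\<close>
  obtain \<epsilon> :: real and N1 where \<epsilon>: "0 < \<epsilon>" "\<epsilon> \<le> 1 / 6"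
    and N1: "\<And>n \<sigma> \<delta>. \<lbrakk>bt < 0; - bt < 3/2 * pi\<^sup>2; N1 \<le> n; 1 \<le> cmod \<sigma>;
        \<delta> = of_real (bt / (real n)\<^sup>2) * (inverse (\<sigma> ^ n) - 1);
        cmod ((\<sigma> - 1)\<^sup>2 / \<sigma> + \<delta> / 3) \<le> \<epsilon> * cmod \<delta>\<rbrakk> \<Longrightarrow> \<sigma> = 1"
  proof (cases "bt < 0 \<and> - bt < 3/2 * pi\<^sup>2")
    case True
    then obtain \<epsilon> N where \<epsilon>: "0 < \<epsilon>" and N: "\<And>n \<sigma> \<delta>. \<lbrakk>N \<le> n; 1 \<le> cmod \<sigma>;
        \<delta> = of_real (bt / (real n)\<^sup>2) * (inverse (\<sigma> ^ n) - 1);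
        cmod ((\<sigma> - 1)\<^sup>2 / \<sigma> + \<delta> / 3) \<le> \<epsilon> * cmod \<delta>\<rbrakk> \<Longrightarrow> \<sigma> = 1"
      using no_unstable_multiplier by metis
    show ?thesis
    proof (rule that[of "min \<epsilon> (1 / 6)" N])
      fix n :: nat and \<sigma> \<delta> :: complex
      assume *: "N \<le> n" "1 \<le> cmod \<sigma>" "\<delta> = of_real (bt / (real n)\<^sup>2) * (inverse (\<sigma> ^ n) - 1)"
        and "cmod ((\<sigma> - 1)\<^sup>2 / \<sigma> + \<delta> / 3) \<le> min \<epsilon> (1 / 6) * cmod \<delta>"
      moreover have "min \<epsilon> (1 / 6) * cmod \<delta> \<le> \<epsilon> * cmod \<delta>" by (intro mult_right_mono) auto
      ultimately show "\<sigma> = 1" by (intro N[OF *]) linarith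
    qed (use \<epsilon> in auto)
  next
    case False
    then show ?thesis by (intro that[of "1 / 6" 0]) auto
  qed
  \<comment> \<open>Any amplitude with positive phase speed would do; for \<tau> below its half
    period the orbit exists.\<close>
  define A0 where "A0 = sqrt (2 * (\<bar>\<alpha>\<bar> + 1))"
  have "A0\<^sup>2 / 2 = \<bar>\<alpha>\<bar> + 1" unfolding A0_def by simp
  then have "0 < \<alpha> + A0\<^sup>2 / 2" by linarith
  moreover have "0 < A0" by (simp add: A0_def)
  ultimately have A0: "0 < A0" "0 < \<alpha> + A0\<^sup>2 / 2" by auto
  have K0: "0 < half_period \<alpha> A0"
    using half_period_bounds(1)[OF A0(2)] less_le_trans[OF phase_speed_pos[OF A0(2)] phase_speed_bounds(2)]
    by (meson divide_pos_pos pi_gt_zero less_le_trans)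
  define c where "c = trace_const * (2 * \<bar>bt\<bar> + T\<^sup>2 * \<bar>\<alpha>\<bar>)"
  have c: "0 \<le> c" unfolding c_def trace_const_def by (intro mult_nonneg_nonneg add_nonneg_nonneg) auto
  \<comment> \<open>A sum of nonnegative thresholds dominates each: existence of the orbit,
    \<open>\<bar>\<delta>\<bar> \<le> 1\<close>, the relative trace error, smallness of \<eta> for
    \<open>monodromy_not_scalar\<close>, and \<open>n \<ge> 1\<close>.\<close>
  obtain N2 :: nat where N2: "T / half_period \<alpha> A0 + 2 * \<bar>bt\<bar> + c / \<epsilon> + T\<^sup>2 * \<bar>\<alpha>\<bar> * 5 * exp 79 + 1 \<le> real N2"
    using real_arch_simple by blast
  show ?thesis
  proof (intro exI[of _ "max N1 N2"] allI impI)
    fix n :: nat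
    assume n: "max N1 N2 \<le> n" and par: "(-1) ^ n = sg" and lim: "- (sg * b * T\<^sup>2) < 3/2 * pi\<^sup>2"
    have nN: "N1 \<le> n" using n by simp
    have nonneg: "0 \<le> T / half_period \<alpha> A0" "0 \<le> 2 * \<bar>bt\<bar>" "0 \<le> c / \<epsilon>" "0 \<le> T\<^sup>2 * \<bar>\<alpha>\<bar> * 5 * exp 79"
      using T K0 \<epsilon> c by auto
    have "real N2 \<le> real n" using n by simp
    then have big: "T / half_period \<alpha> A0 + 1 \<le> real n" "2 * \<bar>bt\<bar> \<le> real n" "c / \<epsilon> \<le> real n"
        "T\<^sup>2 * \<bar>\<alpha>\<bar> * 5 * exp 79 \<le> real n" "1 \<le> real n"
      using N2 nonneg by linarith+
    have c\<epsilon>: "c \<le> \<epsilon> * real n" using big(3) \<epsilon> by (simp add: pos_divide_le_eq mult.commute)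
    also have "\<dots> \<le> 1 / 6 * real n" using \<epsilon> by (intro mult_right_mono) auto
    finally have c6: "c \<le> 1 / 6 * real n" .
    define \<tau> where "\<tau> = T / real n"
    have \<tau>0: "0 < \<tau>" using T big(5) by (simp add: \<tau>_def)
    have "T / half_period \<alpha> A0 < real n" using big(1) by linarith
    then have \<tau>K: "\<tau> < half_period \<alpha> A0" using K0 big(5) by (simp add: \<tau>_def field_simps)
    have p: "2 * T / real n = 2 * \<tau>" by (simp add: \<tau>_def)
    have ex: "\<exists>!x. normalized_duffing_orbit \<alpha> (2 * \<tau>) x"
      by (rule normalized_duffing_orbit_ex1[OF A0 \<tau>0 \<tau>K])
    have "real n \<le> (real n)\<^sup>2" using mult_left_mono[OF big(5), of "real n"] by (simp add: power2_eq_square)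
    then have "T\<^sup>2 * \<bar>\<alpha>\<bar> * 5 * exp 79 \<le> (real n)\<^sup>2" using big(4) by linarith
    then have "\<bar>\<tau>\<^sup>2 * \<alpha>\<bar> * 5 * exp 79 \<le> 1"
      using big(5) by (simp add: \<tau>_def abs_mult power_divide field_simps)
    then have orbit: "delayed_orbit a b T \<alpha> \<tau> n x" if "normalized_duffing_orbit \<alpha> (2 * \<tau>) x" for x
      using b T big(5) that by unfold_locales (auto simp: \<tau>_def \<alpha>_def par)
    have "delayed_duffing_solution a b T x \<and> (linearly_stable a b T x (2 * \<tau>) \<longleftrightarrow> sg * b < 0) \<and>
       (linearly_unstable a b T x (2 * \<tau>) \<longleftrightarrow> sg * b > 0)" if x: "normalized_duffing_orbit \<alpha> (2 * \<tau>) x" for x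
    proof -
      interpret delayed_orbit a b T \<alpha> \<tau> n x by (rule orbit[OF x])
      have \<beta>': "delayed_orbit.\<beta> b T n = bt" by (simp add: bt_def \<beta>_def par)
      note c = c_def[symmetric]
      have "sg * b < 0 \<or> 0 < sg * b" using sgb by linarith
      then show ?thesis
      proof
        assume neg: "sg * b < 0"
        have "linearly_stable a b T x (2 * \<tau>)"
        proof (rule stable_case[unfolded \<beta>' c, OF big(2) c\<epsilon>])
          have *: "bt < 0" "- bt < 3/2 * pi\<^sup>2" "N1 \<le> n" using neg bt_sign lim nN by (auto simp: bt_def)
          show "\<sigma> = 1" if "1 \<le> cmod \<sigma>" "\<delta> = of_real (bt / (real n)\<^sup>2) * (inverse (\<sigma> ^ n) - 1)"
            "cmod ((\<sigma> - 1)\<^sup>2 / \<sigma> + \<delta> / 3) \<le> \<epsilon> * cmod \<delta>" for \<sigma> \<delta>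
            by (rule N1[OF * that])
        qed
        then show ?thesis using delayed stable_not_unstable neg by auto
      next
        assume pos: "0 < sg * b"
        then have "0 < bt" using bt_sign by simp
        then have "linearly_unstable a b T x (2 * \<tau>)"
          by (rule unstable_case[unfolded \<beta>' c, OF _ big(2) c6])
        then show ?thesis using delayed stable_not_unstable pos by auto
      qed
    qed
    then show "(\<exists>!x. normalized_duffing_orbit (a + sg * b) (2 * T / real n) x) \<and>
      (\<forall>x. normalized_duffing_orbit (a + sg * b) (2 * T / real n) x \<longrightarrow>
       delayed_duffing_solution a b T x \<and>
       (linearly_stable a b T x (2 * T / real n) \<longleftrightarrow> sg * b < 0) \<and>
       (linearly_unstable a b T x (2 * T / real n) \<longleftrightarrow> sg * b > 0))"
      using ex unfolding p \<alpha>_def[symmetric] by blast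
  qed
qed

theorem theorem1p1:
  fixes a b T :: real
  assumes "b \<noteq> 0" and "T > 0"
  shows "\<exists>n0::nat. \<forall>n\<ge>n0.
    (-1)^(n+1) * b * T^2 < 3/2 * pi^2 \<longrightarrow>
    (a + (-1)^n * b > 0 \<longrightarrow> real n > 1/pi * T * sqrt (a + (-1)^n * b)) \<longrightarrow>
    (\<exists>!x. normalized_duffing_orbit (a + (-1)^n * b) (2 * T / real n) x) \<and>
    (\<forall>x. normalized_duffing_orbit (a + (-1)^n * b) (2 * T / real n) x \<longrightarrow>
       delayed_duffing_solution a b T x \<and>
       (linearly_stable a b T x (2 * T / real n) \<longleftrightarrow> (-1)^n * b < 0) \<and>
       (linearly_unstable a b T x (2 * T / real n) \<longleftrightarrow> (-1)^n * b > 0))"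
proof -
  define P where "P sg n \<longleftrightarrow>
    (\<exists>!x. normalized_duffing_orbit (a + sg * b) (2 * T / real n) x) \<and>
    (\<forall>x. normalized_duffing_orbit (a + sg * b) (2 * T / real n) x \<longrightarrow>
       delayed_duffing_solution a b T x \<and>
       (linearly_stable a b T x (2 * T / real n) \<longleftrightarrow> sg * b < 0) \<and>
       (linearly_unstable a b T x (2 * T / real n) \<longleftrightarrow> sg * b > 0))" for sg :: real and n :: nat
  have ev: "\<exists>N. \<forall>n\<ge>N. (-1) ^ n = sg \<longrightarrow> - (sg * b * T\<^sup>2) < 3/2 * pi\<^sup>2 \<longrightarrow> P sg n"
    if "sg = 1 \<or> sg = - 1" for sg
    unfolding P_def by (rule eventually_stability[OF assms that])
  obtain N where N: "\<And>n. N \<le> n \<Longrightarrow> (-1) ^ n = (1::real) \<Longrightarrow> - (1 * b * T\<^sup>2) < 3/2 * pi\<^sup>2 \<Longrightarrow> P 1 n"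
    using ev[of 1] by blast
  obtain M where M: "\<And>n. M \<le> n \<Longrightarrow> (-1) ^ n = (-1::real) \<Longrightarrow> - ((-1) * b * T\<^sup>2) < 3/2 * pi\<^sup>2 \<Longrightarrow> P (-1) n"
    using ev[of "-1"] by blast
  \<comment> \<open>Even and odd n have separate thresholds, and the larger one covers both.\<close>
  have "P ((-1) ^ n) n" if n: "max N M \<le> n" and lim: "(-1)^(n+1) * b * T^2 < 3/2 * pi^2" for n
    using N[of n] M[of n] n lim by (cases "even n") auto
  then show ?thesis unfolding P_def by blast
qed

end
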